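(* Let $T$ be a Lie triple system and $(V,\theta)$ a representation of $T$. Then the Yamaguti cohomology complex of the Lie triple system $T$ with coefficients in $V$ coincides with the Loday-Pirashvili cohomology complex of the Leibniz algebra $\mathcal{L}=T\otimes T$ with coefficients in $\mathrm{Hom}(T,V)$, with the same coboundary operator.
   Context: All Lie triple systems are over an algebraically closed field $\mathbb{F}$ of characteristic different from 2 and 3. A Lie triple system is a vector space $T$ with a trilinear map $[\cdot,\cdot,\cdot]:T\times T\times T\to T$ such that, for all elements, $[x_1,x_1,x_2]=0$; $[x_1,x_2,x_3]+[x_2,x_3,x_1]+[x_3,x_1,x_2]=0$; and $[x_1,x_2,[y_1,y_2,y_3]]=[[x_1,x_2,y_1],y_2,y_3]+[y_1,[x_1,x_2,y_2],y_3]+[y_1,y_2,[x_1,x_2,y_3]]$. Let $\mathcal{L}=T\otimes T$, write $(x_1,x_2)$ for $x_1\otimes x_2$, and let $(x_1,x_2)\circ(y_1,y_2)=([x_1,x_2,y_1],y_2)+(y_1,[x_1,x_2,y_2])$, extended bilinearly. Then $(\mathcal{L},\circ)$ is a (left) Leibniz algebra: $x\circ(y\circ z)=(x\circ y)\circ z+y\circ(x\circ z)$. A representation $(V,\theta)$ of $T$ is a vector space $V$ with a linear map $\theta:T\otimes T\to\mathrm{End}(V)$ such that, with $D(x_1,x_2):=\theta(x_2,x_1)-\theta(x_1,x_2)$: (R1) $[D(x_1,x_2),\theta(y_1,y_2)]=\theta((x_1,x_2)\circ(y_1,y_2))$ (commutator on the left); (R2) $\theta(x_1,[y_1,y_2,y_3])=\theta(y_2,y_3)\theta(x_1,y_1)-\theta(y_1,y_3)\theta(x_1,y_2)+D(y_1,y_2)\theta(x_1,y_3)$.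 Yamaguti complex: $C^{2n+1}(T,V)$ is the vector space spanned by all $(2n+1)$-linear maps $\omega$ of $T\times\cdots\times T$ into $V$ satisfying $\omega(x_1,\dots,x_{2n-2},x,x,y)=0$ and $\omega(x_1,\dots,x_{2n-2},x,y,z)+\omega(x_1,\dots,x_{2n-2},y,z,x)+\omega(x_1,\dots,x_{2n-2},z,x,y)=0$ (for $n=0$ there is no condition and $C^1(T,V)=\mathrm{Hom}(T,V)$). The Yamaguti coboundary operator $\delta^{2n-1}:C^{2n-1}(T,V)\to C^{2n+1}(T,V)$, $n\ge1$, is $$\begin{aligned}\delta^{2n-1}\omega(x_1,\dots,x_{2n+1})={}&\theta(x_{2n},x_{2n+1})\omega(x_1,\dots,x_{2n-1})-\theta(x_{2n-1},x_{2n+1})\omega(x_1,\dots,x_{2n-2},x_{2n})\\&+\sum_{k=1}^n(-1)^{n+k}D(x_{2k-1},x_{2k})\omega(x_1,\dots,\widehat{x_{2k-1}},\widehat{x_{2k}},\dots,x_{2n+1})\\&+\sum_{k=1}^n\sum_{j=2k+1}^{2n+1}(-1)^{n+k+1}\omega(x_1,\dots,\widehat{x_{2k-1}},\widehat{x_{2k}},\dots,[x_{2k-1},x_{2k},x_j],\dots,x_{2n+1}),\end{aligned}$$ where $[x_{2k-1},x_{2k},x_j]$ replaces $x_j$ and $\widehat{\ }$ denotes omission. The Leibniz algebra $\mathcal{L}$ is represented on $\mathrm{Hom}(T,V)$ by the left and right actions $[(x_1,x_2),\phi]_L(x_3)=D(x_1,x_2)\phi(x_3)-\phi([x_1,x_2,x_3])$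 and $[\phi,(x_1,x_2)]_R(x_3)=\phi([x_1,x_2,x_3])-D(x_1,x_2)\phi(x_3)+\theta(x_1,x_3)\phi(x_2)-\theta(x_2,x_3)\phi(x_1)$. Loday-Pirashvili complex of $\mathcal{L}$ with coefficients in $\mathrm{Hom}(T,V)$: the cochain spaces are $\mathrm{Hom}(\otimes^{n}\mathcal{L},\mathrm{Hom}(T,V))$, $n\ge 0$, and the coboundary of $\omega\in\mathrm{Hom}(\otimes^{n-1}\mathcal{L},\mathrm{Hom}(T,V))$ is $$\begin{aligned}d_{n-1}\omega(x^1,\dots,x^n)={}&\sum_{k=1}^{n-1}(-1)^{k+1}[x^k,\omega(x^1,\dots,\widehat{x^k},\dots,x^n)]_L+(-1)^n[\omega(x^1,\dots,x^{n-1}),x^n]_R\\&+\sum_{1\le k<l\le n}(-1)^k\omega(x^1,\dots,\widehat{x^k},\dots,x^{l-1},x^k\circ x^l,x^{l+1},\dots,x^n).\end{aligned}$$ A $(2n+1)$-linear map $\omega$ from $T$ to $V$ is regarded as an element of $\mathrm{Hom}(\otimes^{n}\mathcal{L},\mathrm{Hom}(T,V))$ via $\omega(x^1,\dots,x^n)(w)=\omega(x_1,\dots,x_{2n},w)$ with $x^k=(x_{2k-1},x_{2k})$.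
   Formalization: "Coincides" is corrected: the Yamaguti complex is identified with the subcomplex of Loday-Pirashvili cochains satisfying the two Yamaguti identities (the full cochain spaces differ in general), and the coboundary operators agree up to the sign (-1)^{n-1}. *)

theory Defs
  imports
    "HOL-Computational_Algebra.Polynomial"
    "HOL-Library.Poly_Mapping"
    "HOL-Library.Function_Algebras"
begin

section \<open>Linear algebra\<close>

definition fun_scale :: "('k \<Rightarrow> 'b \<Rightarrow> 'b) \<Rightarrow> 'k \<Rightarrow> ('x \<Rightarrow> 'b) \<Rightarrow> 'x \<Rightarrow> 'b" where
  "fun_scale s c f = (\<lambda>x. s c (f x))"

definition Hom_space ::
  "('k::field \<Rightarrow> 'a::ab_group_add \<Rightarrow> 'a) \<Rightarrow> ('k \<Rightarrow> 'b::ab_group_add \<Rightarrow> 'b) \<Rightarrow> ('a \<Rightarrow> 'b) set" where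
  "Hom_space sT sV = {\<phi>. Vector_Spaces.linear sT sV \<phi>}"

definition linear_on ::
  "'u::ab_group_add set \<Rightarrow> ('k \<Rightarrow> 'u \<Rightarrow> 'u) \<Rightarrow> ('k \<Rightarrow> 'w::ab_group_add \<Rightarrow> 'w) \<Rightarrow> ('u \<Rightarrow> 'w) \<Rightarrow> bool" where
  "linear_on U s s' f \<longleftrightarrow>
     (\<forall>x\<in>U. \<forall>y\<in>U. f (x + y) = f x + f y) \<and> (\<forall>c. \<forall>x\<in>U. f (s c x) = s' c (f x))"

text \<open>
  A vector space on an explicit carrier. The carrier is needed for \<open>T \<otimes> T\<close>, whose elements
  are cosets and which therefore is not the universe of a type.
\<close>
locale vector_space_on =
  fixes A :: "'l set" and add :: "'l \<Rightarrow> 'l \<Rightarrow> 'l" and zero :: 'l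
    and scale :: "'k::field \<Rightarrow> 'l \<Rightarrow> 'l"
  assumes add_closed: "x \<in> A \<Longrightarrow> y \<in> A \<Longrightarrow> add x y \<in> A"
    and zero_closed: "zero \<in> A"
    and scale_closed: "x \<in> A \<Longrightarrow> scale c x \<in> A"
    and add_assoc: "x \<in> A \<Longrightarrow> y \<in> A \<Longrightarrow> z \<in> A \<Longrightarrow> add (add x y) z = add x (add y z)"
    and add_commute: "x \<in> A \<Longrightarrow> y \<in> A \<Longrightarrow> add x y = add y x"
    and add_zero: "x \<in> A \<Longrightarrow> add zero x = x"
    and add_inverse: "x \<in> A \<Longrightarrow> \<exists>y\<in>A. add x y = zero"
    and scale_add_right: "x \<in> A \<Longrightarrow> y \<in> A \<Longrightarrow> scale c (add x y) = add (scale c x) (scale c y)"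
    and scale_add_left: "x \<in> A \<Longrightarrow> scale (c + d) x = add (scale c x) (scale d x)"
    and scale_scale: "x \<in> A \<Longrightarrow> scale c (scale d x) = scale (c * d) x"
    and scale_one: "x \<in> A \<Longrightarrow> scale 1 x = x"

definition cochain_complex ::
  "('k::field \<Rightarrow> 'c::ab_group_add \<Rightarrow> 'c) \<Rightarrow> (nat \<Rightarrow> 'c set) \<Rightarrow> (nat \<Rightarrow> 'c \<Rightarrow> 'c) \<Rightarrow> bool" where
  "cochain_complex s C d \<longleftrightarrow> vector_space s \<and>
     (\<forall>n. module.subspace s (C n) \<and> linear_on (C n) s s (d n) \<and> d n ` C n \<subseteq> C (Suc n) \<and>
          (\<forall>f\<in>C n. d (Suc n) (d n f) = 0))"


section \<open>The tensor square of a vector space\<close>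

text \<open>
  \<open>T \<otimes> T\<close> is the quotient of the free vector space on \<open>T \<times> T\<close> (finitely supported functions)
  by the span of the bilinearity relations; its elements are the cosets.
\<close>

type_synonym ('k, 'a) tensor2 = "(('a \<times> 'a) \<Rightarrow>\<^sub>0 'k) set"

definition free_scale :: "'k::field \<Rightarrow> ('x \<Rightarrow>\<^sub>0 'k) \<Rightarrow> ('x \<Rightarrow>\<^sub>0 'k)" where
  "free_scale c p = Poly_Mapping.map (\<lambda>a. c * a) p"

abbreviation free_gen :: "'x \<Rightarrow> ('x \<Rightarrow>\<^sub>0 'k::field)" where
  "free_gen x \<equiv> Poly_Mapping.single x 1"

definition tensor_relations ::
  "('k::field \<Rightarrow> 'a::ab_group_add \<Rightarrow> 'a) \<Rightarrow> (('a \<times> 'a) \<Rightarrow>\<^sub>0 'k) set" where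
  "tensor_relations sT = module.span free_scale
     ({free_gen (x + y, z) - free_gen (x, z) - free_gen (y, z) |x y z. True} \<union>
      {free_gen (x, y + z) - free_gen (x, y) - free_gen (x, z) |x y z. True} \<union>
      {free_gen (sT c x, y) - free_scale c (free_gen (x, y)) |c x y. True} \<union>
      {free_gen (x, sT c y) - free_scale c (free_gen (x, y)) |c x y. True})"

definition tensor_class ::
  "('k::field \<Rightarrow> 'a::ab_group_add \<Rightarrow> 'a) \<Rightarrow> (('a \<times> 'a) \<Rightarrow>\<^sub>0 'k) \<Rightarrow> ('k, 'a) tensor2" where
  "tensor_class sT p = {q. q - p \<in> tensor_relations sT}"

definition tensor_space ::
  "('k::field \<Rightarrow> 'a::ab_group_add \<Rightarrow> 'a) \<Rightarrow> ('k, 'a) tensor2 set" where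
  "tensor_space sT = tensor_class sT ` UNIV"

definition tensor ::
  "('k::field \<Rightarrow> 'a::ab_group_add \<Rightarrow> 'a) \<Rightarrow> 'a \<Rightarrow> 'a \<Rightarrow> ('k, 'a) tensor2" where
  "tensor sT x y = tensor_class sT (free_gen (x, y))"

definition tensor_add ::
  "('k::field, 'a::ab_group_add) tensor2 \<Rightarrow> ('k, 'a) tensor2 \<Rightarrow> ('k, 'a) tensor2" where
  "tensor_add X Y = {p + q |p q. p \<in> X \<and> q \<in> Y}"

definition tensor_zero ::
  "('k::field \<Rightarrow> 'a::ab_group_add \<Rightarrow> 'a) \<Rightarrow> ('k, 'a) tensor2" where
  "tensor_zero sT = tensor_class sT 0"

text \<open>The relations are added back because \<open>{0 \<cdot> p | p \<in> X}\<close> is not a coset.\<close>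
definition tensor_scale ::
  "('k::field \<Rightarrow> 'a::ab_group_add \<Rightarrow> 'a) \<Rightarrow> 'k \<Rightarrow> ('k, 'a) tensor2 \<Rightarrow> ('k, 'a) tensor2" where
  "tensor_scale sT c X = {free_scale c p + r |p r. p \<in> X \<and> r \<in> tensor_relations sT}"

text \<open>
  Linear extension to \<open>T \<otimes> T\<close> of a map \<open>b\<close> on pairs, computed on a representative of the coset.
  The value does not depend on the representative when \<open>b\<close> is bilinear.
\<close>
definition tensor_ext ::
  "('k::field \<Rightarrow> 'w::ab_group_add \<Rightarrow> 'w) \<Rightarrow> ('a \<Rightarrow> 'a \<Rightarrow> 'w) \<Rightarrow> ('k, 'a) tensor2 \<Rightarrow> 'w" where
  "tensor_ext s b X =
     (let p = (SOME p. p \<in> X) in \<Sum>(x, y)\<in>Poly_Mapping.keys p. s (Poly_Mapping.lookup p (x, y)) (b x y))"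


section \<open>Lie triple systems and their representations\<close>

locale lie_triple_system = vector_space sT
  for sT :: "'k::field \<Rightarrow> 'a::ab_group_add \<Rightarrow> 'a" +
  fixes br :: "'a \<Rightarrow> 'a \<Rightarrow> 'a \<Rightarrow> 'a"
  assumes br_linear1: "Vector_Spaces.linear sT sT (\<lambda>x. br x y z)"
    and br_linear2: "Vector_Spaces.linear sT sT (\<lambda>y. br x y z)"
    and br_linear3: "Vector_Spaces.linear sT sT (\<lambda>z. br x y z)"
    and br_alternating: "br x x y = 0"
    and br_cyclic: "br x y z + br y z x + br z x y = 0"
    and br_derivation:
      "br x1 x2 (br y1 y2 y3) = br (br x1 x2 y1) y2 y3 + br y1 (br x1 x2 y2) y3 + br y1 y2 (br x1 x2 y3)"

text \<open>
  The bilinear extension of \<open>(x1,x2) \<circ> (y1,y2) = ([x1,x2,y1],y2) + (y1,[x1,x2,y2])\<close>,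
  computed in the free vector space on representatives and then projected to \<open>T \<otimes> T\<close>.
\<close>
definition tensor_circ ::
  "('k::field \<Rightarrow> 'a::ab_group_add \<Rightarrow> 'a) \<Rightarrow> ('a \<Rightarrow> 'a \<Rightarrow> 'a \<Rightarrow> 'a) \<Rightarrow>
     ('k, 'a) tensor2 \<Rightarrow> ('k, 'a) tensor2 \<Rightarrow> ('k, 'a) tensor2" where
  "tensor_circ sT br X Y = tensor_class sT
     (tensor_ext free_scale (\<lambda>x1 x2. tensor_ext free_scale
        (\<lambda>y1 y2. free_gen (br x1 x2 y1, y2) + free_gen (y1, br x1 x2 y2)) Y) X)"

definition rep_D ::
  "('k::field \<Rightarrow> 'a::ab_group_add \<Rightarrow> 'a) \<Rightarrow> (('k, 'a) tensor2 \<Rightarrow> 'b::ab_group_add \<Rightarrow> 'b) \<Rightarrow>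
     'a \<Rightarrow> 'a \<Rightarrow> 'b \<Rightarrow> 'b" where
  "rep_D sT \<theta> x1 x2 v = \<theta> (tensor sT x2 x1) v - \<theta> (tensor sT x1 x2) v"

locale lts_representation = lie_triple_system sT br + V: vector_space sV
  for sT :: "'k::field \<Rightarrow> 'a::ab_group_add \<Rightarrow> 'a" and br
    and sV :: "'k \<Rightarrow> 'b::ab_group_add \<Rightarrow> 'b" +
  fixes \<theta> :: "('k, 'a) tensor2 \<Rightarrow> 'b \<Rightarrow> 'b"
  assumes theta_End: "X \<in> tensor_space sT \<Longrightarrow> Vector_Spaces.linear sV sV (\<theta> X)"
    and theta_add: "X \<in> tensor_space sT \<Longrightarrow> Y \<in> tensor_space sT \<Longrightarrow>
          \<theta> (tensor_add X Y) v = \<theta> X v + \<theta> Y v"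
    and theta_scale: "X \<in> tensor_space sT \<Longrightarrow> \<theta> (tensor_scale sT c X) v = sV c (\<theta> X v)"
    and R1: "rep_D sT \<theta> x1 x2 (\<theta> (tensor sT y1 y2) v) - \<theta> (tensor sT y1 y2) (rep_D sT \<theta> x1 x2 v)
          = \<theta> (tensor_circ sT br (tensor sT x1 x2) (tensor sT y1 y2)) v"
    and R2: "\<theta> (tensor sT x1 (br y1 y2 y3)) v
          = \<theta> (tensor sT y2 y3) (\<theta> (tensor sT x1 y1) v)
            - \<theta> (tensor sT y1 y3) (\<theta> (tensor sT x1 y2) v)
            + rep_D sT \<theta> y1 y2 (\<theta> (tensor sT x1 y3) v)"


section \<open>The Yamaguti complex\<close>

text \<open>
  An \<open>m\<close>-linear map is a function on lists that is linear in each entry of lists of length \<open>m\<close>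
  and, as a normalization, zero on lists of any other length.
\<close>
definition multilinear_maps ::
  "('k::field \<Rightarrow> 'a::ab_group_add \<Rightarrow> 'a) \<Rightarrow> ('k \<Rightarrow> 'b::ab_group_add \<Rightarrow> 'b) \<Rightarrow> nat \<Rightarrow> ('a list \<Rightarrow> 'b) set" where
  "multilinear_maps sT sV m = {\<omega>.
     (\<forall>xs. length xs \<noteq> m \<longrightarrow> \<omega> xs = 0) \<and>
     (\<forall>xs i. length xs = m \<and> i < m \<longrightarrow> Vector_Spaces.linear sT sV (\<lambda>x. \<omega> (xs[i := x])))}"

text \<open>\<open>yamaguti_cochains sT sV n\<close> is \<open>C\<^sup>2\<^sup>n\<^sup>+\<^sup>1(T,V)\<close>; the two conditions are linear, so this set is its own span.\<close>
definition yamaguti_cochains ::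
  "('k::field \<Rightarrow> 'a::ab_group_add \<Rightarrow> 'a) \<Rightarrow> ('k \<Rightarrow> 'b::ab_group_add \<Rightarrow> 'b) \<Rightarrow> nat \<Rightarrow> ('a list \<Rightarrow> 'b) set" where
  "yamaguti_cochains sT sV n = {\<omega> \<in> multilinear_maps sT sV (2 * n + 1). n \<ge> 1 \<longrightarrow>
     (\<forall>xs x y z. length xs = 2 * n - 2 \<longrightarrow>
        \<omega> (xs @ [x, x, y]) = 0 \<and>
        \<omega> (xs @ [x, y, z]) + \<omega> (xs @ [y, z, x]) + \<omega> (xs @ [z, x, y]) = 0)}"

definition omit_pair :: "nat \<Rightarrow> 'a list \<Rightarrow> 'a list" where
  "omit_pair k xs = take (2 * k - 2) xs @ drop (2 * k) xs"

text \<open>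
  \<open>yamaguti_coboundary sT br sV \<theta> n\<close> is \<open>\<delta>\<^sup>2\<^sup>n\<^sup>-\<^sup>1\<close> for \<open>n \<ge> 1\<close>, with values on lists of length
  \<open>2n+1\<close>. Arguments are numbered from 1 via \<open>x i = xs ! (i - 1)\<close>.
\<close>
definition yamaguti_coboundary ::
  "('k::field \<Rightarrow> 'a::ab_group_add \<Rightarrow> 'a) \<Rightarrow> ('a \<Rightarrow> 'a \<Rightarrow> 'a \<Rightarrow> 'a) \<Rightarrow>
   ('k \<Rightarrow> 'b::ab_group_add \<Rightarrow> 'b) \<Rightarrow> (('k, 'a) tensor2 \<Rightarrow> 'b \<Rightarrow> 'b) \<Rightarrow>
   nat \<Rightarrow> ('a list \<Rightarrow> 'b) \<Rightarrow> 'a list \<Rightarrow> 'b" where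
  "yamaguti_coboundary sT br sV \<theta> n \<omega> xs =
     (if length xs \<noteq> 2 * n + 1 then 0 else
      let x = (\<lambda>i. xs ! (i - 1)) in
        \<theta> (tensor sT (x (2 * n)) (x (2 * n + 1))) (\<omega> (take (2 * n - 1) xs))
      - \<theta> (tensor sT (x (2 * n - 1)) (x (2 * n + 1))) (\<omega> (take (2 * n - 2) xs @ [x (2 * n)]))
      + (\<Sum>k = 1..n. sV ((-1) ^ (n + k))
           (rep_D sT \<theta> (x (2 * k - 1)) (x (2 * k)) (\<omega> (omit_pair k xs))))
      + (\<Sum>k = 1..n. \<Sum>j = 2 * k + 1..2 * n + 1. sV ((-1) ^ (n + k + 1))
           (\<omega> (omit_pair k (xs[j - 1 := br (x (2 * k - 1)) (x (2 * k)) (x j)])))))"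


section \<open>Leibniz algebras and the Loday-Pirashvili complex\<close>

locale leibniz_algebra = vector_space_on A add zero scale
  for A :: "'l set" and add :: "'l \<Rightarrow> 'l \<Rightarrow> 'l" and zero :: 'l
    and scale :: "'k::field \<Rightarrow> 'l \<Rightarrow> 'l" +
  fixes circ :: "'l \<Rightarrow> 'l \<Rightarrow> 'l"
  assumes circ_closed: "x \<in> A \<Longrightarrow> y \<in> A \<Longrightarrow> circ x y \<in> A"
    and circ_add_left: "x \<in> A \<Longrightarrow> y \<in> A \<Longrightarrow> z \<in> A \<Longrightarrow> circ (add x y) z = add (circ x z) (circ y z)"
    and circ_add_right: "x \<in> A \<Longrightarrow> y \<in> A \<Longrightarrow> z \<in> A \<Longrightarrow> circ x (add y z) = add (circ x y) (circ x z)"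
    and circ_scale_left: "x \<in> A \<Longrightarrow> y \<in> A \<Longrightarrow> circ (scale c x) y = scale c (circ x y)"
    and circ_scale_right: "x \<in> A \<Longrightarrow> y \<in> A \<Longrightarrow> circ x (scale c y) = scale c (circ x y)"
    and leibniz: "x \<in> A \<Longrightarrow> y \<in> A \<Longrightarrow> z \<in> A \<Longrightarrow>
          circ x (circ y z) = add (circ (circ x y) z) (circ y (circ x z))"

text \<open>
  A representation of a left Leibniz algebra on a subspace \<open>M\<close> of a vector space:
  \<open>l x m\<close> is \<open>[x,m]\<^sub>L\<close> and \<open>r m x\<close> is \<open>[m,x]\<^sub>R\<close>.
\<close>
locale leibniz_representation = leibniz_algebra A add zero scale circ + M: vector_space sM
  for A :: "'l set" and add :: "'l \<Rightarrow> 'l \<Rightarrow> 'l" and zero :: 'l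
    and scale :: "'k::field \<Rightarrow> 'l \<Rightarrow> 'l" and circ :: "'l \<Rightarrow> 'l \<Rightarrow> 'l"
    and sM :: "'k \<Rightarrow> 'm::ab_group_add \<Rightarrow> 'm" +
  fixes M :: "'m set" and l :: "'l \<Rightarrow> 'm \<Rightarrow> 'm" and r :: "'m \<Rightarrow> 'l \<Rightarrow> 'm"
  assumes M_subspace: "module.subspace sM M"
    and l_closed: "x \<in> A \<Longrightarrow> m \<in> M \<Longrightarrow> l x m \<in> M"
    and r_closed: "x \<in> A \<Longrightarrow> m \<in> M \<Longrightarrow> r m x \<in> M"
    and l_linear: "x \<in> A \<Longrightarrow> linear_on M sM sM (l x)"
    and r_linear: "x \<in> A \<Longrightarrow> linear_on M sM sM (\<lambda>m. r m x)"
    and l_add: "x \<in> A \<Longrightarrow> y \<in> A \<Longrightarrow> m \<in> M \<Longrightarrow> l (add x y) m = l x m + l y m"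
    and l_scale: "x \<in> A \<Longrightarrow> m \<in> M \<Longrightarrow> l (scale c x) m = sM c (l x m)"
    and r_add: "x \<in> A \<Longrightarrow> y \<in> A \<Longrightarrow> m \<in> M \<Longrightarrow> r m (add x y) = r m x + r m y"
    and r_scale: "x \<in> A \<Longrightarrow> m \<in> M \<Longrightarrow> r m (scale c x) = sM c (r m x)"
    and rep_LL: "x \<in> A \<Longrightarrow> y \<in> A \<Longrightarrow> m \<in> M \<Longrightarrow> l (circ x y) m = l x (l y m) - l y (l x m)"
    and rep_LR: "x \<in> A \<Longrightarrow> y \<in> A \<Longrightarrow> m \<in> M \<Longrightarrow> r m (circ x y) = l x (r m y) - r (l x m) y"
    and rep_RR: "x \<in> A \<Longrightarrow> y \<in> A \<Longrightarrow> m \<in> M \<Longrightarrow> r (l x m) y = - r (r m x) y"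

text \<open>
  \<open>Hom(\<otimes>\<^sup>n L, M)\<close> as \<open>n\<close>-linear maps \<open>L\<^sup>n \<rightarrow> M\<close>: functions on lists, normalized to be zero outside
  the lists of length \<open>n\<close> over the carrier \<open>A\<close>. For \<open>n = 0\<close> such a function amounts to its value
  on the empty list, an element of \<open>M\<close>.
\<close>
definition lp_cochains ::
  "'l set \<Rightarrow> ('l \<Rightarrow> 'l \<Rightarrow> 'l) \<Rightarrow> ('k \<Rightarrow> 'l \<Rightarrow> 'l) \<Rightarrow> ('k \<Rightarrow> 'm::ab_group_add \<Rightarrow> 'm) \<Rightarrow> 'm set \<Rightarrow>
   nat \<Rightarrow> ('l list \<Rightarrow> 'm) set" where
  "lp_cochains A add scale sM M n = {f.
     (\<forall>xs. \<not> (length xs = n \<and> set xs \<subseteq> A) \<longrightarrow> f xs = 0) \<and>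
     (\<forall>xs. length xs = n \<and> set xs \<subseteq> A \<longrightarrow> f xs \<in> M) \<and>
     (\<forall>xs i. length xs = n \<and> set xs \<subseteq> A \<and> i < n \<longrightarrow>
        (\<forall>x\<in>A. \<forall>y\<in>A. f (xs[i := add x y]) = f (xs[i := x]) + f (xs[i := y])) \<and>
        (\<forall>c. \<forall>x\<in>A. f (xs[i := scale c x]) = sM c (f (xs[i := x]))))}"

definition omit :: "nat \<Rightarrow> 'l list \<Rightarrow> 'l list" where
  "omit k xs = take (k - 1) xs @ drop k xs"

text \<open>
  \<open>lp_coboundary A circ sM l r n\<close> is \<open>d\<^sub>n\<^sub>-\<^sub>1\<close> for \<open>n \<ge> 1\<close>, with values on lists of length \<open>n\<close>.
  Arguments are numbered from 1.
\<close>
definition lp_coboundary ::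
  "'l set \<Rightarrow> ('l \<Rightarrow> 'l \<Rightarrow> 'l) \<Rightarrow> ('k::field \<Rightarrow> 'm::ab_group_add \<Rightarrow> 'm) \<Rightarrow>
   ('l \<Rightarrow> 'm \<Rightarrow> 'm) \<Rightarrow> ('m \<Rightarrow> 'l \<Rightarrow> 'm) \<Rightarrow> nat \<Rightarrow> ('l list \<Rightarrow> 'm) \<Rightarrow> 'l list \<Rightarrow> 'm" where
  "lp_coboundary A circ sM l r n f xs =
     (if \<not> (length xs = n \<and> set xs \<subseteq> A) then 0 else
      let x = (\<lambda>i. xs ! (i - 1)) in
        (\<Sum>k = 1..n - 1. sM ((-1) ^ (k + 1)) (l (x k) (f (omit k xs))))
      + sM ((-1) ^ n) (r (f (take (n - 1) xs)) (x n))
      + (\<Sum>k = 1..n. \<Sum>j = k + 1..n. sM ((-1) ^ k) (f (omit k (xs[j - 1 := circ (x k) (x j)])))))"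


section \<open>The representation of \<open>T \<otimes> T\<close> on \<open>Hom(T,V)\<close>\<close>

definition left_action ::
  "('k::field \<Rightarrow> 'a::ab_group_add \<Rightarrow> 'a) \<Rightarrow> ('a \<Rightarrow> 'a \<Rightarrow> 'a \<Rightarrow> 'a) \<Rightarrow>
   ('k \<Rightarrow> 'b::ab_group_add \<Rightarrow> 'b) \<Rightarrow> (('k, 'a) tensor2 \<Rightarrow> 'b \<Rightarrow> 'b) \<Rightarrow>
   ('k, 'a) tensor2 \<Rightarrow> ('a \<Rightarrow> 'b) \<Rightarrow> 'a \<Rightarrow> 'b" where
  "left_action sT br sV \<theta> X \<phi> = tensor_ext (fun_scale sV)
     (\<lambda>x1 x2 x3. rep_D sT \<theta> x1 x2 (\<phi> x3) - \<phi> (br x1 x2 x3)) X"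

definition right_action ::
  "('k::field \<Rightarrow> 'a::ab_group_add \<Rightarrow> 'a) \<Rightarrow> ('a \<Rightarrow> 'a \<Rightarrow> 'a \<Rightarrow> 'a) \<Rightarrow>
   ('k \<Rightarrow> 'b::ab_group_add \<Rightarrow> 'b) \<Rightarrow> (('k, 'a) tensor2 \<Rightarrow> 'b \<Rightarrow> 'b) \<Rightarrow>
   ('a \<Rightarrow> 'b) \<Rightarrow> ('k, 'a) tensor2 \<Rightarrow> 'a \<Rightarrow> 'b" where
  "right_action sT br sV \<theta> \<phi> X = tensor_ext (fun_scale sV)
     (\<lambda>x1 x2 x3. \<phi> (br x1 x2 x3) - rep_D sT \<theta> x1 x2 (\<phi> x3)
        + \<theta> (tensor sT x1 x3) (\<phi> x2) - \<theta> (tensor sT x2 x3) (\<phi> x1)) X"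

abbreviation lts_lp_cochains ::
  "('k::field \<Rightarrow> 'a::ab_group_add \<Rightarrow> 'a) \<Rightarrow> ('k \<Rightarrow> 'b::ab_group_add \<Rightarrow> 'b) \<Rightarrow>
   nat \<Rightarrow> (('k, 'a) tensor2 list \<Rightarrow> 'a \<Rightarrow> 'b) set" where
  "lts_lp_cochains sT sV \<equiv>
     lp_cochains (tensor_space sT) tensor_add (tensor_scale sT) (fun_scale sV) (Hom_space sT sV)"

abbreviation lts_lp_coboundary ::
  "('k::field \<Rightarrow> 'a::ab_group_add \<Rightarrow> 'a) \<Rightarrow> ('a \<Rightarrow> 'a \<Rightarrow> 'a \<Rightarrow> 'a) \<Rightarrow>
   ('k \<Rightarrow> 'b::ab_group_add \<Rightarrow> 'b) \<Rightarrow> (('k, 'a) tensor2 \<Rightarrow> 'b \<Rightarrow> 'b) \<Rightarrow>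
   nat \<Rightarrow> (('k, 'a) tensor2 list \<Rightarrow> 'a \<Rightarrow> 'b) \<Rightarrow> ('k, 'a) tensor2 list \<Rightarrow> 'a \<Rightarrow> 'b" where
  "lts_lp_coboundary sT br sV \<theta> \<equiv>
     lp_coboundary (tensor_space sT) (tensor_circ sT br) (fun_scale sV)
       (left_action sT br sV \<theta>) (right_action sT br sV \<theta>)"

definition pair_up ::
  "('k::field \<Rightarrow> 'a::ab_group_add \<Rightarrow> 'a) \<Rightarrow> nat \<Rightarrow> 'a list \<Rightarrow> ('k, 'a) tensor2 list" where
  "pair_up sT n xs = map (\<lambda>k. tensor sT (xs ! (2 * k)) (xs ! (2 * k + 1))) [0..<n]"

text \<open>
  The cochain in \<open>Hom(\<otimes>\<^sup>n(T \<otimes> T), Hom(T,V))\<close> as which a \<open>(2n+1)\<close>-linear map is regarded.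
\<close>
definition regard ::
  "('k::field \<Rightarrow> 'a::ab_group_add \<Rightarrow> 'a) \<Rightarrow> ('k \<Rightarrow> 'b::ab_group_add \<Rightarrow> 'b) \<Rightarrow> nat \<Rightarrow>
   ('a list \<Rightarrow> 'b) \<Rightarrow> ('k, 'a) tensor2 list \<Rightarrow> 'a \<Rightarrow> 'b" where
  "regard sT sV n \<omega> = (THE f. f \<in> lts_lp_cochains sT sV n \<and>
     (\<forall>xs w. length xs = 2 * n \<longrightarrow> f (pair_up sT n xs) w = \<omega> (xs @ [w])))"

end

theory Submission
  imports Defs
begin

text \<open>
  For a left Leibniz algebra, write \<open>i\<^sub>x\<close> for insertion of \<open>x\<close> in the first argument and \<open>L\<^sub>x\<close> for the
  Lie derivative. The Loday-Pirashvili differential satisfies \<open>i\<^sub>x d + d i\<^sub>x = L\<^sub>x\<close> in positive degrees,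
  and this recursion determines it. Induction on the degree gives in turn
  \<open>[L\<^sub>x, L\<^sub>y] = L\<^bsub>x\<circ>y\<^esub>\<close>, \<open>[L\<^sub>x, d] = 0\<close> and \<open>d d = 0\<close>, the three representation identities being exactly
  the initial cases. The identities themselves are multilinear, so on \<open>T \<otimes> T\<close> they need only be
  checked on pure tensors, where they are (R1), (R2) and the derivation rule.

  A cochain on \<open>T \<otimes> T\<close> is determined by its values on pure tensors, where the two coboundary
  formulas agree term by term up to a global sign. Hence all properties of the Yamaguti operator, including
  multilinearity and \<open>\<delta> \<delta> = 0\<close>, are inherited from \<open>d\<close>; that \<open>\<delta>\<close> preserves the two symmetry
  conditions follows again from the recursion for \<open>d\<close>.
\<close>

section \<open>Cartan calculus on the Loday-Pirashvili complex\<close>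

text \<open>Cartan's formula fails in degree 0 because there \<open>i_x d m\<close> is
  \<open>- [m,x]_R\<close> rather than \<open>[x,m]_L\<close>. The right action enters the recursion
  only at this point, so every induction on the degree has a separate base case, and those base
  cases are where the laws of a Leibniz representation are consumed.

  Two encodings shape the rest. First, a linear extension to \<open>T \<otimes> T\<close> is
  evaluated on an arbitrarily chosen representative of a coset, so it has its meaning only after the
  map on pairs is known to be bilinear. The product on \<open>T \<otimes> T\<close> is computed in
  the free vector space, where it is bilinear merely modulo the relations. Second,
  \<open>regard\<close> is a definite description, so nothing can be said about
  \<open>regard\<close> of a coboundary before that coboundary is known to be multilinear; the
  missing multilinear map is therefore produced on the tensor side and pulled back.

  The sign comes from the weights of the terms: \<open>(-1)^(n+k)\<close> in the Yamaguti formula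
  against \<open>(-1)^(k+1)\<close> in the other one. The quotient \<open>(-1)^(n-1)\<close> depends
  on the degree only, so kernels and images are the same.\<close>

text \<open>
  Unlike \<^const>\<open>lp_cochains\<close>, no value is prescribed on lists of other lengths or outside the carrier, and
  insertion in the first argument is built into the recursion.
\<close>
primrec multilinear_on ::
  "'l set \<Rightarrow> ('l \<Rightarrow> 'l \<Rightarrow> 'l) \<Rightarrow> ('k \<Rightarrow> 'l \<Rightarrow> 'l) \<Rightarrow> ('k \<Rightarrow> 'm::ab_group_add \<Rightarrow> 'm) \<Rightarrow> 'm set \<Rightarrow>
   nat \<Rightarrow> ('l list \<Rightarrow> 'm) \<Rightarrow> bool" where
  "multilinear_on A add scale s M 0 f \<longleftrightarrow> f [] \<in> M"
| "multilinear_on A add scale s M (Suc n) f \<longleftrightarrow>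
     (\<forall>x\<in>A. multilinear_on A add scale s M n (\<lambda>xs. f (x # xs))) \<and>
     (\<forall>xs. length xs = n \<longrightarrow> set xs \<subseteq> A \<longrightarrow>
        (\<forall>x\<in>A. \<forall>y\<in>A. f (add x y # xs) = f (x # xs) + f (y # xs)) \<and>
        (\<forall>c. \<forall>x\<in>A. f (scale c x # xs) = s c (f (x # xs))))"

text \<open>Slot 0 is the head clause of the recursion, and slot \<open>Suc i\<close> of
  \<open>a # xs\<close> is slot \<open>i\<close> after insertion of \<open>a\<close>. This connects
  the entrywise condition of \<open>lp_cochains\<close> with a form suited to induction on the
  degree.\<close>

lemma multilinear_on_iff:
  "multilinear_on A add scale s M n f \<longleftrightarrow>
     (\<forall>xs. length xs = n \<and> set xs \<subseteq> A \<longrightarrow> f xs \<in> M) \<and>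
     (\<forall>xs i. length xs = n \<and> set xs \<subseteq> A \<and> i < n \<longrightarrow>
        (\<forall>x\<in>A. \<forall>y\<in>A. f (xs[i := add x y]) = f (xs[i := x]) + f (xs[i := y])) \<and>
        (\<forall>c. \<forall>x\<in>A. f (xs[i := scale c x]) = s c (f (xs[i := x]))))"
  (is "_ \<longleftrightarrow> ?V n f \<and> ?L n f")
proof (induction n arbitrary: f)
  case 0
  then show ?case by simp
next
  case (Suc n)
  show ?case
  proof
    assume ml: "multilinear_on A add scale s M (Suc n) f"
    then have tail: "?V n (\<lambda>xs. f (a # xs)) \<and> ?L n (\<lambda>xs. f (a # xs))" if "a \<in> A" for a
      using that Suc.IH by auto
    have "?V (Suc n) f"
    proof (intro allI impI)
      fix xs :: "'a list" assume "length xs = Suc n \<and> set xs \<subseteq> A"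
      then obtain a as where "xs = a # as" "length as = n" "a \<in> A" "set as \<subseteq> A"
        by (cases xs) auto
      then show "f xs \<in> M" using tail by blast
    qed
    moreover have "?L (Suc n) f"
    proof (intro allI impI)
      fix xs :: "'a list" and i
      assume *: "length xs = Suc n \<and> set xs \<subseteq> A \<and> i < Suc n"
      then obtain a as where xs: "xs = a # as" "length as = n" "a \<in> A" "set as \<subseteq> A"
        by (cases xs) auto
      show "(\<forall>x\<in>A. \<forall>y\<in>A. f (xs[i := add x y]) = f (xs[i := x]) + f (xs[i := y])) \<and>
        (\<forall>c. \<forall>x\<in>A. f (xs[i := scale c x]) = s c (f (xs[i := x])))"
      proof (cases i)
        case 0
        then show ?thesis using ml xs by simp
      next
        case (Suc j)
        then show ?thesis using tail[OF xs(3)] xs * by simp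
      qed
    qed
    ultimately show "?V (Suc n) f \<and> ?L (Suc n) f" by blast
  next
    assume *: "?V (Suc n) f \<and> ?L (Suc n) f"
    have "multilinear_on A add scale s M n (\<lambda>xs. f (a # xs))" if a: "a \<in> A" for a
    proof -
      have "?V n (\<lambda>xs. f (a # xs))" using * a by simp
      moreover have "?L n (\<lambda>xs. f (a # xs))"
      proof (intro allI impI)
        fix xs :: "'a list" and i
        assume i: "length xs = n \<and> set xs \<subseteq> A \<and> i < n"
        have "(\<forall>x\<in>A. \<forall>y\<in>A. f ((a # xs)[Suc i := add x y]) = f ((a # xs)[Suc i := x]) + f ((a # xs)[Suc i := y])) \<and>
          (\<forall>c. \<forall>x\<in>A. f ((a # xs)[Suc i := scale c x]) = s c (f ((a # xs)[Suc i := x])))"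
          by (rule *[THEN conjunct2, rule_format]) (use i a in auto)
        then show "(\<forall>x\<in>A. \<forall>y\<in>A. f (a # xs[i := add x y]) = f (a # xs[i := x]) + f (a # xs[i := y])) \<and>
          (\<forall>c. \<forall>x\<in>A. f (a # xs[i := scale c x]) = s c (f (a # xs[i := x])))" by simp
      qed
      ultimately show ?thesis using Suc.IH by blast
    qed
    moreover have "(\<forall>x\<in>A. \<forall>y\<in>A. f (add x y # xs) = f (x # xs) + f (y # xs)) \<and>
        (\<forall>c. \<forall>x\<in>A. f (scale c x # xs) = s c (f (x # xs)))"
      if xs: "length xs = n" "set xs \<subseteq> A" for xs
    proof (intro conjI ballI allI)
      fix x y assume "x \<in> A" "y \<in> A"
      then have "f ((x # xs)[0 := add x y]) = f ((x # xs)[0 := x]) + f ((x # xs)[0 := y])"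
        using xs by (intro *[THEN conjunct2, rule_format, THEN conjunct1, rule_format]) auto
      then show "f (add x y # xs) = f (x # xs) + f (y # xs)" by simp
    next
      fix c x assume "x \<in> A"
      then have "f ((x # xs)[0 := scale c x]) = s c (f ((x # xs)[0 := x]))"
        using xs by (intro *[THEN conjunct2, rule_format, THEN conjunct2, rule_format]) auto
      then show "f (scale c x # xs) = s c (f (x # xs))" by simp
    qed
    ultimately show "multilinear_on A add scale s M (Suc n) f" by simp
  qed
qed

lemma lp_cochains_iff:
  "f \<in> lp_cochains A add scale s M n \<longleftrightarrow>
     (\<forall>xs. \<not> (length xs = n \<and> set xs \<subseteq> A) \<longrightarrow> f xs = 0) \<and> multilinear_on A add scale s M n f"
  unfolding lp_cochains_def multilinear_on_iff by blast

text \<open>Closure of \<open>A\<close> under the operations enters because the head clauses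
  evaluate both functions at \<open>add x y # xs\<close> and \<open>scale c x # xs\<close>.\<close>

lemma multilinear_on_cong:
  assumes "vector_space_on A add zero scale"
    and "\<And>xs. length xs = n \<Longrightarrow> set xs \<subseteq> A \<Longrightarrow> f xs = g xs"
  shows "multilinear_on A add scale s M n f \<longleftrightarrow> multilinear_on A add scale s M n g"
  using assms(2)
proof (induction n arbitrary: f g)
  case 0
  then show ?case by simp
next
  case (Suc n)
  interpret vector_space_on A add zero scale by fact
  have "multilinear_on A add scale s M n (\<lambda>xs. f (x # xs)) \<longleftrightarrow>
      multilinear_on A add scale s M n (\<lambda>xs. g (x # xs))" if "x \<in> A" for x
    by (rule Suc.IH) (use Suc.prems that in simp)
  then show ?case using Suc.prems by (auto simp: add_closed scale_closed)
qed

lemma multilinear_on_value: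
  "multilinear_on A add scale s M n f \<Longrightarrow> length xs = n \<Longrightarrow> set xs \<subseteq> A \<Longrightarrow> f xs \<in> M"
  using multilinear_on_iff[of A add scale s M n f] by blast

section \<open>Pointwise vector space structure on cochains\<close>

lemma vector_space_fun_scale:
  assumes "vector_space s"
  shows "vector_space (fun_scale s)"
proof -
  interpret vector_space s by fact
  show ?thesis
    by unfold_locales (auto simp: fun_scale_def fun_eq_iff scale_right_distrib scale_left_distrib)
qed

context vector_space begin

lemma multilinear_on_zero:
  assumes "subspace M"
  shows "multilinear_on A add sc scale M n (\<lambda>_. 0)"
  by (induction n) (simp_all add: subspace_0[OF assms])

lemma multilinear_on_add:
  assumes "subspace M" "multilinear_on A add sc scale M n f" "multilinear_on A add sc scale M n g"
  shows "multilinear_on A add sc scale M n (\<lambda>xs. f xs + g xs)"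
  using assms(2,3)
  by (induction n arbitrary: f g) (auto simp: subspace_add[OF assms(1)] scale_right_distrib)

lemma multilinear_on_scale:
  assumes "subspace M" "multilinear_on A add sc scale M n f"
  shows "multilinear_on A add sc scale M n (\<lambda>xs. scale c (f xs))"
  using assms(2)
  by (induction n arbitrary: f) (auto simp: subspace_scale[OF assms(1)] scale_right_distrib mult.commute)

lemma multilinear_on_diff:
  assumes "subspace M" "multilinear_on A add sc scale M n f" "multilinear_on A add sc scale M n g"
  shows "multilinear_on A add sc scale M n (\<lambda>xs. f xs - g xs)"
  using assms(2,3)
  by (induction n arbitrary: f g) (auto simp: subspace_diff[OF assms(1)] scale_right_diff_distrib)

lemma subspace_lp_cochains:
  assumes "subspace M"
  shows "module.subspace (fun_scale scale) (lp_cochains A add sc scale M n)"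
proof -
  interpret F: vector_space "fun_scale scale"
    by (rule vector_space_fun_scale) (rule vector_space_axioms)
  show ?thesis
    unfolding F.subspace_def
    using multilinear_on_zero[OF assms] multilinear_on_add[OF assms] multilinear_on_scale[OF assms]
    by (auto simp: lp_cochains_iff fun_scale_def zero_fun_def plus_fun_def)
qed

end

section \<open>Lie derivative, differential and their commutation rules\<close>

context leibniz_representation begin

abbreviation ml :: "nat \<Rightarrow> ('l list \<Rightarrow> 'm) \<Rightarrow> bool" where
  "ml \<equiv> multilinear_on A add scale sM M"

text \<open>The second equation is the rule \<open>i_y L_x = L_x i_y - i_(x \<circ> y)\<close> read
  as a recursion.\<close>

primrec lie :: "'l \<Rightarrow> ('l list \<Rightarrow> 'm) \<Rightarrow> 'l list \<Rightarrow> 'm" where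
  "lie x f [] = l x (f [])"
| "lie x f (y # ys) = lie x (\<lambda>zs. f (y # zs)) ys - f (circ x y # ys)"

text \<open>Cartan's formula read as a recursive definition; in degree 0 it fails, and only the right action enters.\<close>
primrec cob :: "('l list \<Rightarrow> 'm) \<Rightarrow> 'l list \<Rightarrow> 'm" where
  "cob f [] = 0"
| "cob f (x # xs) = (if xs = [] then - r (f []) x else lie x f xs - cob (\<lambda>zs. f (x # zs)) xs)"

lemmas ml_scale = M.multilinear_on_scale[OF M_subspace]
  and ml_diff = M.multilinear_on_diff[OF M_subspace]
  and ml_cong = multilinear_on_cong[OF vector_space_on_axioms]

lemma
  assumes "x \<in> A" "m \<in> M" "m' \<in> M"
  shows l_plus: "l x (m + m') = l x m + l x m'"
    and l_sM: "l x (sM c m) = sM c (l x m)"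
    and l_minus: "l x (m - m') = l x m - l x m'"
    and r_plus: "r (m + m') x = r m x + r m' x"
    and r_sM: "r (sM c m) x = sM c (r m x)"
    and l_uminus: "l x (- m) = - l x m"
    and r_uminus: "r (- m) x = - r m x"
proof -
  note L = l_linear[OF assms(1), unfolded linear_on_def] and R = r_linear[OF assms(1), unfolded linear_on_def]
  show 1: "l x (m + m') = l x m + l x m'" and 2: "l x (sM c m) = sM c (l x m)"
    and "r (m + m') x = r m x + r m' x" and 3: "r (sM c m) x = sM c (r m x)" for c
    using L R assms by auto
  show "l x (- m) = - l x m" using 2[of "-1"] by simp
  show "r (- m) x = - r m x" using 3[of "-1"] by simp
  have "l x ((m - m') + m') = l x (m - m') + l x m'"
    using L assms M.subspace_diff[OF M_subspace] by blast
  then show "l x (m - m') = l x m - l x m'" by (simp add: algebra_simps)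
qed

lemma ml_Cons: "ml (Suc n) f \<Longrightarrow> x \<in> A \<Longrightarrow> ml n (\<lambda>xs. f (x # xs))"
  by simp

text \<open>Multilinearity of \<open>f\<close> is an assertion about lists over \<open>A\<close>
  only, so rewriting \<open>f (add y y' # zs)\<close> under the binder inside \<open>lie\<close>
  goes through this congruence. \<open>cob_cong\<close> serves the same purpose for
  \<open>cob\<close>.\<close>

lemma lie_cong:
  "(\<And>zs. length zs = length xs \<Longrightarrow> set zs \<subseteq> A \<Longrightarrow> f zs = g zs) \<Longrightarrow> x \<in> A \<Longrightarrow> set xs \<subseteq> A \<Longrightarrow>
    lie x f xs = lie x g xs"
proof (induction xs arbitrary: f g)
  case (Cons y ys)
  have "lie x (\<lambda>zs. f (y # zs)) ys = lie x (\<lambda>zs. g (y # zs)) ys"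
    by (rule Cons.IH) (use Cons.prems in auto)
  then show ?case using Cons.prems by (simp add: circ_closed)
qed simp

lemma lie_plus:
  "ml (length xs) f \<Longrightarrow> ml (length xs) g \<Longrightarrow> x \<in> A \<Longrightarrow> set xs \<subseteq> A \<Longrightarrow>
    lie x (\<lambda>zs. f zs + g zs) xs = lie x f xs + lie x g xs"
proof (induction xs arbitrary: f g)
  case (Cons y ys)
  have "lie x (\<lambda>zs. f (y # zs) + g (y # zs)) ys = lie x (\<lambda>zs. f (y # zs)) ys + lie x (\<lambda>zs. g (y # zs)) ys"
    by (rule Cons.IH) (use Cons.prems in auto)
  then show ?case by simp
qed (simp add: l_plus)

lemma lie_diff:
  "ml (length xs) f \<Longrightarrow> ml (length xs) g \<Longrightarrow> x \<in> A \<Longrightarrow> set xs \<subseteq> A \<Longrightarrow>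
    lie x (\<lambda>zs. f zs - g zs) xs = lie x f xs - lie x g xs"
proof (induction xs arbitrary: f g)
  case (Cons y ys)
  have "lie x (\<lambda>zs. f (y # zs) - g (y # zs)) ys = lie x (\<lambda>zs. f (y # zs)) ys - lie x (\<lambda>zs. g (y # zs)) ys"
    by (rule Cons.IH) (use Cons.prems in auto)
  then show ?case by simp
qed (simp add: l_minus)

lemma lie_sM:
  "ml (length xs) f \<Longrightarrow> x \<in> A \<Longrightarrow> set xs \<subseteq> A \<Longrightarrow>
    lie x (\<lambda>zs. sM c (f zs)) xs = sM c (lie x f xs)"
proof (induction xs arbitrary: f)
  case (Cons y ys)
  have "lie x (\<lambda>zs. sM c (f (y # zs))) ys = sM c (lie x (\<lambda>zs. f (y # zs)) ys)"
    by (rule Cons.IH) (use Cons.prems in auto)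
  then show ?case by (simp add: M.scale_right_diff_distrib)
qed (simp add: l_sM)

lemma ml_lie:
  "ml n f \<Longrightarrow> x \<in> A \<Longrightarrow> ml n (lie x f)"
proof (induction n arbitrary: f)
  case 0
  then show ?case by (simp add: l_closed)
next
  case (Suc n)
  note f = Suc.prems(1)[unfolded multilinear_on.simps]
  have "ml n (\<lambda>zs. lie x f (y # zs))" if y: "y \<in> A" for y
  proof -
    have "ml n (\<lambda>zs. lie x (\<lambda>zs. f (y # zs)) zs - f (circ x y # zs))"
      using Suc.prems y by (intro ml_diff Suc.IH) (auto simp: circ_closed)
    then show ?thesis by simp
  qed
  moreover have "lie x f (add y y' # zs) = lie x f (y # zs) + lie x f (y' # zs)"
    if "length zs = n" "set zs \<subseteq> A" "y \<in> A" "y' \<in> A" for zs y y'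
  proof -
    have "lie x (\<lambda>zs. f (add y y' # zs)) zs = lie x (\<lambda>zs. f (y # zs) + f (y' # zs)) zs"
      using f that Suc.prems by (intro lie_cong) auto
    also have "\<dots> = lie x (\<lambda>zs. f (y # zs)) zs + lie x (\<lambda>zs. f (y' # zs)) zs"
      using that Suc.prems by (intro lie_plus) auto
    finally show ?thesis using that Suc.prems by (simp add: circ_add_right circ_closed)
  qed
  moreover have "lie x f (scale c y # zs) = sM c (lie x f (y # zs))"
    if "length zs = n" "set zs \<subseteq> A" "y \<in> A" for zs y c
  proof -
    have "lie x (\<lambda>zs. f (scale c y # zs)) zs = lie x (\<lambda>zs. sM c (f (y # zs))) zs"
      using f that Suc.prems by (intro lie_cong) auto
    also have "\<dots> = sM c (lie x (\<lambda>zs. f (y # zs)) zs)"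
      using that Suc.prems by (intro lie_sM) auto
    finally show ?thesis
      using that Suc.prems by (simp add: circ_scale_right circ_closed M.scale_right_diff_distrib)
  qed
  ultimately show ?case by simp
qed

lemma lie_add_left:
  "ml (length xs) f \<Longrightarrow> x \<in> A \<Longrightarrow> y \<in> A \<Longrightarrow> set xs \<subseteq> A \<Longrightarrow>
    lie (add x y) f xs = lie x f xs + lie y f xs"
  by (induction xs arbitrary: f) (auto simp: l_add circ_add_left circ_closed)

lemma lie_scale_left:
  "ml (length xs) f \<Longrightarrow> x \<in> A \<Longrightarrow> set xs \<subseteq> A \<Longrightarrow>
    lie (scale c x) f xs = sM c (lie x f xs)"
  by (induction xs arbitrary: f)
    (auto simp: l_scale circ_scale_left circ_closed M.scale_right_diff_distrib)

lemma cob_cong: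
  "(\<And>zs. Suc (length zs) = length xs \<Longrightarrow> set zs \<subseteq> A \<Longrightarrow> f zs = g zs) \<Longrightarrow> set xs \<subseteq> A \<Longrightarrow>
    cob f xs = cob g xs"
proof (induction xs arbitrary: f g)
  case (Cons x xs)
  have "lie x f xs = lie x g xs"
    by (rule lie_cong) (use Cons.prems in auto)
  moreover have "cob (\<lambda>zs. f (x # zs)) xs = cob (\<lambda>zs. g (x # zs)) xs"
    by (rule Cons.IH) (use Cons.prems in auto)
  ultimately show ?case using Cons.prems by auto
qed simp

lemma cob_plus:
  "ml n f \<Longrightarrow> ml n g \<Longrightarrow> length xs = Suc n \<Longrightarrow> set xs \<subseteq> A \<Longrightarrow>
    cob (\<lambda>zs. f zs + g zs) xs = cob f xs + cob g xs"
proof (induction xs arbitrary: n f g)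
  case (Cons x xs)
  show ?case
  proof (cases xs)
    case Nil
    then show ?thesis using Cons.prems by (simp add: r_plus)
  next
    case (Cons y ys)
    then obtain k where k: "n = Suc k" using Cons.prems by auto
    have "cob (\<lambda>zs. f (x # zs) + g (x # zs)) xs = cob (\<lambda>zs. f (x # zs)) xs + cob (\<lambda>zs. g (x # zs)) xs"
      by (rule Cons.IH[of k]) (use Cons.prems k in auto)
    moreover have "lie x (\<lambda>zs. f zs + g zs) xs = lie x f xs + lie x g xs"
      by (rule lie_plus) (use Cons.prems k in auto)
    \<comment> \<open>Only the layer with head \<open>x\<close> is unfolded; unfolding the tail
      \<open>y # ys\<close> as well would destroy the shape of the induction hypothesis.\<close>
    ultimately show ?thesis by (simp add: Cons del: lie.simps cob.simps add: cob.simps(2)[of _ x])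
  qed
qed simp

lemma cob_sM:
  "ml n f \<Longrightarrow> length xs = Suc n \<Longrightarrow> set xs \<subseteq> A \<Longrightarrow>
    cob (\<lambda>zs. sM c (f zs)) xs = sM c (cob f xs)"
proof (induction xs arbitrary: n f)
  case (Cons x xs)
  show ?case
  proof (cases xs)
    case Nil
    then show ?thesis using Cons.prems by (simp add: r_sM)
  next
    case (Cons y ys)
    then obtain k where k: "n = Suc k" using Cons.prems by auto
    have "cob (\<lambda>zs. sM c (f (x # zs))) xs = sM c (cob (\<lambda>zs. f (x # zs)) xs)"
      by (rule Cons.IH[of k]) (use Cons.prems k in auto)
    moreover have "lie x (\<lambda>zs. sM c (f zs)) xs = sM c (lie x f xs)"
      by (rule lie_sM) (use Cons.prems k in auto)
    ultimately show ?thesis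
      by (simp add: Cons M.scale_right_diff_distrib del: lie.simps cob.simps add: cob.simps(2)[of _ x])
  qed
qed simp

lemma cob_diff:
  assumes "ml n f" "ml n g" "length xs = Suc n" "set xs \<subseteq> A"
  shows "cob (\<lambda>zs. f zs - g zs) xs = cob f xs - cob g xs"
proof -
  have "cob (\<lambda>zs. f zs + sM (-1) (g zs)) xs = cob f xs + cob (\<lambda>zs. sM (-1) (g zs)) xs"
    using assms by (intro cob_plus ml_scale) auto
  then show ?thesis using cob_sM[OF assms(2-4), of "-1"] by simp
qed

lemma ml_cob:
  "ml n f \<Longrightarrow> ml (Suc n) (cob f)"
proof (induction n arbitrary: f)
  case 0
  then show ?case using M.subspace_neg[OF M_subspace] by (simp add: r_closed r_add r_scale)
next
  case (Suc n)
  note f = Suc.prems[unfolded multilinear_on.simps]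
  have "ml (Suc n) (\<lambda>zs. cob f (x # zs))" if x: "x \<in> A" for x
  proof -
    have "ml (Suc n) (\<lambda>zs. lie x f zs - cob (\<lambda>zs. f (x # zs)) zs)"
      using f by (intro ml_diff ml_lie Suc.IH Suc.prems x) (auto simp: x)
    \<comment> \<open>All lists have length \<open>Suc n\<close> here, so the branch of
      \<open>cob\<close> for an empty tail is never taken.\<close>
    then show ?thesis
      by (rule ml_cong[THEN iffD1, rotated]) auto
  qed
  moreover have "cob f (add x y # zs) = cob f (x # zs) + cob f (y # zs)"
    if zs: "length zs = Suc n" "set zs \<subseteq> A" and xy: "x \<in> A" "y \<in> A" for zs x y
  proof -
    have "cob (\<lambda>zs. f (add x y # zs)) zs = cob (\<lambda>zs. f (x # zs) + f (y # zs)) zs"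
      using f zs xy by (intro cob_cong) auto
    also have "\<dots> = cob (\<lambda>zs. f (x # zs)) zs + cob (\<lambda>zs. f (y # zs)) zs"
      using zs xy f by (intro cob_plus[of n]) auto
    finally show ?thesis
      using zs xy lie_add_left[of zs f x y] Suc.prems
      by (cases zs) (simp_all del: lie.simps cob.simps multilinear_on.simps add: cob.simps(2)[of _ x] cob.simps(2)[of _ y] cob.simps(2)[of _ "add x y"])
  qed
  moreover have "cob f (scale c x # zs) = sM c (cob f (x # zs))"
    if zs: "length zs = Suc n" "set zs \<subseteq> A" and x: "x \<in> A" for zs x c
  proof -
    have "cob (\<lambda>zs. f (scale c x # zs)) zs = cob (\<lambda>zs. sM c (f (x # zs))) zs"
      using f zs x by (intro cob_cong) auto
    also have "\<dots> = sM c (cob (\<lambda>zs. f (x # zs)) zs)"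
      using zs x f by (intro cob_sM[of n]) auto
    finally show ?thesis
      using zs x lie_scale_left[of zs f x c] Suc.prems
      by (cases zs) (simp_all del: lie.simps cob.simps multilinear_on.simps
          add: cob.simps(2)[of _ x] cob.simps(2)[of _ "scale c x"] M.scale_right_diff_distrib)
  qed
  ultimately show ?case unfolding multilinear_on.simps(2)[of A add scale sM M "Suc n"] by blast
qed

text \<open>Expanding \<open>L_x L_y\<close> at the head \<open>z\<close> gives mixed terms in
  \<open>y \<circ> z\<close> and \<open>x \<circ> z\<close> that are symmetric in \<open>x\<close>
  and \<open>y\<close> and cancel in the commutator. What survives is \<open>f\<close> at
  \<open>x \<circ> (y \<circ> z)\<close> minus \<open>f\<close> at
  \<open>y \<circ> (x \<circ> z)\<close>, which the Leibniz rule evaluates.\<close>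

lemma lie_circ:
  "ml (length xs) f \<Longrightarrow> x \<in> A \<Longrightarrow> y \<in> A \<Longrightarrow> set xs \<subseteq> A \<Longrightarrow>
    lie (circ x y) f xs = lie x (lie y f) xs - lie y (lie x f) xs"
proof (induction xs arbitrary: f)
  case Nil
  then show ?case by (simp add: rep_LL)
next
  case (Cons z zs)
  note f = Cons.prems(1)[simplified]
  have z: "z \<in> A" "set zs \<subseteq> A" using Cons.prems by auto
  have *: "lie u (\<lambda>zs. lie v (\<lambda>zs. f (z # zs)) zs - f (circ v z # zs)) zs
      = lie u (lie v (\<lambda>zs. f (z # zs))) zs - lie u (\<lambda>zs. f (circ v z # zs)) zs"
    if "u \<in> A" "v \<in> A" for u v
    using f z that by (intro lie_diff ml_lie) (auto simp: circ_closed)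
  have IH: "lie (circ x y) (\<lambda>zs. f (z # zs)) zs
      = lie x (lie y (\<lambda>zs. f (z # zs))) zs - lie y (lie x (\<lambda>zs. f (z # zs))) zs"
    by (rule Cons.IH) (use Cons.prems in auto)
  have "f (circ x (circ y z) # zs) = f (circ (circ x y) z # zs) + f (circ y (circ x z) # zs)"
    unfolding leibniz[OF Cons.prems(2,3) z(1)] using f z Cons.prems by (simp add: circ_closed)
  then show ?case
    unfolding lie.simps(2) *[OF Cons.prems(2,3)] *[OF Cons.prems(3,2)] IH by (simp add: algebra_simps)
qed

text \<open>Inserting \<open>y\<close> and using Cartan's formula on both sides leaves
  \<open>L_x L_y - L_(x \<circ> y)\<close> against \<open>L_y L_x\<close> acting on
  \<open>f\<close>, plus the claim for \<open>i_y f\<close>. Degree 0 is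
  \<open>rep_LR\<close>.\<close>

lemma lie_cob:
  "ml n f \<Longrightarrow> x \<in> A \<Longrightarrow> length xs = Suc n \<Longrightarrow> set xs \<subseteq> A \<Longrightarrow>
    lie x (cob f) xs = cob (lie x f) xs"
proof (induction n arbitrary: f xs)
  case 0
  then obtain y where xs: "xs = [y]" "y \<in> A"
    by (cases xs) auto
  have "r (f []) y \<in> M" using 0 xs r_closed by simp
  then show ?case using xs 0 by (simp add: rep_LR l_uminus)
next
  case (Suc n)
  then obtain y ys where xs: "xs = y # ys" "y \<in> A" "length ys = Suc n" "set ys \<subseteq> A"
    by (cases xs) auto
  have ys: "ys \<noteq> []" using xs by auto
  note f = Suc.prems(1)
  have fy: "ml n (\<lambda>zs. f (u # zs))" if "u \<in> A" for u using f that by simp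
  have xy: "circ x y \<in> A" using Suc.prems xs circ_closed by blast
  have 1: "lie x (\<lambda>zs. cob f (y # zs)) ys = lie x (\<lambda>zs. lie y f zs - cob (\<lambda>zs. f (y # zs)) zs) ys"
    using Suc.prems xs by (intro lie_cong) auto
  have 2: "lie x (\<lambda>zs. lie y f zs - cob (\<lambda>zs. f (y # zs)) zs) ys
      = lie x (lie y f) ys - lie x (cob (\<lambda>zs. f (y # zs))) ys"
    by (rule lie_diff) (use ml_lie[OF f xs(2)] ml_cob[OF fy[OF xs(2)]] xs Suc.prems in simp_all)
  have 3: "lie x (cob (\<lambda>zs. f (y # zs))) ys = cob (lie x (\<lambda>zs. f (y # zs))) ys"
    by (rule Suc.IH) (use fy xs Suc.prems in auto)
  have 4: "cob (\<lambda>zs. lie x f (y # zs)) ys = cob (lie x (\<lambda>zs. f (y # zs))) ys - cob (\<lambda>zs. f (circ x y # zs)) ys"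
    unfolding lie.simps
    by (rule cob_diff[of n]) (use fy[OF xy] ml_lie[OF fy[OF xs(2)] Suc.prems(2)] xs in auto)
  have 5: "lie (circ x y) f ys = lie x (lie y f) ys - lie y (lie x f) ys"
    by (rule lie_circ) (use f Suc.prems xs in simp_all)
  have L: "lie x (cob f) xs = lie x (lie y f) ys - cob (lie x (\<lambda>zs. f (y # zs))) ys
      - (lie (circ x y) f ys - cob (\<lambda>zs. f (circ x y # zs)) ys)"
    unfolding xs(1) lie.simps(2)[of x "cob f"] 1 2 3 cob.simps(2)[of f "circ x y"] using ys by simp
  have R: "cob (lie x f) xs = lie y (lie x f) ys - cob (\<lambda>zs. lie x f (y # zs)) ys"
    unfolding xs(1) cob.simps(2)[of "lie x f" y] using ys by simp
  show ?case
    unfolding L R 4 5 by (simp only: algebra_simps)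
qed

text \<open>For positive degree,
  \<open>i_x d d f = L_x d f - d (L_x f - d i_x f) = d d i_x f\<close>. In degree 0 the value is
  \<open>r m (x \<circ> y) - l x (r m y) - r (r m x) y\<close>; \<open>rep_LR\<close> turns the
  first two terms into \<open>- r (l x m) y\<close>, and \<open>rep_RR\<close> cancels the
  rest.\<close>

lemma cob_cob:
  "ml n f \<Longrightarrow> length xs = Suc (Suc n) \<Longrightarrow> set xs \<subseteq> A \<Longrightarrow> cob (cob f) xs = 0"
proof (induction n arbitrary: f xs)
  case 0
  then obtain x y where xs: "xs = [x, y]" "x \<in> A" "y \<in> A"
    by (auto simp: length_Suc_conv)
  have f: "f [] \<in> M" and "r (f []) y \<in> M" "r (f []) x \<in> M" using 0 xs r_closed by auto
  then show ?case using xs rep_LR[OF xs(2,3) f] rep_RR[OF xs(2,3) f] 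
    by (simp add: l_uminus r_uminus)
next
  case (Suc n)
  then obtain x ys where xs: "xs = x # ys" "x \<in> A" "length ys = Suc (Suc n)" "set ys \<subseteq> A"
    by (cases xs) auto
  have ys: "ys \<noteq> []" using xs by auto
  note f = Suc.prems(1)
  have fx: "ml n (\<lambda>zs. f (x # zs))" using f xs by simp
  have "cob (\<lambda>zs. cob f (x # zs)) ys = cob (\<lambda>zs. lie x f zs - cob (\<lambda>zs. f (x # zs)) zs) ys"
    using xs by (intro cob_cong) auto
  also have "\<dots> = cob (lie x f) ys - cob (cob (\<lambda>zs. f (x # zs))) ys"
    by (rule cob_diff[of "Suc n"]) (use ml_lie[OF f xs(2)] ml_cob[OF fx] xs in simp_all)
  also have "cob (cob (\<lambda>zs. f (x # zs))) ys = 0"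
    by (rule Suc.IH) (use fx xs in auto)
  also have "cob (lie x f) ys = lie x (cob f) ys"
    using lie_cob[OF f xs(2-4)] by simp
  finally show ?case unfolding xs(1) cob.simps(2)[of "cob f" x] using ys by simp
qed

section \<open>Closed sums for the recursive operators\<close>

lemma lie_eq_sum:
  "lie x f xs = l x (f xs) - (\<Sum>j<length xs. f (xs[j := circ x (xs ! j)]))"
  by (induction xs arbitrary: f) (simp_all add: sum.lessThan_Suc_shift del: sum.lessThan_Suc)

text \<open>Each argument peeled off reverses the sign of the remaining differential. Hence the
  weight \<open>(-1)^k\<close> for the list index \<open>k\<close>, and \<open>(-1)^n\<close> on the
  right action, which is reached when one of the \<open>n\<close> arguments is left.\<close>

lemma cob_eq_sum:
  assumes "xs \<noteq> []"
  shows "cob f xs =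
      (\<Sum>k<length xs - 1. sM ((-1) ^ k) (l (xs ! k) (f (omit (Suc k) xs))))
    + sM ((-1) ^ length xs) (r (f (take (length xs - 1) xs)) (xs ! (length xs - 1)))
    + (\<Sum>k<length xs. \<Sum>j=Suc k..<length xs.
         sM ((-1) ^ Suc k) (f (omit (Suc k) (xs[j := circ (xs ! k) (xs ! j)]))))"
  using assms
proof (induction xs arbitrary: f)
  case (Cons x xs)
  show ?case
  proof (cases "xs = []")
    case False
    then obtain m where m: "length xs = Suc m" by (cases xs) auto
    let ?P = "\<lambda>f. \<Sum>k<length xs - 1. sM ((-1) ^ k) (l (xs ! k) (f (omit (Suc k) xs)))"
    let ?Q = "\<lambda>f. sM ((-1) ^ length xs) (r (f (take (length xs - 1) xs)) (xs ! (length xs - 1)))"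
    let ?R = "\<lambda>f. \<Sum>k<length xs. \<Sum>j=Suc k..<length xs.
         sM ((-1) ^ Suc k) (f (omit (Suc k) (xs[j := circ (xs ! k) (xs ! j)])))"
    let ?g = "\<lambda>zs. f (x # zs)"
    have omit: "omit (Suc (Suc k)) (x # ys) = x # omit (Suc k) ys" for k ys
      by (simp add: omit_def)
    have omit1: "omit (Suc 0) (x # ys) = ys" for ys
      by (simp add: omit_def)
    have P: "(\<Sum>k<length (x # xs) - 1. sM ((-1) ^ k) (l ((x # xs) ! k) (f (omit (Suc k) (x # xs)))))
        = l x (f xs) - ?P ?g"
      by (simp add: m sum.lessThan_Suc_shift omit omit1 sum_negf del: sum.lessThan_Suc)
    have Q: "sM ((-1) ^ length (x # xs)) (r (f (take (length (x # xs) - 1) (x # xs))) ((x # xs) ! (length (x # xs) - 1)))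
        = - ?Q ?g"
      by (simp add: m)
    have inner: "(\<Sum>j=Suc (Suc k)..<Suc (Suc m). h j) = (\<Sum>j=Suc k..<Suc m. h (Suc j))" for k and h :: "nat \<Rightarrow> 'm"
      by (rule sum.shift_bounds_Suc_ivl)
    have inner0: "(\<Sum>j=Suc 0..<Suc (Suc m). h j) = (\<Sum>j<Suc m. h (Suc j))" for h :: "nat \<Rightarrow> 'm"
      by (simp only: sum.shift_bounds_Suc_ivl lessThan_atLeast0)
    \<comment> \<open>The row \<open>k = 0\<close> consists of the product terms of
      \<open>lie x f xs\<close>; the later rows are those of the tail with the opposite
      sign.\<close>
    have R: "(\<Sum>k<length (x # xs). \<Sum>j=Suc k..<length (x # xs).
         sM ((-1) ^ Suc k) (f (omit (Suc k) ((x # xs)[j := circ ((x # xs) ! k) ((x # xs) ! j)]))))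
        = - (\<Sum>j<length xs. f (xs[j := circ x (xs ! j)])) - ?R ?g"
      unfolding length_Cons m sum.lessThan_Suc_shift[of _ "Suc m"] inner inner0
      by (simp add: omit omit1 sum_negf del: sum.lessThan_Suc)
    have IH: "cob ?g xs = ?P ?g + ?Q ?g + ?R ?g" by (rule Cons.IH) (rule False)
    show ?thesis
      unfolding P Q R cob.simps(2)[of f x xs] if_not_P[OF False] lie_eq_sum IH
      by (simp only: algebra_simps) simp
  qed (simp add: omit_def)
qed simp

lemma lp_coboundary_eq_cob:
  assumes "length xs = Suc n" "set xs \<subseteq> A"
  shows "lp_coboundary A circ sM l r (Suc n) f xs = cob f xs"
proof -
  have "xs \<noteq> []" using assms by auto
  have inner: "(\<Sum>j=Suc k + 1..Suc n. h j) = (\<Sum>j=Suc k..<Suc n. h (Suc j))" for k and h :: "nat \<Rightarrow> 'm"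
    by (rule sum.reindex_bij_witness[of _ Suc "\<lambda>j. j - 1"]) auto
  show ?thesis
    unfolding cob_eq_sum[OF \<open>xs \<noteq> []\<close>] lp_coboundary_def Let_def One_nat_def sum.atLeast1_atMost_eq
      inner[unfolded One_nat_def] assms(1)
    using assms by simp
qed

lemma lp_coboundary_outside:
  "\<not> (length xs = n \<and> set xs \<subseteq> A) \<Longrightarrow> lp_coboundary A circ sM l r n f xs = 0"
  by (simp add: lp_coboundary_def)

lemma lp_coboundary_in_cochains:
  assumes "f \<in> lp_cochains A add scale sM M n"
  shows "lp_coboundary A circ sM l r (Suc n) f \<in> lp_cochains A add scale sM M (Suc n)"
proof -
  have "ml (Suc n) (cob f)" using assms ml_cob unfolding lp_cochains_iff by blast
  then have "ml (Suc n) (lp_coboundary A circ sM l r (Suc n) f)"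
    using ml_cong[of "Suc n" "lp_coboundary A circ sM l r (Suc n) f" "cob f"] lp_coboundary_eq_cob by blast
  then show ?thesis unfolding lp_cochains_iff using lp_coboundary_outside by blast
qed

lemma lp_coboundary_square:
  assumes "f \<in> lp_cochains A add scale sM M n"
  shows "lp_coboundary A circ sM l r (Suc (Suc n)) (lp_coboundary A circ sM l r (Suc n) f) = 0"
proof
  fix xs
  show "lp_coboundary A circ sM l r (Suc (Suc n)) (lp_coboundary A circ sM l r (Suc n) f) xs = 0 xs"
  proof (cases "length xs = Suc (Suc n) \<and> set xs \<subseteq> A")
    case True
    then have "lp_coboundary A circ sM l r (Suc (Suc n)) (lp_coboundary A circ sM l r (Suc n) f) xs
        = cob (lp_coboundary A circ sM l r (Suc n) f) xs"
      using lp_coboundary_eq_cob by blast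
    also have "\<dots> = cob (cob f) xs"
      using True by (intro cob_cong lp_coboundary_eq_cob) auto
    also have "\<dots> = 0"
      using True assms by (intro cob_cob[of n]) (auto simp: lp_cochains_iff)
    finally show ?thesis by simp
  qed (simp add: lp_coboundary_outside)
qed

theorem lp_cochain_complex:
  "cochain_complex (fun_scale sM) (lp_cochains A add scale sM M)
     (\<lambda>n. lp_coboundary A circ sM l r (n + 1))"
proof -
  have "linear_on (lp_cochains A add scale sM M n) (fun_scale sM) (fun_scale sM)
      (lp_coboundary A circ sM l r (Suc n))" for n
    unfolding linear_on_def
  proof (intro conjI ballI allI ext)
    fix f g xs
    assume "f \<in> lp_cochains A add scale sM M n" "g \<in> lp_cochains A add scale sM M n"
    then have "ml n f" "ml n g" by (simp_all add: lp_cochains_iff)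
    then show "lp_coboundary A circ sM l r (Suc n) (f + g) xs
        = (lp_coboundary A circ sM l r (Suc n) f + lp_coboundary A circ sM l r (Suc n) g) xs"
      using cob_plus[of n f g xs]
      by (cases "length xs = Suc n \<and> set xs \<subseteq> A")
        (simp_all add: lp_coboundary_eq_cob lp_coboundary_outside plus_fun_def)
  next
    fix c f xs
    assume "f \<in> lp_cochains A add scale sM M n"
    then have "ml n f" by (simp add: lp_cochains_iff)
    then show "lp_coboundary A circ sM l r (Suc n) (fun_scale sM c f) xs
        = fun_scale sM c (lp_coboundary A circ sM l r (Suc n) f) xs"
      using cob_sM[of n f xs c]
      by (cases "length xs = Suc n \<and> set xs \<subseteq> A")
        (simp_all add: lp_coboundary_eq_cob lp_coboundary_outside fun_scale_def)
  qed
  then show ?thesis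
    unfolding cochain_complex_def
    using M.subspace_lp_cochains[OF M_subspace] vector_space_fun_scale[OF M.vector_space_axioms]
      lp_coboundary_in_cochains lp_coboundary_square by auto
qed

end

section \<open>The tensor square as a Leibniz algebra and its representation on Hom(T,V)\<close>

lemma lookup_free_scale [simp]:
  "Poly_Mapping.lookup (free_scale c p) x = c * Poly_Mapping.lookup p x"
  by (simp add: free_scale_def Poly_Mapping.map.rep_eq when_def)

lemma vector_space_free_scale: "vector_space free_scale"
  by unfold_locales (rule poly_mapping_eqI, simp add: lookup_add algebra_simps)+

interpretation free: vector_space free_scale
  by (rule vector_space_free_scale)

definition free_ext ::
  "('k::field \<Rightarrow> 'w::ab_group_add \<Rightarrow> 'w) \<Rightarrow> ('x \<Rightarrow> 'w) \<Rightarrow> ('x \<Rightarrow>\<^sub>0 'k) \<Rightarrow> 'w" where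
  "free_ext s g p = (\<Sum>x\<in>Poly_Mapping.keys p. s (Poly_Mapping.lookup p x) (g x))"

lemma tensor_ext_eq_free_ext: "tensor_ext s b X = free_ext s (\<lambda>(x, y). b x y) (SOME p. p \<in> X)"
  by (simp add: tensor_ext_def free_ext_def Let_def split_def)

context vector_space begin

text \<open>The support of a sum can shrink by cancellation, so additivity is proved by writing all
  three extensions over one common finite set.\<close>

lemma free_ext_superset:
  assumes "finite S" "Poly_Mapping.keys p \<subseteq> S"
  shows "free_ext scale g p = (\<Sum>x\<in>S. scale (Poly_Mapping.lookup p x) (g x))"
  unfolding free_ext_def using assms by (intro sum.mono_neutral_left) (auto simp: in_keys_iff)

lemma free_ext_add: "free_ext scale g (p + q) = free_ext scale g p + free_ext scale g q"
proof -
  let ?S = "Poly_Mapping.keys p \<union> Poly_Mapping.keys q"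
  have "Poly_Mapping.keys (p + q) \<subseteq> ?S" by (rule Poly_Mapping.keys_add)
  then show ?thesis
    by (simp add: free_ext_superset[of ?S] lookup_add scale_left_distrib sum.distrib)
qed

lemma free_ext_scale: "free_ext scale g (free_scale c p) = scale c (free_ext scale g p)"
proof -
  have "Poly_Mapping.keys (free_scale c p) \<subseteq> Poly_Mapping.keys p"
    by (auto simp: in_keys_iff)
  then show ?thesis
    by (simp add: free_ext_superset[of "Poly_Mapping.keys p"] scale_sum_right)
qed

lemma free_ext_gen [simp]: "free_ext scale g (free_gen x) = g x"
  by (simp add: free_ext_def)

lemma linear_free_ext: "Vector_Spaces.linear free_scale scale (free_ext scale g)"
  by unfold_locales (simp_all add: free_ext_add free_ext_scale)

lemma free_ext_diff: "free_ext scale g (p - q) = free_ext scale g p - free_ext scale g q"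
  using linear_free_ext by (rule Vector_Spaces.linear.axioms(3)[THEN module_hom.diff])

lemma free_ext_fun_add:
  "free_ext scale (\<lambda>x. g x + h x) p = free_ext scale g p + free_ext scale h p"
  by (simp add: free_ext_def scale_right_distrib sum.distrib)

lemma free_ext_fun_scale:
  "free_ext scale (\<lambda>x. scale c (g x)) p = scale c (free_ext scale g p)"
  by (simp add: free_ext_def scale_sum_right mult.commute)

lemma free_ext_fun_diff:
  "free_ext scale (\<lambda>x. g x - h x) p = free_ext scale g p - free_ext scale h p"
  by (simp add: free_ext_def scale_right_diff_distrib sum_subtractf)

lemma free_ext_in_subspace:
  assumes "subspace N" "\<And>x. g x \<in> N"
  shows "free_ext scale g p \<in> N"
  unfolding free_ext_def by (intro subspace_sum subspace_scale assms)

text \<open>The representative is chosen from the coset alone, so all the maps involved are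
  evaluated on the same one.\<close>

lemma tensor_ext_fun_add:
  "tensor_ext scale (\<lambda>x y. b x y + b' x y) X = tensor_ext scale b X + tensor_ext scale b' X"
  unfolding tensor_ext_eq_free_ext free_ext_fun_add[symmetric] split_def ..

lemma tensor_ext_fun_scale:
  "tensor_ext scale (\<lambda>x y. scale c (b x y)) X = scale c (tensor_ext scale b X)"
  unfolding tensor_ext_eq_free_ext free_ext_fun_scale[symmetric] split_def ..

end

lemma free_ext_self: "free_ext free_scale free_gen p = p"
  by (rule poly_mapping_eqI)
    (simp add: free_ext_def lookup_sum lookup_single when_def in_keys_iff if_distrib cong: if_cong)

lemma free_induct [case_names gen add scale zero]:
  assumes "\<And>x. P (free_gen x)"
    and "\<And>p q. P p \<Longrightarrow> P q \<Longrightarrow> P (p + q)"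
    and "\<And>c p. P p \<Longrightarrow> P (free_scale c p)"
    and "P 0"
  shows "P p"
proof -
  have "P (\<Sum>x\<in>S. free_scale (f x) (free_gen x))" if "finite S" for S f
    using that by (induction S) (auto intro: assms)
  then have "P (free_ext free_scale free_gen p)" unfolding free_ext_def by simp
  then show ?thesis by (simp add: free_ext_self)
qed

definition bilinear_map ::
  "('k::field \<Rightarrow> 'a::ab_group_add \<Rightarrow> 'a) \<Rightarrow> ('k \<Rightarrow> 'w::ab_group_add \<Rightarrow> 'w) \<Rightarrow> ('a \<Rightarrow> 'a \<Rightarrow> 'w) \<Rightarrow> bool" where
  "bilinear_map sT s b \<longleftrightarrow>
     (\<forall>x y z. b (x + y) z = b x z + b y z) \<and> (\<forall>x y z. b x (y + z) = b x y + b x z) \<and>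
     (\<forall>c x y. b (sT c x) y = s c (b x y)) \<and> (\<forall>c x y. b x (sT c y) = s c (b x y))"

section \<open>Cosets, pure tensors and bilinear extension\<close>

context vector_space begin

lemma subspace_tensor_relations: "free.subspace (tensor_relations scale)"
  unfolding tensor_relations_def by (rule free.subspace_span)

lemma tensor_class_eq_iff:
  "tensor_class scale p = tensor_class scale q \<longleftrightarrow> p - q \<in> tensor_relations scale"
proof
  assume "tensor_class scale p = tensor_class scale q"
  moreover have "p \<in> tensor_class scale p"
    by (simp add: tensor_class_def free.subspace_0[OF subspace_tensor_relations])
  ultimately show "p - q \<in> tensor_relations scale" by (simp add: tensor_class_def)
next
  assume *: "p - q \<in> tensor_relations scale"
  have "r - p \<in> tensor_relations scale \<longleftrightarrow> r - q \<in> tensor_relations scale" for r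
    using free.subspace_add[OF subspace_tensor_relations _ *, of "r - p"]
      free.subspace_diff[OF subspace_tensor_relations _ *, of "r - q"] by auto
  then show "tensor_class scale p = tensor_class scale q" by (auto simp: tensor_class_def)
qed

lemma tensor_class_self: "p \<in> tensor_class scale p"
  by (simp add: tensor_class_def free.subspace_0[OF subspace_tensor_relations])

lemma tensor_class_in_space [simp]: "tensor_class scale p \<in> tensor_space scale"
  by (simp add: tensor_space_def)

lemma tensor_in_space [simp]: "tensor scale x y \<in> tensor_space scale"
  by (simp add: tensor_def)

lemma tensor_add_class:
  "tensor_add (tensor_class scale p) (tensor_class scale q) = tensor_class scale (p + q)"
proof (intro set_eqI iffI)
  fix r assume "r \<in> tensor_add (tensor_class scale p) (tensor_class scale q)"
  then obtain p' q' where "r = p' + q'" "p' - p \<in> tensor_relations scale" "q' - q \<in> tensor_relations scale"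
    by (auto simp: tensor_add_def tensor_class_def)
  moreover from this have "(p' - p) + (q' - q) \<in> tensor_relations scale"
    by (intro free.subspace_add[OF subspace_tensor_relations])
  ultimately show "r \<in> tensor_class scale (p + q)" by (simp add: tensor_class_def algebra_simps)
next
  fix r assume "r \<in> tensor_class scale (p + q)"
  then have "r - q \<in> tensor_class scale p" by (simp add: tensor_class_def algebra_simps)
  moreover have "r = (r - q) + q" by simp
  ultimately show "r \<in> tensor_add (tensor_class scale p) (tensor_class scale q)"
    unfolding tensor_add_def using tensor_class_self by blast
qed

lemma tensor_scale_class:
  "tensor_scale scale c (tensor_class scale p) = tensor_class scale (free_scale c p)"
proof (intro set_eqI iffI)
  fix r assume "r \<in> tensor_scale scale c (tensor_class scale p)"
  then obtain p' u where r: "r = free_scale c p' + u" "p' - p \<in> tensor_relations scale" "u \<in> tensor_relations scale"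
    by (auto simp: tensor_scale_def tensor_class_def)
  then have "free_scale c (p' - p) + u \<in> tensor_relations scale"
    using free.subspace_add[OF subspace_tensor_relations] free.subspace_scale[OF subspace_tensor_relations] by blast
  then show "r \<in> tensor_class scale (free_scale c p)"
    using r by (simp add: tensor_class_def free.scale_right_diff_distrib algebra_simps)
next
  fix r assume "r \<in> tensor_class scale (free_scale c p)"
  then have "r - free_scale c p \<in> tensor_relations scale" by (simp add: tensor_class_def)
  moreover have "r = free_scale c p + (r - free_scale c p)" by simp
  ultimately show "r \<in> tensor_scale scale c (tensor_class scale p)"
    unfolding tensor_scale_def using tensor_class_self by blast
qed

lemma tensor_space_cases:
  assumes "X \<in> tensor_space scale"
  obtains p where "X = tensor_class scale p"
  using assms by (auto simp: tensor_space_def)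

lemma tensor_space_closed:
  "X \<in> tensor_space scale \<Longrightarrow> Y \<in> tensor_space scale \<Longrightarrow> tensor_add X Y \<in> tensor_space scale"
  "X \<in> tensor_space scale \<Longrightarrow> tensor_scale scale c X \<in> tensor_space scale"
  "tensor_zero scale \<in> tensor_space scale"
  by (auto simp: tensor_space_def tensor_add_class tensor_scale_class tensor_zero_def)

lemma vector_space_on_tensor:
  "vector_space_on (tensor_space scale) tensor_add (tensor_zero scale) (tensor_scale scale)"
proof
  fix X assume "X \<in> tensor_space scale"
  then obtain p where "X = tensor_class scale p" by (rule tensor_space_cases)
  then have "tensor_add X (tensor_class scale (- p)) = tensor_zero scale"
    by (simp add: tensor_add_class tensor_zero_def)
  then show "\<exists>Y\<in>tensor_space scale. tensor_add X Y = tensor_zero scale" by (auto simp: tensor_space_def)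
qed (auto elim!: tensor_space_cases simp: tensor_add_class tensor_scale_class tensor_zero_def
    tensor_space_closed free.scale_right_distrib free.scale_left_distrib ac_simps)

lemma tensor_add_left: "tensor scale (x + y) z = tensor_add (tensor scale x z) (tensor scale y z)"
  unfolding tensor_def tensor_add_class tensor_class_eq_iff tensor_relations_def
  by (rule free.span_base) (simp add: diff_diff_eq[symmetric], blast)

lemma tensor_add_right: "tensor scale x (y + z) = tensor_add (tensor scale x y) (tensor scale x z)"
  unfolding tensor_def tensor_add_class tensor_class_eq_iff tensor_relations_def
  by (rule free.span_base) (simp add: diff_diff_eq[symmetric], blast)

lemma tensor_scale_left: "tensor scale (scale c x) y = tensor_scale scale c (tensor scale x y)"
  unfolding tensor_def tensor_scale_class tensor_class_eq_iff tensor_relations_def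
  by (rule free.span_base) blast

lemma tensor_scale_right: "tensor scale x (scale c y) = tensor_scale scale c (tensor scale x y)"
  unfolding tensor_def tensor_scale_class tensor_class_eq_iff tensor_relations_def
  by (rule free.span_base) blast

lemma tensor_space_induct [consumes 1, case_names tensor add scale]:
  assumes "X \<in> tensor_space scale"
    and tensor: "\<And>x y. P (tensor scale x y)"
    and add: "\<And>X Y. X \<in> tensor_space scale \<Longrightarrow> Y \<in> tensor_space scale \<Longrightarrow> P X \<Longrightarrow> P Y \<Longrightarrow> P (tensor_add X Y)"
    and scale: "\<And>c X. X \<in> tensor_space scale \<Longrightarrow> P X \<Longrightarrow> P (tensor_scale scale c X)"
  shows "P X"
proof -
  obtain p where p: "X = tensor_class scale p" using assms(1) by (rule tensor_space_cases)
  have "P (tensor_class scale p)"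
  proof (induction p rule: free_induct)
    case (gen x)
    then show ?case using tensor[of "fst x" "snd x"] by (simp add: tensor_def)
  next
    case (add p q)
    then show ?case using assms(3)[of "tensor_class scale p" "tensor_class scale q"] by (simp add: tensor_add_class)
  next
    case (scale c p)
    then show ?case using assms(4)[of "tensor_class scale p" c] by (simp add: tensor_scale_class)
  next
    case zero
    \<comment> \<open>Zero is \<open>0\<close> times a pure tensor and so falls under the scaling
      premise.\<close>
    show ?case using assms(4)[of "tensor scale 0 0" 0] tensor by (simp add: tensor_def tensor_scale_class)
  qed
  then show ?thesis by (simp add: p)
qed

text \<open>The preimage of \<open>N\<close> is a subspace containing all generating relations. With
  \<open>N = {0}\<close> this is well-definedness of the extension of a bilinear map; with
  \<open>N\<close> the relations themselves it handles the product, which is bilinear only modulo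
  \<open>N\<close>.\<close>

lemma free_ext_relation:
  assumes "vector_space s" and N: "module.subspace s N"
    and "\<And>x y z. b (x + y) z - b x z - b y z \<in> N" "\<And>x y z. b x (y + z) - b x y - b x z \<in> N"
    and "\<And>c x y. b (scale c x) y - s c (b x y) \<in> N" "\<And>c x y. b x (scale c y) - s c (b x y) \<in> N"
    and p: "p \<in> tensor_relations scale"
  shows "free_ext s (\<lambda>(x, y). b x y) p \<in> N"
proof -
  interpret W: vector_space s by fact
  let ?g = "\<lambda>(x, y). b x y"
  have "free.subspace {p. free_ext s ?g p \<in> N}"
    unfolding free.subspace_def
    by (auto simp: W.free_ext_add W.free_ext_scale W.subspace_add[OF N] W.subspace_scale[OF N])
      (simp add: free_ext_def W.subspace_0[OF N])
  moreover note rel = p[unfolded tensor_relations_def]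
  ultimately have "p \<in> {p. free_ext s ?g p \<in> N}"
    by (rule_tac free.span_subspace_induct[OF rel])
      (use assms(3-6) in \<open>auto simp: W.free_ext_diff W.free_ext_scale\<close>)
  then show ?thesis by simp
qed

lemma tensor_ext_class:
  assumes "vector_space s" "bilinear_map scale s b"
  shows "tensor_ext s b (tensor_class scale p) = free_ext s (\<lambda>(x, y). b x y) p"
proof -
  interpret W: vector_space s by fact
  define q where "q = (SOME q. q \<in> tensor_class scale p)"
  have "q \<in> tensor_class scale p" unfolding q_def using tensor_class_self by (rule someI)
  then have "q - p \<in> tensor_relations scale" by (simp add: tensor_class_def)
  \<comment> \<open>The chosen representative \<open>q\<close> differs from \<open>p\<close> by a
    relation, and a bilinear map has defect exactly zero.\<close>
  then have "free_ext s (\<lambda>(x, y). b x y) (q - p) \<in> {0}"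
    by (intro free_ext_relation assms(1)) (use assms(2) in \<open>auto simp: bilinear_map_def\<close>)
  then show ?thesis by (simp add: tensor_ext_eq_free_ext q_def[symmetric] W.free_ext_diff)
qed

lemma
  assumes "vector_space s" "bilinear_map scale s b"
  shows tensor_ext_tensor: "tensor_ext s b (tensor scale x y) = b x y"
    and tensor_ext_add: "X \<in> tensor_space scale \<Longrightarrow> Y \<in> tensor_space scale \<Longrightarrow>
      tensor_ext s b (tensor_add X Y) = tensor_ext s b X + tensor_ext s b Y"
    and tensor_ext_scale: "X \<in> tensor_space scale \<Longrightarrow>
      tensor_ext s b (tensor_scale scale c X) = s c (tensor_ext s b X)"
proof -
  interpret W: vector_space s by fact
  note [simp] = tensor_ext_class[OF assms] tensor_add_class tensor_scale_class
  show "tensor_ext s b (tensor scale x y) = b x y" by (simp add: tensor_def)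
  show "X \<in> tensor_space scale \<Longrightarrow> Y \<in> tensor_space scale \<Longrightarrow>
      tensor_ext s b (tensor_add X Y) = tensor_ext s b X + tensor_ext s b Y"
    by (auto elim!: tensor_space_cases simp: W.free_ext_add)
  show "X \<in> tensor_space scale \<Longrightarrow> tensor_ext s b (tensor_scale scale c X) = s c (tensor_ext s b X)"
    by (auto elim!: tensor_space_cases simp: W.free_ext_scale)
qed

end

section \<open>The Leibniz product on the tensor square\<close>

context lie_triple_system begin

lemmas br_simps =
  br_linear1[THEN Vector_Spaces.linear.axioms(3), THEN module_hom.add]
  br_linear2[THEN Vector_Spaces.linear.axioms(3), THEN module_hom.add]
  br_linear3[THEN Vector_Spaces.linear.axioms(3), THEN module_hom.add]
  br_linear1[THEN Vector_Spaces.linear.axioms(3), THEN module_hom.scale]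
  br_linear2[THEN Vector_Spaces.linear.axioms(3), THEN module_hom.scale]
  br_linear3[THEN Vector_Spaces.linear.axioms(3), THEN module_hom.scale]

definition circ_gen :: "'a \<Rightarrow> 'a \<Rightarrow> 'a \<times> 'a \<Rightarrow> ('a \<times> 'a) \<Rightarrow>\<^sub>0 'k" where
  "circ_gen x1 x2 = (\<lambda>(y1, y2). free_gen (br x1 x2 y1, y2) + free_gen (y1, br x1 x2 y2))"

definition free_circ :: "(('a \<times> 'a) \<Rightarrow>\<^sub>0 'k) \<Rightarrow> (('a \<times> 'a) \<Rightarrow>\<^sub>0 'k) \<Rightarrow> (('a \<times> 'a) \<Rightarrow>\<^sub>0 'k)" where
  "free_circ p q = free_ext free_scale (\<lambda>(x1, x2). free_ext free_scale (circ_gen x1 x2) q) p"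

lemma free_circ_add_left: "free_circ (p + p') q = free_circ p q + free_circ p' q"
  and free_circ_scale_left: "free_circ (free_scale c p) q = free_scale c (free_circ p q)"
  and free_circ_diff_left: "free_circ (p - p') q = free_circ p q - free_circ p' q"
  by (simp_all add: free_circ_def free.free_ext_add free.free_ext_scale free.free_ext_diff)

lemma free_circ_add_right: "free_circ p (q + q') = free_circ p q + free_circ p q'"
  and free_circ_scale_right: "free_circ p (free_scale c q) = free_scale c (free_circ p q)"
  and free_circ_diff_right: "free_circ p (q - q') = free_circ p q - free_circ p q'"
  by (simp_all add: free_circ_def free.free_ext_add free.free_ext_scale free.free_ext_diff
      free.free_ext_fun_add free.free_ext_fun_scale free.free_ext_fun_diff split_def)

lemmas tensor_relations_intros =
  free.subspace_add[OF subspace_tensor_relations] free.subspace_diff[OF subspace_tensor_relations]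

lemma gen_relations:
  "free_gen (x + y, z) - free_gen (x, z) - free_gen (y, z) \<in> tensor_relations sT"
  "free_gen (x, y + z) - free_gen (x, y) - free_gen (x, z) \<in> tensor_relations sT"
  "free_gen (sT c x, y) - free_scale c (free_gen (x, y)) \<in> tensor_relations sT"
  "free_gen (x, sT c y) - free_scale c (free_gen (x, y)) \<in> tensor_relations sT"
  unfolding tensor_relations_def by (rule free.span_base; blast)+

text \<open>\<open>free_gen\<close> is not additive in the entries of the pair, so linearity of the
  bracket yields only congruences. Grouping the two summands of \<open>circ_gen\<close> separately
  exhibits each defect as a sum of two defining relations.\<close>

lemma circ_gen_relations_left:
  "circ_gen (x + x') y z - circ_gen x y z - circ_gen x' y z \<in> tensor_relations sT"
  "circ_gen x (y + y') z - circ_gen x y z - circ_gen x y' z \<in> tensor_relations sT"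
  "circ_gen (sT c x) y z - free_scale c (circ_gen x y z) \<in> tensor_relations sT"
  "circ_gen x (sT c y) z - free_scale c (circ_gen x y z) \<in> tensor_relations sT"
proof -
  obtain u v where z: "z = (u, v)" by (cases z)
  have *: "(a + b) - (a' + b') - (a'' + b'') = (a - a' - a'') + (b - b' - b'')"
    for a b a' b' a'' b'' :: "('a \<times> 'a) \<Rightarrow>\<^sub>0 'k" by simp
  have **: "(a + b) - free_scale c (a' + b') = (a - free_scale c a') + (b - free_scale c b')"
    for c a b a' b' by (simp add: free.scale_right_distrib)
  show "circ_gen (x + x') y z - circ_gen x y z - circ_gen x' y z \<in> tensor_relations sT"
    "circ_gen x (y + y') z - circ_gen x y z - circ_gen x y' z \<in> tensor_relations sT"
    "circ_gen (sT c x) y z - free_scale c (circ_gen x y z) \<in> tensor_relations sT"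
    "circ_gen x (sT c y) z - free_scale c (circ_gen x y z) \<in> tensor_relations sT"
    unfolding circ_gen_def z prod.case br_simps * **
    by (intro tensor_relations_intros gen_relations)+
qed

lemma circ_gen_relations_right:
  "circ_gen x y (u + u', v) - circ_gen x y (u, v) - circ_gen x y (u', v) \<in> tensor_relations sT"
  "circ_gen x y (u, v + v') - circ_gen x y (u, v) - circ_gen x y (u, v') \<in> tensor_relations sT"
  "circ_gen x y (sT c u, v) - free_scale c (circ_gen x y (u, v)) \<in> tensor_relations sT"
  "circ_gen x y (u, sT c v) - free_scale c (circ_gen x y (u, v)) \<in> tensor_relations sT"
proof -
  have *: "(a + b) - (a' + b') - (a'' + b'') = (a - a' - a'') + (b - b' - b'')"
    for a b a' b' a'' b'' :: "('a \<times> 'a) \<Rightarrow>\<^sub>0 'k" by simp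
  have **: "(a + b) - free_scale c (a' + b') = (a - free_scale c a') + (b - free_scale c b')"
    for c a b a' b' by (simp add: free.scale_right_distrib)
  show "circ_gen x y (u + u', v) - circ_gen x y (u, v) - circ_gen x y (u', v) \<in> tensor_relations sT"
    "circ_gen x y (u, v + v') - circ_gen x y (u, v) - circ_gen x y (u, v') \<in> tensor_relations sT"
    "circ_gen x y (sT c u, v) - free_scale c (circ_gen x y (u, v)) \<in> tensor_relations sT"
    "circ_gen x y (u, sT c v) - free_scale c (circ_gen x y (u, v)) \<in> tensor_relations sT"
    unfolding circ_gen_def prod.case br_simps * **
    by (intro tensor_relations_intros gen_relations)+
qed

text \<open>For fixed \<open>q\<close> the inner extension is linear in the function being extended,
  so its defect of bilinearity in \<open>(x1, x2)\<close> is an extension of the defects of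
  \<open>circ_gen\<close>, and these lie in the relations.\<close>

lemma free_circ_relation_left:
  assumes "p \<in> tensor_relations sT"
  shows "free_circ p q \<in> tensor_relations sT"
  unfolding free_circ_def
  using vector_space_free_scale subspace_tensor_relations _ _ _ _ assms
  by (rule free_ext_relation)
    (simp_all only: free.free_ext_fun_diff[symmetric] free.free_ext_fun_scale[symmetric],
      (rule free.free_ext_in_subspace[OF subspace_tensor_relations]; rule circ_gen_relations_left)+)

lemma free_circ_relation_right:
  assumes "q \<in> tensor_relations sT"
  shows "free_circ p q \<in> tensor_relations sT"
proof -
  have "free_ext free_scale (\<lambda>(y1, y2). circ_gen x1 x2 (y1, y2)) q \<in> tensor_relations sT" for x1 x2
    using vector_space_free_scale subspace_tensor_relations circ_gen_relations_right assms
    by (rule free_ext_relation)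
  then show ?thesis
    unfolding free_circ_def
    by (intro free.free_ext_in_subspace[OF subspace_tensor_relations]) auto
qed

lemma tensor_circ_class:
  "tensor_circ sT br (tensor_class sT p) (tensor_class sT q) = tensor_class sT (free_circ p q)"
proof -
  define p' where "p' = (SOME r. r \<in> tensor_class sT p)"
  define q' where "q' = (SOME r. r \<in> tensor_class sT q)"
  have "p' \<in> tensor_class sT p" "q' \<in> tensor_class sT q"
    unfolding p'_def q'_def by (rule someI, rule tensor_class_self)+
  then have "p' - p \<in> tensor_relations sT" "q' - q \<in> tensor_relations sT"
    by (auto simp: tensor_class_def)
  \<comment> \<open>This sum telescopes to \<open>free_circ p' q' - free_circ p q\<close>.\<close>
  then have "free_circ (p' - p) q' + free_circ p (q' - q) \<in> tensor_relations sT"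
    by (rule free.subspace_add[OF subspace_tensor_relations free_circ_relation_left free_circ_relation_right])
  then have "tensor_class sT (free_circ p' q') = tensor_class sT (free_circ p q)"
    by (simp add: tensor_class_eq_iff free_circ_diff_left free_circ_diff_right)
  then show ?thesis
    by (simp add: tensor_circ_def tensor_ext_eq_free_ext p'_def[symmetric] q'_def[symmetric]
        free_circ_def circ_gen_def)
qed

lemma tensor_circ_tensor:
  "tensor_circ sT br (tensor sT x1 x2) (tensor sT y1 y2)
    = tensor_add (tensor sT (br x1 x2 y1) y2) (tensor sT y1 (br x1 x2 y2))"
  unfolding tensor_def tensor_circ_class tensor_add_class
  by (simp add: free_circ_def circ_gen_def)

lemma
  assumes "X \<in> tensor_space sT" "Y \<in> tensor_space sT"
  shows tensor_circ_closed: "tensor_circ sT br X Y \<in> tensor_space sT"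
    and tensor_circ_scale_left:
      "tensor_circ sT br (tensor_scale sT c X) Y = tensor_scale sT c (tensor_circ sT br X Y)"
    and tensor_circ_scale_right:
      "tensor_circ sT br X (tensor_scale sT c Y) = tensor_scale sT c (tensor_circ sT br X Y)"
    and tensor_circ_add_left: "Z \<in> tensor_space sT \<Longrightarrow>
      tensor_circ sT br (tensor_add X Z) Y = tensor_add (tensor_circ sT br X Y) (tensor_circ sT br Z Y)"
    and tensor_circ_add_right: "Z \<in> tensor_space sT \<Longrightarrow>
      tensor_circ sT br X (tensor_add Y Z) = tensor_add (tensor_circ sT br X Y) (tensor_circ sT br X Z)"
  using assms
  by (auto elim!: tensor_space_cases simp: tensor_circ_class tensor_add_class tensor_scale_class
      free_circ_add_left free_circ_add_right free_circ_scale_left free_circ_scale_right)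

text \<open>On pure tensors the derivation rule is applied in each factor of
  \<open>z1 \<otimes> z2\<close> separately. The mixed terms, with \<open>[x1,x2,_]\<close> on one
  factor and \<open>[y1,y2,_]\<close> on the other, are the same in
  \<open>x \<circ> (y \<circ> z)\<close> and \<open>y \<circ> (x \<circ> z)\<close>.\<close>

lemma tensor_circ_leibniz:
  assumes "X \<in> tensor_space sT" "Y \<in> tensor_space sT" "Z \<in> tensor_space sT"
  shows "tensor_circ sT br X (tensor_circ sT br Y Z)
    = tensor_add (tensor_circ sT br (tensor_circ sT br X Y) Z) (tensor_circ sT br Y (tensor_circ sT br X Z))"
proof -
  interpret L: vector_space_on "tensor_space sT" tensor_add "tensor_zero sT" "tensor_scale sT"
    by (rule vector_space_on_tensor)
  \<comment> \<open>\<open>tensor_add\<close> is an operation on sets and not a type class addition,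
    so the regrouping needed in the additive cases is obtained from representatives.\<close>
  have swap: "tensor_add (tensor_add a b) (tensor_add c d) = tensor_add (tensor_add a c) (tensor_add b d)"
    if "a \<in> tensor_space sT" "b \<in> tensor_space sT" "c \<in> tensor_space sT" "d \<in> tensor_space sT" for a b c d
    using that by (auto elim!: tensor_space_cases simp: tensor_add_class ac_simps)
  note simps = tensor_circ_add_left tensor_circ_add_right tensor_circ_scale_left tensor_circ_scale_right
    tensor_circ_closed tensor_space_closed L.scale_add_right
  show ?thesis using assms
  proof (induction X rule: tensor_space_induct)
    case (tensor x1 x2)
    show ?case using assms(2,3)
    proof (induction Y rule: tensor_space_induct)
      case (tensor y1 y2)
      show ?case using assms(3)
      proof (induction Z rule: tensor_space_induct)
        case (tensor z1 z2)
        have 1: "br x1 x2 (br y1 y2 z) = br (br x1 x2 y1) y2 z + br y1 (br x1 x2 y2) z + br y1 y2 (br x1 x2 z)" for z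
          by (rule br_derivation)
        show ?case
          by (simp add: tensor_circ_tensor simps 1 tensor_add_left tensor_add_right)
            (simp add: tensor_def tensor_add_class ac_simps)
      qed (simp_all add: simps swap)
    qed (simp_all add: simps swap)
  qed (simp_all add: simps swap)
qed

theorem leibniz_algebra_tensor:
  "leibniz_algebra (tensor_space sT) tensor_add (tensor_zero sT) (tensor_scale sT) (tensor_circ sT br)"
proof -
  interpret L: vector_space_on "tensor_space sT" tensor_add "tensor_zero sT" "tensor_scale sT"
    by (rule vector_space_on_tensor)
  show ?thesis
    by unfold_locales
      (simp_all add: tensor_circ_closed tensor_circ_add_left tensor_circ_add_right
        tensor_circ_scale_left tensor_circ_scale_right tensor_circ_leibniz[symmetric])
qed

end

lemma (in vector_space) subspace_Hom_space:
  assumes "vector_space s"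
  shows "module.subspace (fun_scale s) (Hom_space scale s)"
proof -
  interpret W: vector_space s by fact
  interpret F: vector_space "fun_scale s" by (rule vector_space_fun_scale) fact
  show ?thesis
    unfolding F.subspace_def
    by (auto simp: Hom_space_def Vector_Spaces.linear_iff vector_space_axioms W.vector_space_axioms
        fun_scale_def W.scale_right_distrib algebra_simps)
qed

section \<open>The left and right actions on Hom(T,V)\<close>

context lts_representation begin

abbreviation th where "th x y \<equiv> \<theta> (tensor sT x y)"
abbreviation D where "D \<equiv> rep_D sT \<theta>"

lemma Hom_iff: "\<phi> \<in> Hom_space sT sV \<longleftrightarrow> (\<forall>x y. \<phi> (x + y) = \<phi> x + \<phi> y) \<and> (\<forall>c x. \<phi> (sT c x) = sV c (\<phi> x))"
  by (simp add: Hom_space_def Vector_Spaces.linear_iff vector_space_axioms V.vector_space_axioms)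

lemma th_simps:
  "th (x + x') y v = th x y v + th x' y v"
  "th x (y + y') v = th x y v + th x y' v"
  "th (sT c x) y v = sV c (th x y v)"
  "th x (sT c y) v = sV c (th x y v)"
  "th x y (v + v') = th x y v + th x y v'"
  "th x y (v - v') = th x y v - th x y v'"
  "th x y (- v) = - th x y v"
  "th x y (sV c v) = sV c (th x y v)"
  "th x y 0 = 0"
proof -
  interpret E: Vector_Spaces.linear sV sV "th x y" by (rule theta_End) simp
  show "th x y (v + v') = th x y v + th x y v'"
    "th x y (v - v') = th x y v - th x y v'"
    "th x y (- v) = - th x y v"
    "th x y (sV c v) = sV c (th x y v)"
    "th x y 0 = 0"
    by (rule E.add E.diff E.neg E.scale E.zero)+
qed (simp_all add: tensor_add_left tensor_add_right tensor_scale_left tensor_scale_right theta_add theta_scale)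

lemma D_def: "D x y v = th y x v - th x y v"
  by (rule rep_D_def)

lemma th_R1: "D x1 x2 (th y1 y2 v) = th y1 y2 (D x1 x2 v) + th (br x1 x2 y1) y2 v + th y1 (br x1 x2 y2) v"
  using R1[of x1 x2 y1 y2 v] by (simp add: tensor_circ_tensor theta_add algebra_simps)

lemma th_R2: "th x1 (br y1 y2 y3) v = th y2 y3 (th x1 y1 v) - th y1 y3 (th x1 y2 v) + D y1 y2 (th x1 y3 v)"
  by (rule R2)

text \<open>\<open>D y1 y2\<close> is a difference of two values of \<open>\<theta>\<close>, so this
  is (R1) for both of them, subtracted.\<close>

lemma D_D: "D x1 x2 (D y1 y2 v) = D y1 y2 (D x1 x2 v) + D (br x1 x2 y1) y2 v + D y1 (br x1 x2 y2) v"
proof -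
  have "D x1 x2 (D y1 y2 v) = D x1 x2 (th y2 y1 v) - D x1 x2 (th y1 y2 v)"
    by (simp add: D_def th_simps)
  then show ?thesis
    unfolding th_R1 by (simp add: D_def algebra_simps)
qed

lemma D_simps:
  "D (x + x') y v = D x y v + D x' y v"
  "D x (y + y') v = D x y v + D x y' v"
  "D (sT c x) y v = sV c (D x y v)"
  "D x (sT c y) v = sV c (D x y v)"
  "D x y (v + v') = D x y v + D x y v'"
  "D x y (v - v') = D x y v - D x y v'"
  "D x y (- v) = - D x y v"
  "D x y (sV c v) = sV c (D x y v)"
  by (simp_all add: D_def th_simps V.scale_right_diff_distrib)

definition lact :: "('a \<Rightarrow> 'b) \<Rightarrow> 'a \<Rightarrow> 'a \<Rightarrow> 'a \<Rightarrow> 'b" where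
  "lact \<phi> x1 x2 x3 = D x1 x2 (\<phi> x3) - \<phi> (br x1 x2 x3)"

definition ract :: "('a \<Rightarrow> 'b) \<Rightarrow> 'a \<Rightarrow> 'a \<Rightarrow> 'a \<Rightarrow> 'b" where
  "ract \<phi> x1 x2 x3 = \<phi> (br x1 x2 x3) - D x1 x2 (\<phi> x3) + th x1 x3 (\<phi> x2) - th x2 x3 (\<phi> x1)"

lemma left_action_eq: "left_action sT br sV \<theta> X \<phi> = tensor_ext (fun_scale sV) (lact \<phi>) X"
  by (simp add: left_action_def lact_def[abs_def])

lemma right_action_eq: "right_action sT br sV \<theta> \<phi> X = tensor_ext (fun_scale sV) (ract \<phi>) X"
  by (simp add: right_action_def ract_def[abs_def])

lemma vector_space_Hom: "vector_space (fun_scale sV)"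
  by (rule vector_space_fun_scale) (rule V.vector_space_axioms)

interpretation FV: vector_space "fun_scale sV"
  by (rule vector_space_Hom)

lemma subspace_Hom: "FV.subspace (Hom_space sT sV)"
  by (rule subspace_Hom_space) (rule V.vector_space_axioms)

lemma bilinear_lact: "\<phi> \<in> Hom_space sT sV \<Longrightarrow> bilinear_map sT (fun_scale sV) (lact \<phi>)"
  by (auto simp: bilinear_map_def lact_def fun_scale_def Hom_iff fun_eq_iff D_simps br_simps
      V.scale_right_diff_distrib algebra_simps)

lemma bilinear_ract: "\<phi> \<in> Hom_space sT sV \<Longrightarrow> bilinear_map sT (fun_scale sV) (ract \<phi>)"
  by (auto simp: bilinear_map_def ract_def fun_scale_def Hom_iff fun_eq_iff D_simps th_simps br_simps
      V.scale_right_diff_distrib V.scale_right_distrib algebra_simps)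

lemma lact_Hom: "\<phi> \<in> Hom_space sT sV \<Longrightarrow> lact \<phi> x y \<in> Hom_space sT sV"
  by (auto simp: lact_def Hom_iff D_simps br_simps V.scale_right_diff_distrib algebra_simps)

lemma ract_Hom: "\<phi> \<in> Hom_space sT sV \<Longrightarrow> ract \<phi> x y \<in> Hom_space sT sV"
  by (auto simp: ract_def Hom_iff D_simps th_simps br_simps V.scale_right_diff_distrib
      V.scale_right_distrib algebra_simps)

lemmas left_action_simps =
  tensor_ext_tensor[OF vector_space_Hom bilinear_lact, folded left_action_eq]
  tensor_ext_add[OF vector_space_Hom bilinear_lact, folded left_action_eq]
  tensor_ext_scale[OF vector_space_Hom bilinear_lact, folded left_action_eq]

lemmas right_action_simps =
  tensor_ext_tensor[OF vector_space_Hom bilinear_ract, folded right_action_eq]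
  tensor_ext_add[OF vector_space_Hom bilinear_ract, folded right_action_eq]
  tensor_ext_scale[OF vector_space_Hom bilinear_ract, folded right_action_eq]

lemma left_action_Hom:
  assumes "X \<in> tensor_space sT" "\<phi> \<in> Hom_space sT sV"
  shows "left_action sT br sV \<theta> X \<phi> \<in> Hom_space sT sV"
  using assms(1) by (induction rule: tensor_space_induct)
    (simp_all only: left_action_simps assms(2) lact_Hom FV.subspace_add[OF subspace_Hom]
      FV.subspace_scale[OF subspace_Hom])

lemma right_action_Hom:
  assumes "X \<in> tensor_space sT" "\<phi> \<in> Hom_space sT sV"
  shows "right_action sT br sV \<theta> \<phi> X \<in> Hom_space sT sV"
  using assms(1) by (induction rule: tensor_space_induct)
    (simp_all only: right_action_simps assms(2) ract_Hom FV.subspace_add[OF subspace_Hom]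
      FV.subspace_scale[OF subspace_Hom])

lemma left_action_plus:
  "left_action sT br sV \<theta> X (\<phi> + \<psi>) = left_action sT br sV \<theta> X \<phi> + left_action sT br sV \<theta> X \<psi>"
proof -
  have "lact (\<phi> + \<psi>) = (\<lambda>x y. lact \<phi> x y + lact \<psi> x y)"
    by (auto simp: lact_def fun_eq_iff D_simps)
  then show ?thesis unfolding left_action_eq by (simp only: FV.tensor_ext_fun_add)
qed

lemma left_action_scale:
  "left_action sT br sV \<theta> X (fun_scale sV c \<phi>) = fun_scale sV c (left_action sT br sV \<theta> X \<phi>)"
proof -
  have "lact (fun_scale sV c \<phi>) = (\<lambda>x y. fun_scale sV c (lact \<phi> x y))"
    by (auto simp: lact_def fun_eq_iff D_simps fun_scale_def V.scale_right_diff_distrib)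
  then show ?thesis unfolding left_action_eq by (simp only: FV.tensor_ext_fun_scale)
qed

lemma right_action_plus:
  "right_action sT br sV \<theta> (\<phi> + \<psi>) X = right_action sT br sV \<theta> \<phi> X + right_action sT br sV \<theta> \<psi> X"
proof -
  have "ract (\<phi> + \<psi>) = (\<lambda>x y. ract \<phi> x y + ract \<psi> x y)"
    by (auto simp: ract_def fun_eq_iff D_simps th_simps)
  then show ?thesis unfolding right_action_eq by (simp only: FV.tensor_ext_fun_add)
qed

lemma right_action_scale:
  "right_action sT br sV \<theta> (fun_scale sV c \<phi>) X = fun_scale sV c (right_action sT br sV \<theta> \<phi> X)"
proof -
  have "ract (fun_scale sV c \<phi>) = (\<lambda>x y. fun_scale sV c (ract \<phi> x y))"
    by (auto simp: ract_def fun_eq_iff D_simps th_simps fun_scale_def V.scale_right_diff_distrib V.scale_right_distrib)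
  then show ?thesis unfolding right_action_eq by (simp only: FV.tensor_ext_fun_scale)
qed

context
  fixes \<phi> assumes \<phi>: "\<phi> \<in> Hom_space sT sV"
begin

text \<open>The mixed terms \<open>D x1 x2 (\<phi> [y1,y2,z])\<close> and
  \<open>D y1 y2 (\<phi> [x1,x2,z])\<close> cancel in the commutator. \<open>D_D\<close> accounts
  for what acts on \<open>\<phi> z\<close>, the derivation rule for what stands inside
  \<open>\<phi>\<close>.\<close>

lemma left_action_circ_tensor:
  "left_action sT br sV \<theta> (tensor_circ sT br (tensor sT x1 x2) (tensor sT y1 y2)) \<phi>
    = lact (lact \<phi> y1 y2) x1 x2 - lact (lact \<phi> x1 x2) y1 y2"
proof
  fix z
  have p: "\<phi> (a + b) = \<phi> a + \<phi> b" for a b using \<phi> by (simp add: Hom_iff)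
  show "left_action sT br sV \<theta> (tensor_circ sT br (tensor sT x1 x2) (tensor sT y1 y2)) \<phi> z
    = (lact (lact \<phi> y1 y2) x1 x2 - lact (lact \<phi> x1 x2) y1 y2) z"
    using D_D[of x1 x2 y1 y2 "\<phi> z"]
    by (simp add: tensor_circ_tensor left_action_simps \<phi> lact_def D_simps p
        br_derivation[of x1 x2 y1 y2 z] algebra_simps)
qed

text \<open>Besides the ingredients of the left-left law, the two \<open>\<theta>\<close> terms of
  the right action have to be commuted past \<open>D x1 x2\<close>; this is (R1) for the pairs
  \<open>(y1, z)\<close> and \<open>(y2, z)\<close>.\<close>

lemma right_action_circ_tensor:
  "right_action sT br sV \<theta> \<phi> (tensor_circ sT br (tensor sT x1 x2) (tensor sT y1 y2))
    = lact (ract \<phi> y1 y2) x1 x2 - ract (lact \<phi> x1 x2) y1 y2"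
proof
  fix z
  have p: "\<phi> (a + b) = \<phi> a + \<phi> b" for a b using \<phi> by (simp add: Hom_iff)
  show "right_action sT br sV \<theta> \<phi> (tensor_circ sT br (tensor sT x1 x2) (tensor sT y1 y2)) z
    = (lact (ract \<phi> y1 y2) x1 x2 - ract (lact \<phi> x1 x2) y1 y2) z"
    using D_D[of x1 x2 y1 y2 "\<phi> z"] th_R1[of x1 x2 y1 z "\<phi> y2"] th_R1[of x1 x2 y2 z "\<phi> y1"]
    by (simp add: tensor_circ_tensor right_action_simps \<phi> lact_def ract_def D_simps th_simps p
        br_derivation[of x1 x2 y1 y2 z] algebra_simps)
qed

text \<open>The two actions of \<open>x1 \<otimes> x2\<close> on \<open>\<phi>\<close> add up to the
  map sending \<open>w\<close> to \<open>th x1 w (\<phi> x2) - th x2 w (\<phi> x1)\<close>. By (R2)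
  the right action annihilates every map of this form.\<close>

lemma ract_lact_tensor: "ract (lact \<phi> x1 x2) y1 y2 = - ract (ract \<phi> x1 x2) y1 y2"
proof
  fix z
  show "ract (lact \<phi> x1 x2) y1 y2 z = (- ract (ract \<phi> x1 x2) y1 y2) z"
    using th_R2[of x1 y1 y2 z "\<phi> x2"] th_R2[of x2 y1 y2 z "\<phi> x1"]
    by (simp add: ract_def lact_def D_simps th_simps)
qed

end

theorem leibniz_representation_Hom:
  "leibniz_representation (tensor_space sT) tensor_add (tensor_zero sT) (tensor_scale sT)
     (tensor_circ sT br) (fun_scale sV) (Hom_space sT sV)
     (left_action sT br sV \<theta>) (right_action sT br sV \<theta>)"
proof -
  interpret L: leibniz_algebra "tensor_space sT" tensor_add "tensor_zero sT" "tensor_scale sT" "tensor_circ sT br"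
    by (rule leibniz_algebra_tensor)
  note closed = tensor_circ_closed tensor_space_closed left_action_Hom right_action_Hom lact_Hom ract_Hom
  note simps = tensor_circ_add_left tensor_circ_add_right tensor_circ_scale_left tensor_circ_scale_right
    left_action_simps right_action_simps left_action_plus left_action_scale
    right_action_plus right_action_scale closed FV.scale_right_diff_distrib
  show ?thesis
  proof
    show "FV.subspace (Hom_space sT sV)" by (rule subspace_Hom)
    fix X Y \<phi> assume X: "X \<in> tensor_space sT" and Y: "Y \<in> tensor_space sT" and \<phi>: "\<phi> \<in> Hom_space sT sV"
    show "left_action sT br sV \<theta> (tensor_circ sT br X Y) \<phi>
      = left_action sT br sV \<theta> X (left_action sT br sV \<theta> Y \<phi>) - left_action sT br sV \<theta> Y (left_action sT br sV \<theta> X \<phi>)"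
      using X
    proof (induction X rule: tensor_space_induct)
      case (tensor x1 x2)
      show ?case using Y
        by (induction Y rule: tensor_space_induct)
          (simp_all only: simps \<phi> left_action_circ_tensor tensor_in_space, simp_all only: algebra_simps)
    qed (simp_all only: simps \<phi> Y, simp_all only: algebra_simps)
    show "right_action sT br sV \<theta> \<phi> (tensor_circ sT br X Y)
      = left_action sT br sV \<theta> X (right_action sT br sV \<theta> \<phi> Y) - right_action sT br sV \<theta> (left_action sT br sV \<theta> X \<phi>) Y"
      using X
    proof (induction X rule: tensor_space_induct)
      case (tensor x1 x2)
      show ?case using Y
        by (induction Y rule: tensor_space_induct)
          (simp_all only: simps \<phi> right_action_circ_tensor tensor_in_space, simp_all only: algebra_simps)
    qed (simp_all only: simps \<phi> Y, simp_all only: algebra_simps)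
    show "right_action sT br sV \<theta> (left_action sT br sV \<theta> X \<phi>) Y
      = - right_action sT br sV \<theta> (right_action sT br sV \<theta> \<phi> X) Y"
      using X
    proof (induction X rule: tensor_space_induct)
      case (tensor x1 x2)
      show ?case using Y
        by (induction Y rule: tensor_space_induct)
          (simp_all only: simps \<phi> ract_lact_tensor tensor_in_space minus_add_distrib FV.scale_minus_right)
    qed (simp_all only: simps \<phi> Y minus_add_distrib FV.scale_minus_right)
  qed (simp_all add: simps linear_on_def)
qed

end

section \<open>Multilinear maps as cochains on the tensor square\<close>

lemma pair_up_0 [simp]: "pair_up sT 0 xs = []"
  by (simp add: pair_up_def)

lemma pair_up_Suc [simp]: "pair_up sT (Suc n) (x # y # zs) = tensor sT x y # pair_up sT n zs"
  by (simp add: pair_up_def upt_conv_Cons map_Suc_upt[symmetric] comp_def del: upt_Suc)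

lemma length_pair_up [simp]: "length (pair_up sT n xs) = n"
  by (simp add: pair_up_def)

lemma (in vector_space) set_pair_up: "set (pair_up scale n xs) \<subseteq> tensor_space scale"
  by (auto simp: pair_up_def)

text \<open>The symmetry conditions concern the last pair, whereas \<open>pair_up\<close> unfolds
  from the front.\<close>

lemma pair_up_append:
  "length xs = 2 * n \<Longrightarrow> pair_up sT n xs @ [tensor sT x y] = pair_up sT (Suc n) (xs @ [x, y])"
proof (induction n arbitrary: xs)
  case 0
  then show ?case by simp
next
  case (Suc n)
  then obtain a b zs where "xs = a # b # zs" "length zs = 2 * n"
    by (auto simp: length_Suc_conv)
  then show ?case using Suc.IH by simp
qed

lemma multilinear_on_append:
  "multilinear_on A add sc s M (n + length Ys) f \<Longrightarrow> set Ys \<subseteq> A \<Longrightarrow>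
    multilinear_on A add sc s M n (\<lambda>Xs. f (Xs @ Ys))"
  by (induction n arbitrary: f) (auto intro: multilinear_on_value)

lemma multilinear_on_apply:
  "multilinear_on A add sc (fun_scale s) M n f \<Longrightarrow> multilinear_on A add sc s UNIV n (\<lambda>Xs. f Xs y)"
  by (induction n arbitrary: f) (auto simp: fun_scale_def)

text \<open>Pure tensors span, so the arguments can be made pure one at a time from the front. It is
  stated as vanishing because it is applied both to differences of cochains and to the three-term
  cyclic sums.\<close>

lemma (in vector_space) multilinear_on_tensor_eq_0:
  assumes "multilinear_on (tensor_space scale) tensor_add (tensor_scale scale) s M n g"
    and "vector_space s"
    and "\<And>xs. length xs = 2 * n \<Longrightarrow> g (pair_up scale n xs) = 0"
    and "length Xs = n" "set Xs \<subseteq> tensor_space scale"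
  shows "g Xs = 0"
  using assms(1,3-)
proof (induction n arbitrary: g Xs)
  case 0
  then show ?case by fastforce
next
  case (Suc n)
  interpret W: vector_space s by fact
  note g = Suc.prems(1)[unfolded multilinear_on.simps]
  obtain X Ys where Xs: "Xs = X # Ys" "X \<in> tensor_space scale" "length Ys = n" "set Ys \<subseteq> tensor_space scale"
    using Suc.prems(3,4) by (cases Xs) auto
  from Xs(2) have "g (X # Ys) = 0"
  proof (induction X rule: tensor_space_induct)
    case (tensor x y)
    have "g (pair_up scale (Suc n) (x # y # zs)) = 0" if "length zs = 2 * n" for zs
      by (rule Suc.prems(2)) (use that in simp)
    moreover have "multilinear_on (tensor_space scale) tensor_add (tensor_scale scale) s M n
        (\<lambda>Ys. g (tensor scale x y # Ys))"
      using g by simp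
    ultimately show ?case
      using Suc.IH[of "\<lambda>Ys. g (tensor scale x y # Ys)", OF _ _ Xs(3,4)] by simp
  qed (use g Xs in auto)
  then show ?case using Xs by simp
qed

context lts_representation begin

interpretation FV: vector_space "fun_scale sV"
  by (rule vector_space_Hom)

abbreviation Mult where "Mult \<equiv> multilinear_maps sT sV"
abbreviation LP where "LP \<equiv> lts_lp_cochains sT sV"
abbreviation TML where
  "TML \<equiv> multilinear_on (tensor_space sT) tensor_add (tensor_scale sT) (fun_scale sV) (Hom_space sT sV)"

lemma multilinear_maps_outside: "\<omega> \<in> Mult m \<Longrightarrow> length xs \<noteq> m \<Longrightarrow> \<omega> xs = 0"
  by (simp add: multilinear_maps_def)

lemma multilinear_maps_linear: "\<omega> \<in> Mult m \<Longrightarrow> length xs = m \<Longrightarrow> i < m \<Longrightarrow> (\<lambda>x. \<omega> (xs[i := x])) \<in> Hom_space sT sV"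
  by (simp add: multilinear_maps_def Hom_space_def)

lemma multilinear_maps_I:
  assumes "\<And>xs. length xs \<noteq> m \<Longrightarrow> \<omega> xs = 0"
    and "\<And>xs i. length xs = m \<Longrightarrow> i < m \<Longrightarrow> (\<lambda>x. \<omega> (xs[i := x])) \<in> Hom_space sT sV"
  shows "\<omega> \<in> Mult m"
  using assms by (simp add: multilinear_maps_def Hom_space_def)

lemma subspace_multilinear_maps: "FV.subspace (Mult m)"
  unfolding FV.subspace_def
proof (intro conjI ballI allI)
  have z: "(\<lambda>x. 0) \<in> Hom_space sT sV" by (simp add: Hom_iff)
  show "0 \<in> Mult m" by (rule multilinear_maps_I) (use z in simp_all)
next
  fix \<omega> \<omega>' assume w: "\<omega> \<in> Mult m" "\<omega>' \<in> Mult m"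
  show "\<omega> + \<omega>' \<in> Mult m"
    using w[THEN multilinear_maps_outside] FV.subspace_add[OF subspace_Hom w[THEN multilinear_maps_linear]]
    by (intro multilinear_maps_I) (auto simp: plus_fun_def)
next
  fix c \<omega> assume w: "\<omega> \<in> Mult m"
  show "fun_scale sV c \<omega> \<in> Mult m"
    using w[THEN multilinear_maps_outside] FV.subspace_scale[OF subspace_Hom w[THEN multilinear_maps_linear]]
    by (intro multilinear_maps_I) (auto simp: fun_scale_def)
qed

lemma multilinear_maps_Cons:
  assumes "\<omega> \<in> Mult (Suc m)"
  shows "(\<lambda>zs. \<omega> (x # zs)) \<in> Mult m"
proof (rule multilinear_maps_I)
  fix xs :: "'a list" and i assume "length xs = m" "i < m"
  then show "(\<lambda>y. \<omega> (x # xs[i := y])) \<in> Hom_space sT sV"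
    using multilinear_maps_linear[OF assms, of "x # xs" "Suc i"] by simp
qed (use multilinear_maps_outside[OF assms] in simp)

text \<open>If \<open>zs\<close> has the wrong length, all three values are the default 0. Validity
  for every \<open>zs\<close> is what allows rewriting under the binder in
  \<open>bilinear_lift\<close>.\<close>

lemma multilinear_maps_add:
  assumes "\<omega> \<in> Mult (Suc m)"
  shows "\<omega> ((x + y) # zs) = \<omega> (x # zs) + \<omega> (y # zs)"
  using multilinear_maps_linear[OF assms, of "x # zs" 0] multilinear_maps_outside[OF assms]
  by (cases "length zs = m") (auto simp: Hom_iff)

lemma multilinear_maps_scale:
  assumes "\<omega> \<in> Mult (Suc m)"
  shows "\<omega> (sT c x # zs) = sV c (\<omega> (x # zs))"
  using multilinear_maps_linear[OF assms, of "x # zs" 0] multilinear_maps_outside[OF assms]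
  by (cases "length zs = m") (auto simp: Hom_iff)

lemma multilinear_maps_single: "\<omega> \<in> Mult (Suc 0) \<Longrightarrow> (\<lambda>w. \<omega> [w]) \<in> Hom_space sT sV"
  using multilinear_maps_linear[of \<omega> "Suc 0" "[0]" 0] by simp

text \<open>The universal property of \<open>T \<otimes> T\<close>, iterated: the first two
  arguments are extended bilinearly with values in the lift of the remaining ones, and the last
  unpaired argument stays as the argument of the resulting map.\<close>

primrec lift :: "('a list \<Rightarrow> 'b) \<Rightarrow> ('k, 'a) tensor2 list \<Rightarrow> 'a \<Rightarrow> 'b" where
  "lift \<omega> [] = (\<lambda>w. \<omega> [w])"
| "lift \<omega> (X # Xs) = tensor_ext (fun_scale sV) (\<lambda>x y. lift (\<lambda>zs. \<omega> (x # y # zs)) Xs) X"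

lemma lift_add: "lift (\<lambda>zs. \<omega> zs + \<omega>' zs) Xs = lift \<omega> Xs + lift \<omega>' Xs"
proof (induction Xs arbitrary: \<omega> \<omega>')
  case Nil
  show ?case by (simp add: plus_fun_def)
next
  case (Cons X Xs)
  show ?case unfolding lift.simps Cons.IH by (rule FV.tensor_ext_fun_add)
qed

lemma lift_scale: "lift (\<lambda>zs. sV c (\<omega> zs)) Xs = fun_scale sV c (lift \<omega> Xs)"
proof (induction Xs arbitrary: \<omega>)
  case Nil
  show ?case by (simp add: fun_scale_def)
next
  case (Cons X Xs)
  show ?case unfolding lift.simps Cons.IH by (rule FV.tensor_ext_fun_scale)
qed

lemma bilinear_lift:
  assumes "\<omega> \<in> Mult (Suc (Suc m))"
  shows "bilinear_map sT (fun_scale sV) (\<lambda>x y. lift (\<lambda>zs. \<omega> (x # y # zs)) Xs)"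
  unfolding bilinear_map_def
  by (simp add: multilinear_maps_add[OF assms] multilinear_maps_scale[OF assms] multilinear_maps_add[OF multilinear_maps_Cons[OF assms]]
      multilinear_maps_scale[OF multilinear_maps_Cons[OF assms]] lift_add lift_scale)

lemma lift_tensor:
  "\<omega> \<in> Mult (Suc (Suc m)) \<Longrightarrow> lift \<omega> (tensor sT x y # Xs) = lift (\<lambda>zs. \<omega> (x # y # zs)) Xs"
  by (simp add: tensor_ext_tensor[OF vector_space_Hom bilinear_lift])

text \<open>Linearity in the first tensor comes from \<open>tensor_ext\<close>. For the other slots
  the first tensor may be taken pure, since multilinear functions form a subspace; then the
  induction hypothesis applies to \<open>\<omega>\<close> with two arguments inserted.\<close>

lemma multilinear_lift:
  "\<omega> \<in> Mult (2 * n + 1) \<Longrightarrow> TML n (lift \<omega>)"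
proof (induction n arbitrary: \<omega>)
  case 0
  then show ?case by (simp add: multilinear_maps_single)
next
  case (Suc n)
  then have w: "\<omega> \<in> Mult (Suc (Suc (2 * n + 1)))" by simp
  note ext = tensor_ext_add[OF vector_space_Hom bilinear_lift[OF w]]
    tensor_ext_scale[OF vector_space_Hom bilinear_lift[OF w]]
  have "TML n (\<lambda>Xs. lift \<omega> (X # Xs))" if "X \<in> tensor_space sT" for X
    using that
  proof (induction X rule: tensor_space_induct)
    case (tensor x y)
    show ?case
      unfolding lift_tensor[OF w] by (rule Suc.IH) (intro multilinear_maps_Cons w)
  next
    case (add X Y)
    show ?case
      using FV.multilinear_on_add[OF subspace_Hom add.IH] by (simp only: lift.simps ext add.hyps)
  next
    case (scale c X)
    show ?case
      using FV.multilinear_on_scale[OF subspace_Hom scale.IH] by (simp only: lift.simps ext scale.hyps)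
  qed
  then show ?case by (simp add: ext)
qed

lemma lift_pair_up:
  "\<omega> \<in> Mult (2 * n + 1) \<Longrightarrow> length xs = 2 * n \<Longrightarrow> lift \<omega> (pair_up sT n xs) w = \<omega> (xs @ [w])"
proof (induction n arbitrary: \<omega> xs)
  case 0
  then show ?case by simp
next
  case (Suc n)
  then have w: "\<omega> \<in> Mult (Suc (Suc (2 * n + 1)))" by simp
  obtain a b zs where xs: "xs = a # b # zs" "length zs = 2 * n"
    using Suc.prems by (auto simp: length_Suc_conv)
  have "lift (\<lambda>zs. \<omega> (a # b # zs)) (pair_up sT n zs) w = \<omega> (a # b # zs @ [w])"
    by (rule Suc.IH[OF multilinear_maps_Cons[OF multilinear_maps_Cons[OF w]] xs(2)])
  then show ?case by (simp add: xs(1) lift_tensor[OF w] del: lift.simps)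
qed

text \<open>Truncation of \<open>lift\<close> to the normalization demanded by
  \<open>lp_cochains\<close>.\<close>

definition lifted :: "nat \<Rightarrow> ('a list \<Rightarrow> 'b) \<Rightarrow> ('k, 'a) tensor2 list \<Rightarrow> 'a \<Rightarrow> 'b" where
  "lifted n \<omega> Xs = (if length Xs = n \<and> set Xs \<subseteq> tensor_space sT then lift \<omega> Xs else 0)"

lemma lifted_in_lp_cochains:
  assumes "\<omega> \<in> Mult (2 * n + 1)"
  shows "lifted n \<omega> \<in> LP n"
  unfolding lp_cochains_iff
proof
  show "TML n (lifted n \<omega>)"
    by (rule multilinear_on_cong[OF vector_space_on_tensor, THEN iffD2, OF _ multilinear_lift[OF assms]])
      (simp add: lifted_def)
qed (auto simp: lifted_def)

lemma lp_cochains_eqI: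
  assumes "f \<in> LP n" "g \<in> LP n"
    and "\<And>xs w. length xs = 2 * n \<Longrightarrow> f (pair_up sT n xs) w = g (pair_up sT n xs) w"
  shows "f = g"
proof
  fix Xs
  show "f Xs = g Xs"
  proof (cases "length Xs = n \<and> set Xs \<subseteq> tensor_space sT")
    case True
    have "f Xs - g Xs = 0"
      by (rule multilinear_on_tensor_eq_0[where g = "\<lambda>Xs. f Xs - g Xs" and n = n, OF FV.multilinear_on_diff[OF subspace_Hom]])
        (use assms True vector_space_Hom in \<open>auto simp: lp_cochains_iff fun_eq_iff\<close>)
    then show ?thesis by simp
  qed (use assms in \<open>simp add: lp_cochains_iff\<close>)
qed

text \<open>The description defining \<open>regard\<close> is discharged here: \<open>lifted\<close>
  is a witness, and a cochain with prescribed values on pure tensors is unique.\<close>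

lemma regard_eq_lifted:
  assumes "\<omega> \<in> Mult (2 * n + 1)"
  shows "regard sT sV n \<omega> = lifted n \<omega>"
  unfolding regard_def
proof (rule the_equality)
  have *: "lifted n \<omega> (pair_up sT n xs) w = \<omega> (xs @ [w])" if "length xs = 2 * n" for xs w
    using lift_pair_up[OF assms that] by (simp add: lifted_def set_pair_up)
  then show "lifted n \<omega> \<in> LP n \<and> (\<forall>xs w. length xs = 2 * n \<longrightarrow> lifted n \<omega> (pair_up sT n xs) w = \<omega> (xs @ [w]))"
    using lifted_in_lp_cochains[OF assms] by blast
  show "f = lifted n \<omega>"
    if "f \<in> LP n \<and> (\<forall>xs w. length xs = 2 * n \<longrightarrow> f (pair_up sT n xs) w = \<omega> (xs @ [w]))" for f
    using that * lifted_in_lp_cochains[OF assms] by (intro lp_cochains_eqI) auto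
qed

lemma regard_in_lp_cochains: "\<omega> \<in> Mult (2 * n + 1) \<Longrightarrow> regard sT sV n \<omega> \<in> LP n"
  by (simp add: regard_eq_lifted lifted_in_lp_cochains)

theorem regard_pair_up:
  "\<omega> \<in> Mult (2 * n + 1) \<Longrightarrow> length xs = 2 * n \<Longrightarrow> regard sT sV n \<omega> (pair_up sT n xs) w = \<omega> (xs @ [w])"
  by (simp add: regard_eq_lifted lifted_def set_pair_up lift_pair_up)

lemma regard_add:
  assumes "\<omega> \<in> Mult (2 * n + 1)" "\<omega>' \<in> Mult (2 * n + 1)"
  shows "regard sT sV n (\<omega> + \<omega>') = regard sT sV n \<omega> + regard sT sV n \<omega>'"
proof -
  have "lift (\<omega> + \<omega>') Xs = lift \<omega> Xs + lift \<omega>' Xs" for Xs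
    unfolding plus_fun_def[of \<omega> \<omega>'] by (rule lift_add)
  then show ?thesis
    unfolding regard_eq_lifted[OF assms(1)] regard_eq_lifted[OF assms(2)]
      regard_eq_lifted[OF FV.subspace_add[OF subspace_multilinear_maps assms]]
    by (simp add: lifted_def fun_eq_iff)
qed

lemma regard_scale:
  assumes "\<omega> \<in> Mult (2 * n + 1)"
  shows "regard sT sV n (fun_scale sV c \<omega>) = fun_scale (fun_scale sV) c (regard sT sV n \<omega>)"
proof -
  have "lift (fun_scale sV c \<omega>) Xs = fun_scale sV c (lift \<omega> Xs)" for Xs
    unfolding fun_scale_def[of sV c \<omega>] by (rule lift_scale)
  then have "lifted n (fun_scale sV c \<omega>) Xs = fun_scale sV c (lifted n \<omega> Xs)" for Xs
    by (cases "length Xs = n \<and> set Xs \<subseteq> tensor_space sT")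
      (simp_all only: lifted_def if_True if_False FV.scale_zero_right simp_thms)
  then show ?thesis
    unfolding regard_eq_lifted[OF assms] regard_eq_lifted[OF FV.subspace_scale[OF subspace_multilinear_maps assms]]
      fun_scale_def[of "fun_scale sV"] by blast
qed

theorem regard_linear:
  "linear_on (Mult (2 * n + 1)) (fun_scale sV) (fun_scale (fun_scale sV)) (regard sT sV n)"
  by (simp add: linear_on_def regard_add[simplified] regard_scale[simplified])

lemma regard_inj: "inj_on (regard sT sV n) (Mult (2 * n + 1))"
proof (rule inj_onI, rule ext)
  fix \<omega> \<omega>' and xs :: "'a list"
  assume w: "\<omega> \<in> Mult (2 * n + 1)" "\<omega>' \<in> Mult (2 * n + 1)" "regard sT sV n \<omega> = regard sT sV n \<omega>'"
  show "\<omega> xs = \<omega>' xs"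
  proof (cases "length xs = 2 * n + 1")
    case True
    then have xs: "xs = butlast xs @ [last xs]" "length (butlast xs) = 2 * n"
      by (auto intro!: append_butlast_last_id[symmetric])
    then show ?thesis
      using w regard_pair_up[OF w(1) xs(2), of "last xs"] regard_pair_up[OF w(2) xs(2), of "last xs"] by simp
  qed (use multilinear_maps_outside[OF w(1), of xs] multilinear_maps_outside[OF w(2), of xs] in simp)
qed

text \<open>The inverse of \<open>regard\<close>, with the default value demanded by
  \<open>multilinear_maps\<close>.\<close>

definition unpair :: "nat \<Rightarrow> (('k, 'a) tensor2 list \<Rightarrow> 'a \<Rightarrow> 'b) \<Rightarrow> 'a list \<Rightarrow> 'b" where
  "unpair n f xs = (if length xs = 2 * n + 1 then f (pair_up sT n (butlast xs)) (last xs) else 0)"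

text \<open>Changing one entry affects a single tensor, in its left or right factor according to
  parity. Linearity of \<open>unpair\<close> in each of the first \<open>2 * n\<close> entries thus
  reduces to linearity in a tensor slot.\<close>

lemma pair_up_update:
  assumes "length xs = 2 * n" "i < 2 * n"
  shows "pair_up sT n (xs[i := x]) = (pair_up sT n xs)[i div 2 :=
    (if even i then tensor sT x (xs ! (i + 1)) else tensor sT (xs ! (i - 1)) x)]"
proof (rule nth_equalityI)
  fix k assume "k < length (pair_up sT n (xs[i := x]))"
  then have k: "k < n" by simp
  then have "pair_up sT n (xs[i := x]) ! k = tensor sT (xs[i := x] ! (2 * k)) (xs[i := x] ! (2 * k + 1))"
    by (simp add: pair_up_def)
  moreover have "pair_up sT n xs ! k = tensor sT (xs ! (2 * k)) (xs ! (2 * k + 1))"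
    using k by (simp add: pair_up_def)
  ultimately show "pair_up sT n (xs[i := x]) ! k = (pair_up sT n xs)[i div 2 :=
    (if even i then tensor sT x (xs ! (i + 1)) else tensor sT (xs ! (i - 1)) x)] ! k"
    using k assms by (cases "\<exists>j. i = 2 * j") (auto simp: nth_list_update elim!: oddE)
qed simp

lemma unpair_in_multilinear_maps:
  assumes f: "f \<in> LP n"
  shows "unpair n f \<in> Mult (2 * n + 1)"
proof (rule multilinear_maps_I)
  fix xs :: "'a list" and i
  assume xs: "length xs = 2 * n + 1" and i: "i < 2 * n + 1"
  then have ne: "xs \<noteq> []" "length (butlast xs) = 2 * n" by auto
  show "(\<lambda>x. unpair n f (xs[i := x])) \<in> Hom_space sT sV"
  proof (cases "i = 2 * n")
    case True
    have "f (pair_up sT n (butlast xs)) \<in> Hom_space sT sV"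
      using f set_pair_up by (simp add: lp_cochains_def)
    moreover have "butlast (xs[i := x]) = butlast xs" "last (xs[i := x]) = x" for x
      using True xs ne(1) by (auto simp: butlast_list_update last_list_update)
    ultimately show ?thesis using xs by (simp add: unpair_def)
  next
    case False
    with i have i: "i < 2 * n" by simp
    let ?P = "pair_up sT n (butlast xs)"
    \<comment> \<open>The tensor containing the varied entry, its partner in the pair being kept
      fixed; it is linear in \<open>x\<close>.\<close>
    define T where "T x = (if even i then tensor sT x (butlast xs ! (i + 1)) else tensor sT (butlast xs ! (i - 1)) x)" for x
    have T: "T (x + y) = tensor_add (T x) (T y)" "T (sT c x) = tensor_scale sT c (T x)" "T x \<in> tensor_space sT" for x y c
      by (simp_all add: T_def tensor_add_left tensor_add_right tensor_scale_left tensor_scale_right)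
    have "butlast (xs[i := x]) = (butlast xs)[i := x]" "last (xs[i := x]) = last xs" for x
      using i xs ne(1) by (auto simp: butlast_list_update last_list_update)
    then have "unpair n f (xs[i := x]) = f (?P[i div 2 := T x]) (last xs)" for x
      using xs i ne(2) by (simp add: unpair_def pair_up_update T_def)
    moreover have "f (?P[i div 2 := T (x + y)]) = f (?P[i div 2 := T x]) + f (?P[i div 2 := T y])"
      and "f (?P[i div 2 := T (sT c x)]) = fun_scale sV c (f (?P[i div 2 := T x]))" for x y c
      unfolding T using f T(3) i set_pair_up[of n "butlast xs"] by (auto simp: lp_cochains_def)
    ultimately show ?thesis by (simp add: Hom_iff fun_scale_def)
  qed
qed (simp add: unpair_def)

lemma regard_unpair:
  assumes "f \<in> LP n"
  shows "regard sT sV n (unpair n f) = f"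
  by (rule lp_cochains_eqI[OF regard_in_lp_cochains[OF unpair_in_multilinear_maps[OF assms]] assms],
      subst regard_pair_up[OF unpair_in_multilinear_maps[OF assms]]) (simp_all add: unpair_def)

theorem regard_bij: "bij_betw (regard sT sV n) (Mult (2 * n + 1)) (LP n)"
  unfolding bij_betw_def
proof
  show "regard sT sV n ` Mult (2 * n + 1) = LP n"
  proof (intro equalityI subsetI)
    fix f assume "f \<in> LP n"
    then show "f \<in> regard sT sV n ` Mult (2 * n + 1)"
      using image_eqI[of f "regard sT sV n" "unpair n f", OF regard_unpair[symmetric] unpair_in_multilinear_maps] by blast
  qed (use regard_in_lp_cochains in blast)
qed (rule regard_inj)

section \<open>The two symmetry conditions on the tensor side\<close>

definition yamaguti_condition :: "nat \<Rightarrow> (('k, 'a) tensor2 list \<Rightarrow> 'a \<Rightarrow> 'b) \<Rightarrow> bool" where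
  "yamaguti_condition n f \<longleftrightarrow> (n \<ge> 1 \<longrightarrow>
          (\<forall>Xs x y z. length Xs = n - 1 \<and> set Xs \<subseteq> tensor_space sT \<longrightarrow>
             f (Xs @ [tensor sT x x]) y = 0 \<and>
             f (Xs @ [tensor sT x y]) z + f (Xs @ [tensor sT y z]) x + f (Xs @ [tensor sT z x]) y = 0))"

text \<open>The leading arguments range over all of \<open>T \<otimes> T\<close> on one side and
  over pure tensors on the other. For fixed \<open>x\<close>, \<open>y\<close>, \<open>z\<close>
  both conditions are multilinear in them, so vanishing on pure tensors suffices.\<close>

lemma yamaguti_condition_regard_iff:
  assumes w: "\<omega> \<in> Mult (2 * n + 1)"
  shows "\<omega> \<in> yamaguti_cochains sT sV n \<longleftrightarrow> yamaguti_condition n (regard sT sV n \<omega>)"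
proof (cases n)
  case 0
  then show ?thesis using w by (simp add: yamaguti_cochains_def yamaguti_condition_def)
next
  case (Suc m)
  let ?f = "regard sT sV n \<omega>"
  have f: "?f \<in> LP n" by (rule regard_in_lp_cochains[OF w])
  have eval: "?f (pair_up sT m xs @ [tensor sT x y]) z = \<omega> (xs @ [x, y, z])" if "length xs = 2 * m" for xs x y z
    using regard_pair_up[OF w, of "xs @ [x, y]" z] that by (simp add: pair_up_append Suc)
  \<comment> \<open>The last tensor and the argument of the homomorphism are frozen, leaving a map
    in \<open>m\<close> tensor arguments with values in \<open>V\<close>.\<close>
  have ml: "multilinear_on (tensor_space sT) tensor_add (tensor_scale sT) sV UNIV m
      (\<lambda>Xs. ?f (Xs @ [tensor sT x y]) z)" for x y z
    by (rule multilinear_on_apply[where M = "Hom_space sT sV"], rule multilinear_on_append) (use f in \<open>simp_all add: lp_cochains_iff Suc\<close>)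
  note ml3 = V.multilinear_on_add[OF V.subspace_UNIV V.multilinear_on_add[OF V.subspace_UNIV ml ml] ml]
  show ?thesis
  proof
    assume "\<omega> \<in> yamaguti_cochains sT sV n"
    then have *: "\<omega> (xs @ [x, x, y]) = 0"
        "\<omega> (xs @ [x, y, z]) + \<omega> (xs @ [y, z, x]) + \<omega> (xs @ [z, x, y]) = 0" if "length xs = 2 * m" for xs x y z
      using that by (auto simp: yamaguti_cochains_def Suc)
    have "?f (Xs @ [tensor sT x x]) y = 0" if "length Xs = m" "set Xs \<subseteq> tensor_space sT" for Xs x y
      by (rule multilinear_on_tensor_eq_0[OF ml V.vector_space_axioms _ that]) (simp add: eval *)
    moreover have "?f (Xs @ [tensor sT x y]) z + ?f (Xs @ [tensor sT y z]) x + ?f (Xs @ [tensor sT z x]) y = 0"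
      if "length Xs = m" "set Xs \<subseteq> tensor_space sT" for Xs x y z
      by (rule multilinear_on_tensor_eq_0[OF ml3 V.vector_space_axioms _ that]) (simp add: eval *)
    ultimately show "yamaguti_condition n ?f" by (simp add: yamaguti_condition_def Suc)
  next
    assume "yamaguti_condition n ?f"
    then have *: "?f (pair_up sT m xs @ [tensor sT x x]) y = 0 \<and>
      ?f (pair_up sT m xs @ [tensor sT x y]) z + ?f (pair_up sT m xs @ [tensor sT y z]) x
        + ?f (pair_up sT m xs @ [tensor sT z x]) y = 0" for xs x y z
      by (simp add: yamaguti_condition_def Suc set_pair_up)
    have "\<omega> (xs @ [x, x, y]) = 0 \<and>
      \<omega> (xs @ [x, y, z]) + \<omega> (xs @ [y, z, x]) + \<omega> (xs @ [z, x, y]) = 0" if "length xs = 2 * m" for xs x y z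
      using *[of xs x y z] by (simp only: eval[OF that])
    then show "\<omega> \<in> yamaguti_cochains sT sV n" using w by (simp add: yamaguti_cochains_def Suc)
  qed
qed

lemma yamaguti_subset: "yamaguti_cochains sT sV n \<subseteq> Mult (2 * n + 1)"
  by (auto simp: yamaguti_cochains_def)

theorem regard_yamaguti: "regard sT sV n ` yamaguti_cochains sT sV n = {f \<in> LP n. yamaguti_condition n f}"
proof (intro equalityI subsetI)
  fix f assume "f \<in> regard sT sV n ` yamaguti_cochains sT sV n"
  then show "f \<in> {f \<in> LP n. yamaguti_condition n f}"
    using yamaguti_subset yamaguti_condition_regard_iff regard_in_lp_cochains by (smt (verit) imageE mem_Collect_eq subsetD)
next
  fix f assume "f \<in> {f \<in> LP n. yamaguti_condition n f}"
  then show "f \<in> regard sT sV n ` yamaguti_cochains sT sV n"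
    using image_eqI[of f "regard sT sV n" "unpair n f", OF regard_unpair[of f n, symmetric]] unpair_in_multilinear_maps[of f n]
      yamaguti_condition_regard_iff[of "unpair n f" n] regard_unpair[of f n] by simp
qed

end

section \<open>Comparison of the coboundary operators\<close>

lemma sum_fun_apply: "(\<Sum>i\<in>I. F i) x = (\<Sum>i\<in>I. F i x)"
  by (induction I rule: infinite_finite_induct) simp_all

text \<open>The bracket terms of the Yamaguti formula at positions \<open>2j-1\<close> and
  \<open>2j\<close> make up one product of tensors; the term at \<open>2n+1\<close> belongs to the
  action on Hom(T,V).\<close>

lemma sum_pairs:
  fixes h :: "nat \<Rightarrow> 'b::ab_group_add"
  shows "k \<le> n \<Longrightarrow> (\<Sum>j=2 * k + 1..2 * n + 1. h j) = (\<Sum>j=k + 1..n. h (2 * j - 1) + h (2 * j)) + h (2 * n + 1)"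
proof (induction n rule: dec_induct)
  case base
  then show ?case by simp
next
  case (step n)
  have "(\<Sum>j=2 * k + 1..2 * Suc n + 1. h j) = (\<Sum>j=2 * k + 1..2 * n + 1. h j) + h (2 * n + 2) + h (2 * n + 3)"
    using step.hyps by (simp add: eval_nat_numeral)
  also have "\<dots> = (\<Sum>j=k + 1..Suc n. h (2 * j - 1) + h (2 * j)) + h (2 * Suc n + 1)"
    unfolding step.IH using step.hyps by (simp add: eval_nat_numeral algebra_simps)
  finally show ?case .
qed

lemma nth_omit:
  "1 \<le> k \<Longrightarrow> k \<le> length xs \<Longrightarrow> i < length xs - 1 \<Longrightarrow> omit k xs ! i = xs ! (if i < k - 1 then i else i + 1)"
  by (auto simp: omit_def nth_append)

lemma nth_omit_pair:
  assumes "1 \<le> k" "2 * k \<le> length xs" "i < length xs - 2"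
  shows "omit_pair k xs ! i = xs ! (if i < 2 * k - 2 then i else i + 2)"
proof -
  have "2 * k - 2 \<le> length xs" "i \<ge> 2 * k - 2 \<Longrightarrow> 2 * k + (i - (2 * k - 2)) = i + 2"
    using assms by simp_all
  then show ?thesis using assms(2) by (simp add: omit_pair_def nth_append min_absorb2)
qed

lemma omit_pair_up:
  assumes "1 \<le> k" "k \<le> n" "length xs = 2 * n"
  shows "omit k (pair_up sT n xs) = pair_up sT (n - 1) (omit_pair k xs)"
proof (rule nth_equalityI)
  show "length (omit k (pair_up sT n xs)) = length (pair_up sT (n - 1) (omit_pair k xs))"
    using assms by (simp add: omit_def)
  fix i assume "i < length (omit k (pair_up sT n xs))"
  then have i: "i < n - 1" using assms by (simp add: omit_def)
  have *: "2 * i < length xs - 2" "2 * i + 1 < length xs - 2" "2 * k \<le> length xs"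
    "2 * i < 2 * k - 2 \<longleftrightarrow> i < k - 1" "2 * i + 1 < 2 * k - 2 \<longleftrightarrow> i < k - 1"
    using i assms by auto
  show "omit k (pair_up sT n xs) ! i = pair_up sT (n - 1) (omit_pair k xs) ! i"
    using i assms nth_omit_pair[OF assms(1) *(3,1)] nth_omit_pair[OF assms(1) *(3,2)]
    by (simp add: nth_omit pair_up_def * del: One_nat_def) simp
qed

lemma length_omit_pair: "1 \<le> k \<Longrightarrow> 2 * k \<le> length xs \<Longrightarrow> length (omit_pair k xs) = length xs - 2"
  by (simp add: omit_pair_def)

lemma omit_pair_snoc: "2 * k \<le> length xs \<Longrightarrow> omit_pair k (xs @ [w]) = omit_pair k xs @ [w]"
  by (simp add: omit_pair_def)

lemma omit_update: "1 \<le> k \<Longrightarrow> k \<le> i \<Longrightarrow> i < length Xs \<Longrightarrow> omit k (Xs[i := Z]) = (omit k Xs)[i - 1 := Z]"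
  by (simp add: omit_def list_update_append drop_update_swap min_def)

section \<open>The differential preserves the symmetry conditions\<close>

context lts_representation begin

interpretation FV: vector_space "fun_scale sV"
  by (rule vector_space_Hom)

interpretation R: leibniz_representation "tensor_space sT" tensor_add "tensor_zero sT" "tensor_scale sT"
    "tensor_circ sT br" "fun_scale sV" "Hom_space sT sV" "left_action sT br sV \<theta>" "right_action sT br sV \<theta>"
  by (rule leibniz_representation_Hom)

abbreviation lpd where "lpd \<equiv> lts_lp_coboundary sT br sV \<theta>"
abbreviation yd where "yd \<equiv> yamaguti_coboundary sT br sV \<theta>"

text \<open>The leading arguments are fixed individually, so that insertion of one in front commutes
  with the condition and the inductions can follow the recursions of \<open>lie\<close> and
  \<open>cob\<close>.\<close>

definition symmetric_at :: "(('k, 'a) tensor2 list \<Rightarrow> 'a \<Rightarrow> 'b) \<Rightarrow> ('k, 'a) tensor2 list \<Rightarrow> bool" where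
  "symmetric_at f Xs \<longleftrightarrow> (\<forall>x y z. f (Xs @ [tensor sT x x]) y = 0 \<and>
     f (Xs @ [tensor sT x y]) z + f (Xs @ [tensor sT y z]) x + f (Xs @ [tensor sT z x]) y = 0)"

lemma symmetric_at_Cons: "symmetric_at f (X # Xs) = symmetric_at (\<lambda>Zs. f (X # Zs)) Xs"
  by (simp add: symmetric_at_def)

lemma symmetric_at_diff:
  assumes "symmetric_at f Xs" "symmetric_at g Xs"
  shows "symmetric_at (\<lambda>Zs. f Zs - g Zs) Xs"
proof -
  have *: "(a - a') + (b - b') + (c - c') = (a + b + c) - (a' + b' + c')" for a b c a' b' c' :: 'b
    by simp
  show ?thesis using assms by (simp add: symmetric_at_def *)
qed

lemma symmetric_at_add:
  assumes "symmetric_at f Xs" "symmetric_at g Xs"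
  shows "symmetric_at (\<lambda>Zs. f Zs + g Zs) Xs"
proof -
  have *: "(a + a') + (b + b') + (c + c') = (a + b + c) + (a' + b' + c')" for a b c a' b' c' :: 'b
    by simp
  show ?thesis using assms by (simp add: symmetric_at_def *)
qed

lemma symmetric_at_scale:
  assumes "symmetric_at f Xs"
  shows "symmetric_at (\<lambda>Zs. fun_scale sV c (f Zs)) Xs"
  using assms by (simp add: symmetric_at_def fun_scale_def V.scale_right_distrib[symmetric])

lemma symmetric_at_cong: "(\<And>x y. f (Xs @ [tensor sT x y]) = g (Xs @ [tensor sT x y])) \<Longrightarrow> symmetric_at f Xs = symmetric_at g Xs"
  by (simp add: symmetric_at_def)

text \<open>The Lie derivative by \<open>a \<otimes> b\<close> applies \<open>D a b\<close> to the
  value and subtracts the three terms with \<open>[a,b,_]\<close> put on one of \<open>x\<close>,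
  \<open>y\<close>, \<open>z\<close>. For the first condition the two terms with a bracket inside
  the tensor cancel by skew-symmetry.\<close>

lemma symmetric_at_lie_tensor:
  assumes ml: "TML (Suc 0) f" and sym: "symmetric_at f []"
  shows "symmetric_at (R.lie (tensor sT a b) f) []"
proof -
  have Hom: "f [X] \<in> Hom_space sT sV" if "X \<in> tensor_space sT" for X
    using ml that by simp
  have add: "f [tensor_add X Y] = f [X] + f [Y]" if "X \<in> tensor_space sT" "Y \<in> tensor_space sT" for X Y
    using ml that by simp
  have alt: "f [tensor sT x x] y = 0"
    and cyc: "f [tensor sT x y] z + f [tensor sT y z] x + f [tensor sT z x] y = 0" for x y z
    using sym by (auto simp: symmetric_at_def)
  have skew: "f [tensor sT x y] z + f [tensor sT y x] z = 0" for x y z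
    using alt[of "x + y" z] \<comment> \<open>polarization\<close>
    by (simp add: tensor_add_left tensor_add_right add tensor_space_closed alt add.commute)
  have lie: "R.lie (tensor sT a b) f [tensor sT x y] z = D a b (f [tensor sT x y] z)
      - (f [tensor sT x y] (br a b z) + f [tensor sT (br a b x) y] z + f [tensor sT x (br a b y)] z)" for x y z
    by (simp add: left_action_simps Hom lact_def tensor_circ_tensor add)
  \<comment> \<open>The nine bracket terms are collected by the variable carrying the bracket. Each
    group of three is a cyclic sum for \<open>f\<close>: the \<open>x\<close> group is
    \<open>q1, p2, r3\<close>, the \<open>y\<close> group \<open>r1, q2, p3\<close>, the
    \<open>z\<close> group \<open>p1, r2, q3\<close>.\<close>
  have regroup: "(d1 - (p1 + q1 + r1)) + (d2 - (p2 + q2 + r2)) + (d3 - (p3 + q3 + r3)) = 0"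
    if "d1 + d2 + d3 = 0" "q1 + p2 + r3 = 0" "r1 + q2 + p3 = 0" "p1 + r2 + q3 = 0"
    for d1 d2 d3 p1 p2 p3 q1 q2 q3 r1 r2 r3 :: 'b
  proof -
    have "(d1 - (p1 + q1 + r1)) + (d2 - (p2 + q2 + r2)) + (d3 - (p3 + q3 + r3))
        = (d1 + d2 + d3) - (q1 + p2 + r3) - (r1 + q2 + p3) - (p1 + r2 + q3)"
      by (simp add: algebra_simps)
    then show ?thesis by (simp only: that diff_zero)
  qed
  show ?thesis
    unfolding symmetric_at_def append_Nil lie
  proof (intro allI conjI)
    fix x y z
    show "D a b (f [tensor sT x x] y) - (f [tensor sT x x] (br a b y) + f [tensor sT (br a b x) x] y
        + f [tensor sT x (br a b x)] y) = 0"
      using skew by (simp add: alt D_def th_simps)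
    have "D a b (f [tensor sT x y] z) + D a b (f [tensor sT y z] x) + D a b (f [tensor sT z x] y) = D a b 0"
      by (simp only: D_simps[symmetric] cyc)
    also have "D a b 0 = 0" by (simp add: D_def th_simps)
    finally show "D a b (f [tensor sT x y] z)
        - (f [tensor sT x y] (br a b z) + f [tensor sT (br a b x) y] z + f [tensor sT x (br a b y)] z)
      + (D a b (f [tensor sT y z] x)
        - (f [tensor sT y z] (br a b x) + f [tensor sT (br a b y) z] x + f [tensor sT y (br a b z)] x))
      + (D a b (f [tensor sT z x] y)
        - (f [tensor sT z x] (br a b y) + f [tensor sT (br a b z) x] y + f [tensor sT z (br a b x)] y)) = 0"
      by (rule regroup) (rule cyc[of "br a b x" y z] cyc[of x "br a b y" z] cyc[of x y "br a b z"])+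
  qed
qed

text \<open>Induction along \<open>i_Y L_X = L_X i_Y - i_(X \<circ> Y)\<close>. Symmetry is assumed
  at all leading lists because \<open>X \<circ> Y\<close> takes the place of \<open>Y\<close>. In
  the base case both conditions are linear in \<open>X\<close>, which may therefore be a pure
  tensor.\<close>

lemma symmetric_at_lie:
  "TML (Suc n) f \<Longrightarrow> X \<in> tensor_space sT \<Longrightarrow>
    (\<And>Xs. length Xs = n \<Longrightarrow> set Xs \<subseteq> tensor_space sT \<Longrightarrow> symmetric_at f Xs) \<Longrightarrow>
    length Xs = n \<Longrightarrow> set Xs \<subseteq> tensor_space sT \<Longrightarrow> symmetric_at (R.lie X f) Xs"
proof (induction n arbitrary: f Xs)
  case 0
  have ml: "TML (length [T]) f" for T using 0 by simp
  from 0(2) have "symmetric_at (R.lie X f) []"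
  proof (induction X rule: tensor_space_induct)
    case (tensor a b)
    show ?case using 0 by (intro symmetric_at_lie_tensor) auto
  next
    case (add X Y)
    have "R.lie (tensor_add X Y) f [tensor sT x y] = R.lie X f [tensor sT x y] + R.lie Y f [tensor sT x y]" for x y
      by (rule R.lie_add_left[OF ml]) (use add.hyps in auto)
    then show ?case
      using symmetric_at_add[OF add.IH] symmetric_at_cong[of "R.lie (tensor_add X Y) f" "[]" "\<lambda>Zs. R.lie X f Zs + R.lie Y f Zs"]
      unfolding append_Nil by blast
  next
    case (scale c X)
    have "R.lie (tensor_scale sT c X) f [tensor sT x y] = fun_scale sV c (R.lie X f [tensor sT x y])" for x y
      by (rule R.lie_scale_left[OF ml]) (use scale.hyps in auto)
    then show ?case
      using symmetric_at_scale[OF scale.IH] symmetric_at_cong[of "R.lie (tensor_scale sT c X) f" "[]" "\<lambda>Zs. fun_scale sV c (R.lie X f Zs)"]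
      unfolding append_Nil by blast
  qed
  then show ?case using 0 by simp
next
  case (Suc n)
  then obtain Y Ys where Xs: "Xs = Y # Ys" "Y \<in> tensor_space sT" "length Ys = n" "set Ys \<subseteq> tensor_space sT"
    by (cases Xs) auto
  have "symmetric_at (R.lie X (\<lambda>Zs. f (Y # Zs))) Ys"
  proof (rule Suc.IH[OF _ Suc.prems(2) _ Xs(3,4)])
    show "TML (Suc n) (\<lambda>Zs. f (Y # Zs))" using R.ml_Cons[OF Suc.prems(1) Xs(2)] .
    show "symmetric_at (\<lambda>Zs. f (Y # Zs)) Zs" if "length Zs = n" "set Zs \<subseteq> tensor_space sT" for Zs
      unfolding symmetric_at_Cons[symmetric] using that Xs(2) by (intro Suc.prems(3)) auto
  qed
  moreover have "symmetric_at (\<lambda>Zs. f (tensor_circ sT br X Y # Zs)) Ys"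
    unfolding symmetric_at_Cons[symmetric] using Xs Suc.prems(2) by (intro Suc.prems(3)) (auto simp: tensor_circ_closed)
  ultimately show ?case
    unfolding Xs(1) symmetric_at_Cons R.lie.simps by (rule symmetric_at_diff)
qed

text \<open>In degree 0 the coboundary of any homomorphism satisfies both conditions: the bracket
  terms vanish by the alternating and cyclic laws of the triple system, and the
  \<open>\<theta>\<close> terms cancel once \<open>D\<close> is expanded. Higher degrees follow from
  Cartan's formula and \<open>symmetric_at_lie\<close>.\<close>

lemma symmetric_at_cob:
  "TML n f \<Longrightarrow>
    (\<And>Xs. Suc (length Xs) = n \<Longrightarrow> set Xs \<subseteq> tensor_space sT \<Longrightarrow> symmetric_at f Xs) \<Longrightarrow>
    length Xs = n \<Longrightarrow> set Xs \<subseteq> tensor_space sT \<Longrightarrow> symmetric_at (R.cob f) Xs"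
proof (induction n arbitrary: f Xs)
  case 0
  have "f [] \<in> Hom_space sT sV" using 0 by simp
  then have cob: "R.cob f [tensor sT x y] z = D x y (f [] z) - f [] (br x y z) - th x z (f [] y) + th y z (f [] x)"
    and p: "f [] (a + b) = f [] a + f [] b" for x y z a b
    by (simp_all add: right_action_simps ract_def Hom_iff)
  have f0: "f [] 0 = 0" using p[of 0 0] by simp
  have cyc: "f [] (br x y z) + f [] (br y z x) + f [] (br z x y) = 0" for x y z
    by (simp add: p[symmetric] br_cyclic f0)
  have "symmetric_at (R.cob f) []"
    unfolding symmetric_at_def append_Nil cob
  proof (intro allI conjI)
    fix x y z
    show "D x x (f [] y) - f [] (br x x y) - th x y (f [] x) + th x y (f [] x) = 0"
      by (simp add: br_alternating f0 D_def)
    show "D x y (f [] z) - f [] (br x y z) - th x z (f [] y) + th y z (f [] x)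
      + (D y z (f [] x) - f [] (br y z x) - th y x (f [] z) + th z x (f [] y))
      + (D z x (f [] y) - f [] (br z x y) - th z y (f [] x) + th x y (f [] z)) = 0"
      using cyc[of x y z] by (simp add: D_def algebra_simps)
  qed
  then show ?case using 0 by simp
next
  case (Suc n)
  then obtain Y Ys where Xs: "Xs = Y # Ys" "Y \<in> tensor_space sT" "length Ys = n" "set Ys \<subseteq> tensor_space sT"
    by (cases Xs) auto
  have "symmetric_at (R.cob (\<lambda>Zs. f (Y # Zs))) Ys"
  proof (rule Suc.IH[OF _ _ Xs(3,4)])
    show "TML n (\<lambda>Zs. f (Y # Zs))" using R.ml_Cons[OF Suc.prems(1) Xs(2)] .
    show "symmetric_at (\<lambda>Zs. f (Y # Zs)) Zs" if "Suc (length Zs) = n" "set Zs \<subseteq> tensor_space sT" for Zs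
      unfolding symmetric_at_Cons[symmetric] using that Xs(2) by (intro Suc.prems(2)) auto
  qed
  moreover have "symmetric_at (R.lie Y f) Ys"
    using Suc.prems(2) by (intro symmetric_at_lie[OF Suc.prems(1) Xs(2) _ Xs(3,4)]) auto
  ultimately have "symmetric_at (\<lambda>Zs. R.lie Y f Zs - R.cob (\<lambda>Zs. f (Y # Zs)) Zs) Ys"
    by (intro symmetric_at_diff)
  then show ?case
    unfolding Xs(1) symmetric_at_Cons by (rule symmetric_at_cong[THEN iffD2, rotated]) simp
qed

lemma yamaguti_condition_iff_symmetric_at:
  "yamaguti_condition n f \<longleftrightarrow> (\<forall>Xs. Suc (length Xs) = n \<longrightarrow> set Xs \<subseteq> tensor_space sT \<longrightarrow> symmetric_at f Xs)"
  by (cases n) (auto simp: yamaguti_condition_def symmetric_at_def)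

lemma yamaguti_condition_lp_coboundary:
  assumes "f \<in> LP n" "yamaguti_condition n f"
  shows "yamaguti_condition (Suc n) (lpd (Suc n) f)"
  unfolding yamaguti_condition_iff_symmetric_at
proof (intro allI impI)
  fix Xs :: "('k, 'a) tensor2 list" assume Xs: "Suc (length Xs) = Suc n" "set Xs \<subseteq> tensor_space sT"
  have "symmetric_at (R.cob f) Xs"
    by (rule symmetric_at_cob[of n]) (use assms Xs in \<open>auto simp: lp_cochains_iff yamaguti_condition_iff_symmetric_at\<close>)
  then show "symmetric_at (lpd (Suc n) f) Xs"
    using Xs by (subst symmetric_at_cong[where g = "R.cob f"]) (auto intro!: R.lp_coboundary_eq_cob)
qed

text \<open>With \<open>n = Suc m\<close>, the \<open>D\<close> term for \<open>k\<close> and the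
  bracket term of \<open>k\<close> at position \<open>2n+1\<close> form the left action for
  \<open>k <= m\<close>. For \<open>k = n\<close> they join the two separate \<open>\<theta>\<close>
  terms to form the right action. The bracket terms at the other positions come in pairs and give
  the products.\<close>

lemma coboundary_compare:
  assumes w: "\<omega> \<in> Mult (2 * m + 1)" and xs: "length xs = 2 * Suc m"
  shows "lpd (Suc m) (regard sT sV m \<omega>) (pair_up sT (Suc m) xs) w = sV ((-1) ^ m) (yd (Suc m) \<omega> (xs @ [w]))"
proof -
  let ?n = "Suc m"
  let ?F = "regard sT sV m \<omega>"
  let ?X = "pair_up sT ?n xs"
  let ?ys = "xs @ [w]"
  \<comment> \<open>\<open>a k\<close> and \<open>b k\<close> are the arguments \<open>2k-1\<close>
    and \<open>2k\<close> counted from 1. \<open>E k u\<close> omits this pair and ends in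
    \<open>u\<close>; \<open>G k j\<close> is the bracket term that modifies argument
    \<open>j\<close>.\<close>
  define a b where "a k = xs ! (2 * k - 2)" and "b k = xs ! (2 * k - 1)" for k
  define E where "E k u = \<omega> (omit_pair k xs @ [u])" for k u
  define G where "G k j = \<omega> (omit_pair k (?ys[j - 1 := br (a k) (b k) (?ys ! (j - 1))]))" for k j
  have F: "?F \<in> LP m" by (rule regard_in_lp_cochains[OF w])
  have Xk: "?X ! (k - 1) = tensor sT (a k) (b k)" if k: "1 \<le> k" "k \<le> ?n" for k
  proof -
    obtain k' where "k = Suc k'" using k by (cases k) auto
    then show ?thesis using k by (simp add: pair_up_def a_def b_def del: upt_Suc)
  qed
  have Fomit: "?F (omit k (pair_up sT ?n zs)) u = \<omega> (omit_pair k zs @ [u])"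
    if "1 \<le> k" "k \<le> ?n" "length zs = 2 * ?n" for k u zs
    using omit_pair_up[OF that, of sT] regard_pair_up[OF w, of "omit_pair k zs" u] that
    by (simp add: length_omit_pair)
  have Hom: "?F (omit k ?X) \<in> Hom_space sT sV" if "1 \<le> k" "k \<le> ?n" for k
    unfolding omit_pair_up[OF that xs] using F by (simp add: lp_cochains_def set_pair_up)
  have E: "?F (omit k ?X) u = E k u" if "1 \<le> k" "k \<le> ?n" for k u
    using Fomit[OF that xs] by (simp add: E_def)
  have Glast: "G k (2 * ?n + 1) = E k (br (a k) (b k) w)" if "1 \<le> k" "k \<le> ?n" for k
    using that xs by (simp add: G_def E_def omit_pair_snoc list_update_append nth_append)
  have left: "left_action sT br sV \<theta> (?X ! (k - 1)) (?F (omit k ?X)) w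
      = D (a k) (b k) (E k w) - G k (2 * ?n + 1)" if "1 \<le> k" "k \<le> ?n" for k
    using that by (simp only: Xk left_action_simps Hom lact_def E Glast)
  have right: "right_action sT br sV \<theta> (?F (take (?n - 1) ?X)) (?X ! (?n - 1)) w
      = G ?n (2 * ?n + 1) - D (a ?n) (b ?n) (E ?n w)
        + th (a ?n) w (E ?n (b ?n)) - th (b ?n) w (E ?n (a ?n))"
  proof -
    \<comment> \<open>Dropping the last tensor is the omission of the pair \<open>?n\<close>, so the
      right action is expressed by the same \<open>E\<close> and \<open>G\<close>.\<close>
    have "take (?n - 1) ?X = omit ?n ?X" by (simp add: omit_def)
    moreover have "1 \<le> ?n" by simp
    ultimately show ?thesis by (simp only: Xk right_action_simps Hom ract_def E Glast order_refl)
  qed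
  have circ: "?F (omit k (?X[j - 1 := tensor_circ sT br (?X ! (k - 1)) (?X ! (j - 1))])) w
      = G k (2 * j - 1) + G k (2 * j)" if k: "1 \<le> k" "k < j" and j: "j \<le> ?n" for k j
  proof -
    have kn: "k \<le> ?n" "1 \<le> j" "k \<le> j - 1" "j - 1 < length ?X" using k j by simp_all
    define c where "c = br (a k) (b k) (a j)"
    define d where "d = br (a k) (b k) (b j)"
    have z: "?X ! (j - 1) = tensor sT (a j) (b j)" using Xk kn j by blast
    have upd: "pair_up sT ?n (xs[2 * j - 2 := c]) = ?X[j - 1 := tensor sT c (b j)]"
      "pair_up sT ?n (xs[2 * j - 1 := d]) = ?X[j - 1 := tensor sT (a j) d]"
    proof -
      obtain i where i: "j = Suc i" using kn by (cases j) auto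
      show "pair_up sT ?n (xs[2 * j - 2 := c]) = ?X[j - 1 := tensor sT c (b j)]"
        using pair_up_update[OF xs, of "2 * i" c] j by (simp add: i b_def)
      show "pair_up sT ?n (xs[2 * j - 1 := d]) = ?X[j - 1 := tensor sT (a j) d]"
        using pair_up_update[OF xs, of "2 * i + 1" d] j by (simp add: i a_def)
    qed
    \<comment> \<open>Since \<open>k < j\<close>, omitting the tensor \<open>k\<close> moves the
      tensor \<open>j\<close> to list index \<open>j - 2\<close>; there the product of two pure
      tensors splits by additivity.\<close>
    have "?F ((omit k ?X)[j - 1 - 1 := tensor_add (tensor sT c (b j)) (tensor sT (a j) d)])
        = ?F ((omit k ?X)[j - 1 - 1 := tensor sT c (b j)]) + ?F ((omit k ?X)[j - 1 - 1 := tensor sT (a j) d])"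
    proof -
      have "length (omit k ?X) = m" "set (omit k ?X) \<subseteq> tensor_space sT" "j - 1 - 1 < m"
        unfolding omit_pair_up[OF k(1) kn(1) xs] using k j by (simp_all add: set_pair_up)
      then show ?thesis using F tensor_in_space unfolding lp_cochains_def by blast
    qed
    then have "?F (omit k (?X[j - 1 := tensor_circ sT br (?X ! (k - 1)) (?X ! (j - 1))]))
        = ?F (omit k (pair_up sT ?n (xs[2 * j - 2 := c]))) + ?F (omit k (pair_up sT ?n (xs[2 * j - 1 := d])))"
      unfolding upd omit_update[OF k(1) kn(3,4)] z Xk[OF k(1) kn(1)] tensor_circ_tensor c_def[symmetric] d_def[symmetric] .
    moreover have "?F (omit k (pair_up sT ?n (xs[2 * j - 2 := c]))) w = G k (2 * j - 1)"
    proof -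
      have "?ys[2 * j - 1 - 1 := br (a k) (b k) (?ys ! (2 * j - 1 - 1))] = xs[2 * j - 2 := c] @ [w]"
      proof -
        have "2 * j - 1 - 1 = 2 * j - 2" "2 * j - 2 < length xs" using kn(2) j xs by arith+
        then show ?thesis by (simp only: list_update_append nth_append if_True c_def a_def)
      qed
      then show ?thesis
        using Fomit[OF k(1) kn(1), of "xs[2 * j - 2 := c]" w] xs kn by (simp add: G_def omit_pair_snoc)
    qed
    moreover have "?F (omit k (pair_up sT ?n (xs[2 * j - 1 := d]))) w = G k (2 * j)"
    proof -
      have "?ys[2 * j - 1 := br (a k) (b k) (?ys ! (2 * j - 1))] = xs[2 * j - 1 := d] @ [w]"
      proof -
        have "2 * j - 1 < length xs" using kn(2) j xs by arith
        then show ?thesis by (simp only: list_update_append nth_append if_True d_def b_def)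
      qed
      then show ?thesis
        using Fomit[OF k(1) kn(1), of "xs[2 * j - 1 := d]" w] xs kn by (simp add: G_def omit_pair_snoc)
    qed
    ultimately show ?thesis by simp
  qed
  define A where "A k = D (a k) (b k) (E k w)" for k
  have L: "lpd ?n ?F ?X w = (\<Sum>k=1..m. sV ((-1) ^ (k + 1)) (A k - G k (2 * ?n + 1)))
      + sV ((-1) ^ ?n) (G ?n (2 * ?n + 1) - A ?n + th (a ?n) w (E ?n (b ?n)) - th (b ?n) w (E ?n (a ?n)))
      + (\<Sum>k=1..?n. \<Sum>j=k + 1..?n. sV ((-1) ^ k) (G k (2 * j - 1) + G k (2 * j)))"
  proof -
    have "(\<Sum>k=1..?n - 1. sV ((-1) ^ (k + 1)) (left_action sT br sV \<theta> (?X ! (k - 1)) (?F (omit k ?X)) w))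
        = (\<Sum>k=1..m. sV ((-1) ^ (k + 1)) (A k - G k (2 * ?n + 1)))"
      by (rule sum.cong) (simp_all only: diff_Suc_1 atLeastAtMost_iff left le_SucI A_def)
    moreover have "(\<Sum>k=1..?n. \<Sum>j=k + 1..?n. sV ((-1) ^ k)
          (?F (omit k (?X[j - 1 := tensor_circ sT br (?X ! (k - 1)) (?X ! (j - 1))])) w))
        = (\<Sum>k=1..?n. \<Sum>j=k + 1..?n. sV ((-1) ^ k) (G k (2 * j - 1) + G k (2 * j)))"
      by (intro sum.cong refl arg_cong[where f = "sV _"] circ) auto
    ultimately show ?thesis
      using set_pair_up[of ?n xs]
      by (simp only: lp_coboundary_def Let_def length_pair_up simp_thms if_True if_False plus_fun_apply sum_fun_apply fun_scale_def[of sV]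
          right A_def)
  qed
  have take: "take (2 * ?n - 1) ?ys = omit_pair ?n xs @ [a ?n]" "take (2 * ?n - 2) ?ys = omit_pair ?n xs"
    using xs by (simp_all add: omit_pair_def a_def take_Suc_conv_app_nth)
  have Y: "yd ?n \<omega> ?ys = th (b ?n) w (E ?n (a ?n)) - th (a ?n) w (E ?n (b ?n))
      + (\<Sum>k=1..?n. sV ((-1) ^ (?n + k)) (A k))
      + (\<Sum>k=1..?n. \<Sum>j=2 * k + 1..2 * ?n + 1. sV ((-1) ^ (?n + k + 1)) (G k j))"
  proof -
    have nth: "?ys ! (2 * k - 1 - 1) = a k" "?ys ! (2 * k - 1) = b k" "omit_pair k ?ys = omit_pair k xs @ [w]"
      if "k \<in> {1..?n}" for k
      using that xs by (auto simp: a_def b_def nth_append omit_pair_snoc numeral_2_eq_2)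
    have last: "?ys ! (2 * ?n + 1 - 1) = w" using xs by (simp add: nth_append)
    have "(\<Sum>k=1..?n. sV ((-1) ^ (?n + k)) (D (?ys ! (2 * k - 1 - 1)) (?ys ! (2 * k - 1)) (\<omega> (omit_pair k ?ys))))
      = (\<Sum>k=1..?n. sV ((-1) ^ (?n + k)) (A k))"
      by (rule sum.cong) (simp_all only: nth A_def E_def)
    moreover have "(\<Sum>k=1..?n. \<Sum>j=2 * k + 1..2 * ?n + 1. sV ((-1) ^ (?n + k + 1))
        (\<omega> (omit_pair k (?ys[j - 1 := br (?ys ! (2 * k - 1 - 1)) (?ys ! (2 * k - 1)) (?ys ! (j - 1))]))))
      = (\<Sum>k=1..?n. \<Sum>j=2 * k + 1..2 * ?n + 1. sV ((-1) ^ (?n + k + 1)) (G k j))"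
      by (rule sum.cong) (simp_all only: nth G_def)
    moreover have "length ?ys = 2 * ?n + 1" "?n \<in> {1..?n}" using xs by simp_all
    ultimately show ?thesis
      by (simp only: yamaguti_coboundary_def Let_def simp_thms if_False last nth take E_def)
  qed
  define S where "S k = (\<Sum>j=k + 1..?n. G k (2 * j - 1) + G k (2 * j))" for k
  have "(\<Sum>k=1..?n. \<Sum>j=2 * k + 1..2 * ?n + 1. sV ((-1) ^ (?n + k + 1)) (G k j))
      = (\<Sum>k=1..?n. sV ((-1) ^ (?n + k + 1)) (S k + G k (2 * ?n + 1)))"
  proof (rule sum.cong[OF refl])
    fix k assume "k \<in> {1..?n}"
    then show "(\<Sum>j=2 * k + 1..2 * ?n + 1. sV ((-1) ^ (?n + k + 1)) (G k j))
        = sV ((-1) ^ (?n + k + 1)) (S k + G k (2 * ?n + 1))"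
      using sum_pairs[of k ?n "G k"] by (simp only: V.scale_sum_right[symmetric] atLeastAtMost_iff S_def)
  qed
  note Y = Y[unfolded this]
  \<comment> \<open>As \<open>?n = m + 1\<close>, the exponent \<open>m + ?n + k\<close> has the
    parity of \<open>k + 1\<close>.\<close>
  have sgn: "sV ((-1) ^ m) (sV ((-1) ^ (?n + k)) v) = sV ((-1) ^ (k + 1)) v"
    "sV ((-1) ^ m) (sV ((-1) ^ (?n + k + 1)) v) = sV ((-1) ^ k) v" for k v
    by (simp_all add: minus_one_power_iff)
  have "sV ((-1) ^ m) (yd ?n \<omega> ?ys) = sV ((-1) ^ m) (th (b ?n) w (E ?n (a ?n)) - th (a ?n) w (E ?n (b ?n)))
      + (\<Sum>k=1..?n. sV ((-1) ^ (k + 1)) (A k)) + (\<Sum>k=1..?n. sV ((-1) ^ k) (S k + G k (2 * ?n + 1)))"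
    unfolding Y V.scale_right_distrib[of "(-1) ^ m"] V.scale_sum_right[of "(-1) ^ m"] sgn ..
  \<comment> \<open>The summand \<open>k = ?n\<close> is split off: its \<open>D\<close> term and
    its bracket term at the last argument belong to the right action.\<close>
  also have "\<dots> = sV ((-1) ^ m) (th (b ?n) w (E ?n (a ?n)) - th (a ?n) w (E ?n (b ?n)))
      + (\<Sum>k=1..m. sV ((-1) ^ (k + 1)) (A k - G k (2 * ?n + 1))) + sV ((-1) ^ m) (A ?n - G ?n (2 * ?n + 1))
      + (\<Sum>k=1..?n. sV ((-1) ^ k) (S k))"
    by (simp add: V.scale_right_distrib V.scale_right_diff_distrib sum.distrib sum_subtractf sum_negf)
  also have "\<dots> = lpd ?n ?F ?X w"
    unfolding L V.scale_sum_right[symmetric] S_def[symmetric]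
    by (simp add: V.scale_right_distrib V.scale_right_diff_distrib algebra_simps)
  finally show ?thesis by simp
qed

section \<open>Transport of the complex structure to the Yamaguti cochains\<close>

lemma sign_sign: "sV ((-1) ^ m) (sV ((-1) ^ m) v) = v"
  by (simp add: minus_one_power_iff)

lemma yamaguti_coboundary_outside: "length xs \<noteq> 2 * n + 1 \<Longrightarrow> yd n \<omega> xs = 0"
  by (simp add: yamaguti_coboundary_def)

text \<open>The coboundary of \<open>regard sT sV m \<omega>\<close> is a cochain, hence of the form
  \<open>regard\<close> of a multilinear \<open>\<omega>'\<close>. The pointwise comparison then
  shows that the Yamaguti coboundary is \<open>\<omega>'\<close> up to sign; its multilinearity
  comes first and justifies applying \<open>regard\<close> to it.\<close>

lemma yamaguti_coboundary_in_multilinear_maps: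
  assumes w: "\<omega> \<in> Mult (2 * m + 1)"
  shows "yd (Suc m) \<omega> \<in> Mult (2 * Suc m + 1)"
    and "lpd (Suc m) (regard sT sV m \<omega>) = fun_scale (fun_scale sV) ((-1) ^ m) (regard sT sV (Suc m) (yd (Suc m) \<omega>))"
proof -
  let ?f = "lpd (Suc m) (regard sT sV m \<omega>)"
  have f: "?f \<in> LP (Suc m)" by (rule R.lp_coboundary_in_cochains[OF regard_in_lp_cochains[OF w]])
  define \<omega>' where "\<omega>' = unpair (Suc m) ?f"
  have w': "\<omega>' \<in> Mult (2 * Suc m + 1)" "regard sT sV (Suc m) \<omega>' = ?f"
    unfolding \<omega>'_def by (rule unpair_in_multilinear_maps[OF f], rule regard_unpair[OF f])
  have eq: "yd (Suc m) \<omega> = fun_scale sV ((-1) ^ m) \<omega>'"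
  proof
    fix xs
    show "yd (Suc m) \<omega> xs = fun_scale sV ((-1) ^ m) \<omega>' xs"
    proof (cases "length xs = 2 * Suc m + 1")
      case True
      then have xs: "xs = butlast xs @ [last xs]" "length (butlast xs) = 2 * Suc m"
        by (auto intro!: append_butlast_last_id[symmetric])
      have "\<omega>' xs = ?f (pair_up sT (Suc m) (butlast xs)) (last xs)"
        using True by (simp add: \<omega>'_def unpair_def)
      also have "\<dots> = sV ((-1) ^ m) (yd (Suc m) \<omega> xs)"
        using coboundary_compare[OF w xs(2), of "last xs"] xs(1) by simp
      finally show ?thesis by (simp only: fun_scale_def sign_sign)
    next
      case False
      then show ?thesis
        by (simp only: yamaguti_coboundary_outside[OF False] multilinear_maps_outside[OF w'(1) False] fun_scale_def V.scale_zero_right)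
    qed
  qed
  show "yd (Suc m) \<omega> \<in> Mult (2 * Suc m + 1)"
    unfolding eq by (rule FV.subspace_scale[OF subspace_multilinear_maps w'(1)])
  show "?f = fun_scale (fun_scale sV) ((-1) ^ m) (regard sT sV (Suc m) (yd (Suc m) \<omega>))"
    unfolding eq regard_scale[OF w'(1)] w'(2)
    by (simp only: fun_scale_def sign_sign)
qed

lemma regard_yamaguti_coboundary:
  assumes "\<omega> \<in> Mult (2 * m + 1)"
  shows "regard sT sV (Suc m) (yd (Suc m) \<omega>) = fun_scale (fun_scale sV) ((-1) ^ m) (lpd (Suc m) (regard sT sV m \<omega>))"
  unfolding yamaguti_coboundary_in_multilinear_maps(2)[OF assms] by (simp only: fun_scale_def sign_sign)

lemma subspace_yamaguti: "FV.subspace (yamaguti_cochains sT sV n)"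
proof -
  have *: "(a + a') + (b + b') + (c + c') = (a + b + c) + (a' + b' + c')" for a b c a' b' c' :: 'b
    by simp
  show ?thesis
    unfolding FV.subspace_def yamaguti_cochains_def
    using FV.subspace_0[OF subspace_multilinear_maps] FV.subspace_add[OF subspace_multilinear_maps] FV.subspace_scale[OF subspace_multilinear_maps]
    by (auto simp: * fun_scale_def[of sV _ _ ] V.scale_right_distrib[symmetric])
qed

lemma regard_eqD:
  "\<omega> \<in> Mult (2 * n + 1) \<Longrightarrow> \<omega>' \<in> Mult (2 * n + 1) \<Longrightarrow> regard sT sV n \<omega> = regard sT sV n \<omega>' \<Longrightarrow> \<omega> = \<omega>'"
  using regard_inj by (rule inj_onD)

text \<open>Linearity and square zero are equations between multilinear maps, so injectivity of
  \<open>regard\<close> moves them to the tensor side, where the sign is a scalar fixed by the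
  degree.\<close>

theorem yamaguti_complex:
  "cochain_complex (fun_scale sV) (yamaguti_cochains sT sV) (\<lambda>n. yd (n + 1))"
proof -
  interpret FFV: vector_space "fun_scale (fun_scale sV)"
    by (rule vector_space_fun_scale) (rule vector_space_Hom)
  have cc: "linear_on (LP n) (fun_scale (fun_scale sV)) (fun_scale (fun_scale sV)) (lpd (Suc n))" for n
    using R.lp_cochain_complex by (simp add: cochain_complex_def)
  have "linear_on (yamaguti_cochains sT sV n) (fun_scale sV) (fun_scale sV) (yd (Suc n))" for n
    unfolding linear_on_def
  proof (intro conjI ballI allI)
    fix \<omega> \<omega>' assume "\<omega> \<in> yamaguti_cochains sT sV n" "\<omega>' \<in> yamaguti_cochains sT sV n"
    then have w: "\<omega> \<in> Mult (2 * n + 1)" "\<omega>' \<in> Mult (2 * n + 1)" using yamaguti_subset by blast+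
    note add = FV.subspace_add[OF subspace_multilinear_maps]
    show "yd (Suc n) (\<omega> + \<omega>') = yd (Suc n) \<omega> + yd (Suc n) \<omega>'"
    proof (rule regard_eqD)
      have "lpd (Suc n) (regard sT sV n \<omega> + regard sT sV n \<omega>')
          = lpd (Suc n) (regard sT sV n \<omega>) + lpd (Suc n) (regard sT sV n \<omega>')"
        using cc regard_in_lp_cochains w unfolding linear_on_def by blast
      then show "regard sT sV (Suc n) (yd (Suc n) (\<omega> + \<omega>')) = regard sT sV (Suc n) (yd (Suc n) \<omega> + yd (Suc n) \<omega>')"
        by (simp only: regard_yamaguti_coboundary[OF add[OF w]] regard_add[OF w] regard_add[OF w[THEN yamaguti_coboundary_in_multilinear_maps(1)]]
            regard_yamaguti_coboundary[OF w(1)] regard_yamaguti_coboundary[OF w(2)] FFV.scale_right_distrib)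
    qed (intro yamaguti_coboundary_in_multilinear_maps add w)+
  next
    fix c \<omega> assume "\<omega> \<in> yamaguti_cochains sT sV n"
    then have w: "\<omega> \<in> Mult (2 * n + 1)" using yamaguti_subset by blast
    note scale = FV.subspace_scale[OF subspace_multilinear_maps]
    show "yd (Suc n) (fun_scale sV c \<omega>) = fun_scale sV c (yd (Suc n) \<omega>)"
    proof (rule regard_eqD)
      have "lpd (Suc n) (fun_scale (fun_scale sV) c (regard sT sV n \<omega>))
          = fun_scale (fun_scale sV) c (lpd (Suc n) (regard sT sV n \<omega>))"
        using cc regard_in_lp_cochains w unfolding linear_on_def by blast
      then show "regard sT sV (Suc n) (yd (Suc n) (fun_scale sV c \<omega>)) = regard sT sV (Suc n) (fun_scale sV c (yd (Suc n) \<omega>))"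
        by (simp only: regard_yamaguti_coboundary[OF scale[OF w]] regard_scale[OF w] regard_scale[OF w[THEN yamaguti_coboundary_in_multilinear_maps(1)]]
            regard_yamaguti_coboundary[OF w] FFV.scale_left_commute)
    qed (intro yamaguti_coboundary_in_multilinear_maps scale w)+
  qed
  moreover have "yd (Suc n) \<omega> \<in> yamaguti_cochains sT sV (Suc n)" if "\<omega> \<in> yamaguti_cochains sT sV n" for n \<omega>
  proof -
    have w: "\<omega> \<in> Mult (2 * n + 1)" using that yamaguti_subset by blast
    have "yamaguti_condition n (regard sT sV n \<omega>)" using that yamaguti_condition_regard_iff[OF w] by blast
    then have "yamaguti_condition (Suc n) (lpd (Suc n) (regard sT sV n \<omega>))" by (rule yamaguti_condition_lp_coboundary[OF regard_in_lp_cochains[OF w]])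
    then have "yamaguti_condition (Suc n) (regard sT sV (Suc n) (yd (Suc n) \<omega>))"
      unfolding regard_yamaguti_coboundary[OF w] yamaguti_condition_iff_symmetric_at fun_scale_def[of "fun_scale sV"] using symmetric_at_scale by blast
    then show ?thesis using yamaguti_condition_regard_iff[OF yamaguti_coboundary_in_multilinear_maps(1)[OF w]] by blast
  qed
  moreover have "yd (Suc (Suc n)) (yd (Suc n) \<omega>) = 0" if "\<omega> \<in> yamaguti_cochains sT sV n" for n \<omega>
  proof (rule regard_eqD)
    have w: "\<omega> \<in> Mult (2 * n + 1)" using that yamaguti_subset by blast
    show "yd (Suc (Suc n)) (yd (Suc n) \<omega>) \<in> Mult (2 * Suc (Suc n) + 1)" by (intro yamaguti_coboundary_in_multilinear_maps w)
    have zero: "regard sT sV (Suc (Suc n)) 0 = 0"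
      using regard_add[OF FV.subspace_0[OF subspace_multilinear_maps] FV.subspace_0[OF subspace_multilinear_maps], of "Suc (Suc n)"] by simp
    \<comment> \<open>The sign of the first coboundary sits between the two applications of
      \<open>lpd\<close>; linearity on cochains moves it outside before square zero is used.\<close>
    have "lpd (Suc (Suc n)) (fun_scale (fun_scale sV) c (lpd (Suc n) (regard sT sV n \<omega>)))
       = fun_scale (fun_scale sV) c (lpd (Suc (Suc n)) (lpd (Suc n) (regard sT sV n \<omega>)))" for c
      using cc[of "Suc n"] R.lp_coboundary_in_cochains[OF regard_in_lp_cochains[OF w]] unfolding linear_on_def by blast
    then show "regard sT sV (Suc (Suc n)) (yd (Suc (Suc n)) (yd (Suc n) \<omega>)) = regard sT sV (Suc (Suc n)) 0"
      by (simp only: zero regard_yamaguti_coboundary[OF yamaguti_coboundary_in_multilinear_maps(1)[OF w]] regard_yamaguti_coboundary[OF w]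
          R.lp_coboundary_square[OF regard_in_lp_cochains[OF w]] FFV.scale_zero_right)
  qed (rule FV.subspace_0[OF subspace_multilinear_maps])
  ultimately show ?thesis
    using subspace_yamaguti vector_space_Hom unfolding cochain_complex_def by (simp add: image_subset_iff)
qed

theorem lp_complex:
  "cochain_complex (fun_scale (fun_scale sV)) LP (\<lambda>n. lpd (n + 1))"
  by (rule R.lp_cochain_complex)

end

theorem theorem1p1:
  fixes sT :: "'k::alg_closed_field \<Rightarrow> 'a::ab_group_add \<Rightarrow> 'a"
    and br :: "'a \<Rightarrow> 'a \<Rightarrow> 'a \<Rightarrow> 'a"
    and sV :: "'k \<Rightarrow> 'b::ab_group_add \<Rightarrow> 'b"
    and \<theta> :: "('k, 'a) tensor2 \<Rightarrow> 'b \<Rightarrow> 'b"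
  assumes char: "CHAR('k) \<noteq> 2" "CHAR('k) \<noteq> 3"
    and T: "lie_triple_system sT br"
    and V: "lts_representation sT br sV \<theta>"
  shows "
    \<comment> \<open>the Loday-Pirashvili complex of \<open>T \<otimes> T\<close> with coefficients in \<open>Hom(T,V)\<close>\<close>
   (leibniz_algebra (tensor_space sT) tensor_add (tensor_zero sT) (tensor_scale sT) (tensor_circ sT br))
  \<and> (leibniz_representation (tensor_space sT) tensor_add (tensor_zero sT) (tensor_scale sT)
       (tensor_circ sT br) (fun_scale sV) (Hom_space sT sV)
       (left_action sT br sV \<theta>) (right_action sT br sV \<theta>))
  \<and> (cochain_complex (fun_scale (fun_scale sV)) (lts_lp_cochains sT sV)
       (\<lambda>n. lts_lp_coboundary sT br sV \<theta> (n + 1)))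
    \<comment> \<open>the Yamaguti complex\<close>
  \<and> (cochain_complex (fun_scale sV) (yamaguti_cochains sT sV)
       (\<lambda>n. yamaguti_coboundary sT br sV \<theta> (n + 1)))
    \<comment> \<open>the identification of multilinear maps with Loday-Pirashvili cochains\<close>
  \<and> (\<forall>n. \<forall>\<omega> \<in> multilinear_maps sT sV (2 * n + 1). \<forall>xs w. length xs = 2 * n \<longrightarrow>
       regard sT sV n \<omega> (pair_up sT n xs) w = \<omega> (xs @ [w]))
  \<and> (\<forall>n. linear_on (multilinear_maps sT sV (2 * n + 1)) (fun_scale sV) (fun_scale (fun_scale sV))
           (regard sT sV n) \<and>
         bij_betw (regard sT sV n) (multilinear_maps sT sV (2 * n + 1)) (lts_lp_cochains sT sV n))
    \<comment> \<open>under it, the Yamaguti cochains are the cochains subject to the two symmetry conditions\<close>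
  \<and> (\<forall>n. regard sT sV n ` yamaguti_cochains sT sV n =
       {f \<in> lts_lp_cochains sT sV n. n \<ge> 1 \<longrightarrow>
          (\<forall>Xs x y z. length Xs = n - 1 \<and> set Xs \<subseteq> tensor_space sT \<longrightarrow>
             f (Xs @ [tensor sT x x]) y = 0 \<and>
             f (Xs @ [tensor sT x y]) z + f (Xs @ [tensor sT y z]) x + f (Xs @ [tensor sT z x]) y = 0)})
    \<comment> \<open>and the coboundary operators agree, up to the sign inherent in the two formulas\<close>
  \<and> (\<forall>n \<ge> 1. \<forall>\<omega> \<in> multilinear_maps sT sV (2 * n - 1).
       lts_lp_coboundary sT br sV \<theta> n (regard sT sV (n - 1) \<omega>) =
         fun_scale (fun_scale sV) ((-1) ^ (n - 1))
           (regard sT sV n (yamaguti_coboundary sT br sV \<theta> n \<omega>)))"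
proof -
  interpret lts_representation sT br sV \<theta> by (rule V)
  \<comment> \<open>An index shift to \<open>m = n - 1\<close>, for which \<open>2 * n - 1\<close>
    is \<open>2 * m + 1\<close>.\<close>
  have compare: "lpd n (regard sT sV (n - 1) \<omega>)
      = fun_scale (fun_scale sV) ((-1) ^ (n - 1)) (regard sT sV n (yd n \<omega>))"
    if "n \<ge> 1" "\<omega> \<in> Mult (2 * n - 1)" for n \<omega>
    using that yamaguti_coboundary_in_multilinear_maps(2)[of \<omega> "n - 1"] by (cases n) simp_all
  show ?thesis
    by (intro conjI allI ballI impI leibniz_algebra_tensor leibniz_representation_Hom lp_complex
        yamaguti_complex regard_pair_up regard_linear regard_bij
        regard_yamaguti[unfolded yamaguti_condition_def] compare)
qed

end
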